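(* Let $(\ell,i)\in\{(6,2),(7,1),(7,2),(8,1),(8,2)\}$, let $\mathcal{E}_\ell$ be the root system of type $\mathrm{E}_\ell$, and let $\mathcal{S}^\ell_i\subset\mathcal{E}_\ell$ be the set of odd roots of the $\mathbb{Z}_2$-gradation labelled $(\ell,i)$ (described in the context). For every $\alpha_0\in\mathcal{S}^\ell_i$, the set $$\mathcal{Q}_{\ell,i,\alpha_0}=\{\alpha\in\mathcal{S}^\ell_i\mid(\alpha|\alpha_0)>0\}$$ is a maximal element of $\mathfrak{Q}_s(\mathcal{E}_\ell)$ and does not belong to $\mathfrak{Q}_\Upsilon(\mathcal{E}_\ell)$.
   Context: Root systems. Let $e_1,\dots,e_8$ be the canonical basis of $\mathbb{R}^8$ and, for $\varepsilon=(\epsilon_1,\dots,\epsilon_8)$ with $\epsilon_j=\pm1$ and $\prod\epsilon_j=1$, let $\beta_\varepsilon=\frac12\sum\epsilon_je_j$. Then $\mathcal{E}_6=\{\pm e_i\pm e_j\mid1\le i<j\le5\}\cup\{\beta_\varepsilon\mid\epsilon_6=\epsilon_7=-\epsilon_8\}$; $\mathcal{E}_7=\{\pm e_i\pm e_j\mid1\le i<j\le6\}\cup\{\pm(e_7-e_8)\}\cup\{\beta_\varepsilon\mid\epsilon_7+\epsilon_8=0\}$; $\mathcal{E}_8=\{\pm e_i\pm e_j\mid1\le i<j\le8\}\cup\{\beta_\varepsilon\}$. $(\cdot|\cdot)$ is the Euclidean scalar product. Put $\beta_0=\frac12\sum_{j=1}^8e_j$, $\beta_{i,j}=\beta_0-e_i-e_j$,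 $\beta_{i,j,h,k}=\beta_0-e_i-e_j-e_h-e_k$ for distinct indices. The sets $\mathcal{S}^\ell_i$: $\mathcal{S}^6_2=\{\pm(e_i+e_j),\ \pm\beta_{i,j,6,7}\mid1\le i<j\le5\}$; $\mathcal{S}^7_1=\{\beta_\varepsilon\mid\epsilon_7+\epsilon_8=0\}$; $\mathcal{S}^7_2=\{\pm(e_i+e_j)\mid1\le i<j\le6\}\cup\{\beta_{i,j,h,7},\beta_{i,j,h,8}\mid1\le i<j<h\le6\}$; $\mathcal{S}^8_1=\{\beta_\varepsilon\}$ (all $\beta_\varepsilon$); $\mathcal{S}^8_2=\{\pm(e_i+e_j),\ \pm\beta_{i,j}\mid1\le i<j\le8\}$. Each of them is the set of roots $\alpha\in\mathcal{E}_\ell$ with $\mathfrak{g}^\alpha\subset\mathfrak{g}_{(1)}$ for an inner $\mathbb{Z}_2$-gradation $\mathfrak{g}=\mathfrak{g}_{(0)}\oplus\mathfrak{g}_{(1)}$ of the complex simple Lie algebra of type $\mathrm{E}_\ell$ with $\mathfrak{h}\subset\mathfrak{g}_{(0)}$. Notation. Let $\mathcal{R}=\mathcal{E}_\ell$, $\mathfrak{g}$ the complex simple Lie algebra with root system $\mathcal{R}$ for a Cartan subalgebra $\mathfrak{h}$, which is the complexification of a Cartan subalgebra $\mathfrak{t}_0$ of a compact real form $\mathfrak{u}_0$. Bars denote conjugation with respect to $\mathfrak{u}_0$. $\mathfrak{Q}(\mathcal{R})$ is the collection of $\mathcal{Q}\subset\mathcal{R}$ such that: $\alpha\in\mathcal{Q}\Rightarrow-\alpha\notin\mathcal{Q}$;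 $\alpha,\beta\in\mathcal{Q}\Rightarrow\alpha+\beta\notin\mathcal{R}$; and $\mathcal{R}\subset\mathbb{Z}[\mathcal{Q}]$ (the additive group generated by $\mathcal{Q}$). For $\mathcal{Q}\in\mathfrak{Q}(\mathcal{R})$ let $\mathfrak{q}=\mathfrak{h}\oplus\sum_{\alpha\in\mathcal{Q}}\mathfrak{g}^\alpha$ and $\mathfrak{V}_0=\{\mathrm{Re}\,Z\mid Z\in\mathfrak{q}\}\subset\mathfrak{u}_0$. $\mathfrak{Q}_s(\mathcal{R})$ is the set of $\mathcal{Q}\in\mathfrak{Q}(\mathcal{R})$ for which $(\mathfrak{u}_0,\mathfrak{q})$ is $CR$-symmetric: there is an involution $\lambda$ of the Lie algebra $\mathfrak{g}$ with $\lambda(\mathfrak{u}_0)=\mathfrak{u}_0$, $\ker(\mathrm{Id}-\lambda)$ contained in the Lie subalgebra generated by $\mathfrak{q}+\bar{\mathfrak{q}}$, $\lambda(\mathfrak{q})=\mathfrak{q}$, and $Z+\lambda(Z)\in\mathfrak{q}\cap\bar{\mathfrak{q}}$ for all $Z\in\mathfrak{q}$ (the general definition also asks that $\mathfrak{q}\cap\mathfrak{u}_0=\mathfrak t_0$ be almost compact, automatic here). $\mathfrak{Q}_\Upsilon(\mathcal{R})$ is the set of $\mathcal{Q}\in\mathfrak{Q}(\mathcal{R})$ for which $(\mathfrak{u}_0,\mathfrak{q})$ has the weak-$J$-property: there is $J\in\mathrm{Der}(\mathfrak{u}_0)$ such that $\Upsilon=\exp(\pi J/2)$ satisfies $\Upsilon(\mathfrak{t}_0)=\mathfrak{t}_0$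 and $X+i\Upsilon(X)\in\mathfrak{q}$ for all $X\in\mathfrak{V}_0$. Maximal means maximal for inclusion. *)

theory Defs
  imports
    "HOL-Analysis.Analysis"
    "HOL-Computational_Algebra.Group_Closure"
begin

section \<open>Roots of type E and the odd roots of the gradations\<close>

text \<open>Coordinates of \<open>\<real>\<^sup>8\<close> are indexed by the eight-element type \<open>8\<close>, whose elements are
  \<open>1, \<dots>, 7\<close> and \<open>8 = 0\<close>. Index sets are enumerated explicitly: the library order on this type
  puts \<open>8\<close> first, so that for instance \<open>{1..8::8}\<close> is empty.\<close>

abbreviation ax :: "8 \<Rightarrow> real^8" where
  "ax i \<equiv> axis i 1"

definition even_signs :: "(8 \<Rightarrow> real) set" where
  "even_signs = {\<epsilon>. (\<forall>j. \<epsilon> j = 1 \<or> \<epsilon> j = -1) \<and> (\<Prod>j\<in>UNIV. \<epsilon> j) = 1}"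

definition spin :: "(8 \<Rightarrow> real) \<Rightarrow> real^8" where
  "spin \<epsilon> = (1/2) *\<^sub>R (\<Sum>j\<in>UNIV. \<epsilon> j *\<^sub>R ax j)"

definition beta0 :: "real^8" where
  "beta0 = (1/2) *\<^sub>R (\<Sum>j\<in>UNIV. ax j)"

definition beta2 :: "8 \<Rightarrow> 8 \<Rightarrow> real^8" where
  "beta2 i j = beta0 - ax i - ax j"

definition beta4 :: "8 \<Rightarrow> 8 \<Rightarrow> 8 \<Rightarrow> 8 \<Rightarrow> real^8" where
  "beta4 i j h k = beta0 - ax i - ax j - ax h - ax k"

definition D_roots :: "8 set \<Rightarrow> (real^8) set" where
  "D_roots I = {s *\<^sub>R ax i + t *\<^sub>R ax j | s t i j.
     (s = 1 \<or> s = -1) \<and> (t = 1 \<or> t = -1) \<and> i \<in> I \<and> j \<in> I \<and> i \<noteq> j}"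

definition pm_sums :: "8 set \<Rightarrow> (real^8) set" where
  "pm_sums I = {s *\<^sub>R (ax i + ax j) | s i j. (s = 1 \<or> s = -1) \<and> i \<in> I \<and> j \<in> I \<and> i \<noteq> j}"

definition E6_roots :: "(real^8) set" where
  "E6_roots = D_roots {1,2,3,4,5} \<union>
     {spin \<epsilon> | \<epsilon>. \<epsilon> \<in> even_signs \<and> \<epsilon> 6 = \<epsilon> 7 \<and> \<epsilon> 7 = - \<epsilon> 8}"

definition E7_roots :: "(real^8) set" where
  "E7_roots = D_roots {1,2,3,4,5,6} \<union> {ax 7 - ax 8, ax 8 - ax 7} \<union>
     {spin \<epsilon> | \<epsilon>. \<epsilon> \<in> even_signs \<and> \<epsilon> 7 + \<epsilon> 8 = 0}"

definition E8_roots :: "(real^8) set" where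
  "E8_roots = D_roots {1,2,3,4,5,6,7,8} \<union> {spin \<epsilon> | \<epsilon>. \<epsilon> \<in> even_signs}"

definition E_roots :: "nat \<Rightarrow> (real^8) set" where
  "E_roots l = (if l = 6 then E6_roots else if l = 7 then E7_roots
     else if l = 8 then E8_roots else {})"

definition S62 :: "(real^8) set" where
  "S62 = pm_sums {1,2,3,4,5} \<union>
     {s *\<^sub>R beta4 i j 6 7 | s i j. (s = 1 \<or> s = -1) \<and>
        i \<in> {1,2,3,4,5} \<and> j \<in> {1,2,3,4,5} \<and> i \<noteq> j}"

definition S71 :: "(real^8) set" where
  "S71 = {spin \<epsilon> | \<epsilon>. \<epsilon> \<in> even_signs \<and> \<epsilon> 7 + \<epsilon> 8 = 0}"

definition S72 :: "(real^8) set" where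
  "S72 = pm_sums {1,2,3,4,5,6} \<union>
     {beta4 i j h k | i j h k.
        i \<in> {1,2,3,4,5,6} \<and> j \<in> {1,2,3,4,5,6} \<and> h \<in> {1,2,3,4,5,6} \<and>
        i \<noteq> j \<and> i \<noteq> h \<and> j \<noteq> h \<and> (k = 7 \<or> k = 8)}"

definition S81 :: "(real^8) set" where
  "S81 = {spin \<epsilon> | \<epsilon>. \<epsilon> \<in> even_signs}"

definition S82 :: "(real^8) set" where
  "S82 = pm_sums {1,2,3,4,5,6,7,8} \<union>
     {s *\<^sub>R beta2 i j | s i j. (s = 1 \<or> s = -1) \<and>
        i \<in> {1,2,3,4,5,6,7,8} \<and> j \<in> {1,2,3,4,5,6,7,8} \<and> i \<noteq> j}"

definition odd_roots :: "nat \<Rightarrow> nat \<Rightarrow> (real^8) set" where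
  "odd_roots l i =
     (if (l, i) = (6, 2) then S62 else if (l, i) = (7, 1) then S71
      else if (l, i) = (7, 2) then S72 else if (l, i) = (8, 1) then S81
      else if (l, i) = (8, 2) then S82 else {})"

section \<open>The combinatorial collection \<open>\<QQ>(R)\<close>\<close>

definition QQ :: "'v::ab_group_add set \<Rightarrow> 'v set set" where
  "QQ R = {Q. Q \<subseteq> R \<and> (\<forall>\<alpha>\<in>Q. - \<alpha> \<notin> Q) \<and>
     (\<forall>\<alpha>\<in>Q. \<forall>\<beta>\<in>Q. \<alpha> + \<beta> \<notin> R) \<and> R \<subseteq> group_closure Q}"

definition Q_set :: "nat \<Rightarrow> nat \<Rightarrow> real^8 \<Rightarrow> (real^8) set" where
  "Q_set l i \<alpha>\<^sub>0 = {\<alpha> \<in> odd_roots l i. \<alpha> \<bullet> \<alpha>\<^sub>0 > 0}"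

definition maximal_in :: "'v set set \<Rightarrow> 'v set \<Rightarrow> bool" where
  "maximal_in \<A> Q \<longleftrightarrow> Q \<in> \<A> \<and> (\<forall>Q'\<in>\<A>. Q \<subseteq> Q' \<longrightarrow> Q' = Q)"

section \<open>Real Lie algebras inside a bracket\<close>

text \<open>Lie algebras over \<open>\<real>\<close> are subspaces \<open>V\<close> of an ambient real vector space carrying a
  bracket \<open>br\<close>.\<close>

definition lie_subalgebra :: "('g::real_vector \<Rightarrow> 'g \<Rightarrow> 'g) \<Rightarrow> 'g set \<Rightarrow> bool" where
  "lie_subalgebra br V \<longleftrightarrow> subspace V \<and> (\<forall>X\<in>V. \<forall>Y\<in>V. br X Y \<in> V)"

primrec lower_central :: "('g::real_vector \<Rightarrow> 'g \<Rightarrow> 'g) \<Rightarrow> 'g set \<Rightarrow> nat \<Rightarrow> 'g set" where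
  "lower_central br V 0 = V"
| "lower_central br V (Suc n) = span {br X Y | X Y. X \<in> V \<and> Y \<in> lower_central br V n}"

definition lie_nilpotent :: "('g::real_vector \<Rightarrow> 'g \<Rightarrow> 'g) \<Rightarrow> 'g set \<Rightarrow> bool" where
  "lie_nilpotent br V \<longleftrightarrow> (\<exists>n. lower_central br V n = {0})"

text \<open>Nilpotent and equal to its own normalizer. Nilpotency and normalizers do not depend on
  whether the scalars are \<open>\<real>\<close> or \<open>\<complex>\<close>, so a complex subspace of a complex Lie algebra is a Cartan
  subalgebra over \<open>\<complex>\<close> iff it satisfies this predicate.\<close>

definition cartan_subalgebra :: "('g::real_vector \<Rightarrow> 'g \<Rightarrow> 'g) \<Rightarrow> 'g set \<Rightarrow> 'g set \<Rightarrow> bool" where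
  "cartan_subalgebra br V H \<longleftrightarrow> H \<subseteq> V \<and> lie_subalgebra br H \<and> lie_nilpotent br H \<and>
     {X\<in>V. \<forall>Y\<in>H. br X Y \<in> H} = H"

text \<open>Trace of an \<open>\<real>\<close>-linear map \<open>V \<rightarrow> V\<close> on a finite-dimensional subspace \<open>V\<close>; the value does not
  depend on the chosen basis.\<close>

definition trace_on :: "'g::real_vector set \<Rightarrow> ('g \<Rightarrow> 'g) \<Rightarrow> real" where
  "trace_on V f = (let B = (SOME B. independent B \<and> span B = V)
     in \<Sum>b\<in>B. representation B (f b) b)"

definition killing :: "('g::real_vector \<Rightarrow> 'g \<Rightarrow> 'g) \<Rightarrow> 'g set \<Rightarrow> 'g \<Rightarrow> 'g \<Rightarrow> real" where
  "killing br V X Y = trace_on V (\<lambda>Z. br X (br Y Z))"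

definition derivation :: "('g::real_vector \<Rightarrow> 'g \<Rightarrow> 'g) \<Rightarrow> 'g set \<Rightarrow> ('g \<Rightarrow> 'g) \<Rightarrow> bool" where
  "derivation br V J \<longleftrightarrow> J ` V \<subseteq> V \<and>
     (\<forall>X\<in>V. \<forall>Y\<in>V. J (X + Y) = J X + J Y) \<and> (\<forall>r. \<forall>X\<in>V. J (r *\<^sub>R X) = r *\<^sub>R J X) \<and>
     (\<forall>X\<in>V. \<forall>Y\<in>V. J (br X Y) = br (J X) Y + br X (J Y))"

definition exp_end :: "('g::real_normed_vector \<Rightarrow> 'g) \<Rightarrow> 'g \<Rightarrow> 'g" where
  "exp_end J X = (\<Sum>n. (1 / fact n) *\<^sub>R (J ^^ n) X)"

section \<open>Complex Lie algebras\<close>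

text \<open>A finite-dimensional complex Lie algebra on the type \<open>'g\<close>, with complex scalar
  multiplication \<open>cs\<close> extending the real one. The class \<open>euclidean_space\<close> provides
  finite-dimensionality and the vector space topology; its inner product is unrelated to \<open>br\<close>.\<close>

locale complex_lie_algebra = cx: vector_space cs
  for cs :: "complex \<Rightarrow> 'g::euclidean_space \<Rightarrow> 'g" +
  fixes br :: "'g \<Rightarrow> 'g \<Rightarrow> 'g"
  assumes cs_of_real: "cs (of_real r) X = r *\<^sub>R X"
    and br_add_left: "br (X + Y) Z = br X Z + br Y Z"
    and br_add_right: "br X (Y + Z) = br X Y + br X Z"
    and br_scale_left: "br (cs c X) Y = cs c (br X Y)"
    and br_scale_right: "br X (cs c Y) = cs c (br X Y)"
    and br_self: "br X X = 0"
    and jacobi: "br X (br Y Z) + br Y (br Z X) + br Z (br X Y) = 0"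
begin

definition complex_subalgebra :: "'g set \<Rightarrow> bool" where
  "complex_subalgebra V \<longleftrightarrow> cx.subspace V \<and> (\<forall>X\<in>V. \<forall>Y\<in>V. br X Y \<in> V)"

definition complex_ideal :: "'g set \<Rightarrow> bool" where
  "complex_ideal V \<longleftrightarrow> cx.subspace V \<and> (\<forall>X. \<forall>Y\<in>V. br X Y \<in> V)"

definition simple :: bool where
  "simple \<longleftrightarrow> (\<exists>X Y. br X Y \<noteq> 0) \<and> (\<forall>V. complex_ideal V \<longrightarrow> V = {0} \<or> V = UNIV)"

definition complexification :: "'g set \<Rightarrow> 'g set" where
  "complexification V = {X + cs \<i> Y | X Y. X \<in> V \<and> Y \<in> V}"

definition real_form :: "'g set \<Rightarrow> bool" where
  "real_form U \<longleftrightarrow> lie_subalgebra br U \<and> U \<inter> cs \<i> ` U = {0} \<and> complexification U = UNIV"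

definition compact_real_form :: "'g set \<Rightarrow> bool" where
  "compact_real_form U \<longleftrightarrow> real_form U \<and> (\<forall>X\<in>U. X \<noteq> 0 \<longrightarrow> killing br U X X < 0)"

definition re_part :: "'g set \<Rightarrow> 'g \<Rightarrow> 'g" where
  "re_part U Z = (THE X. X \<in> U \<and> (\<exists>Y\<in>U. Z = X + cs \<i> Y))"

definition im_part :: "'g set \<Rightarrow> 'g \<Rightarrow> 'g" where
  "im_part U Z = (THE Y. Y \<in> U \<and> (\<exists>X\<in>U. Z = X + cs \<i> Y))"

definition lie_conj :: "'g set \<Rightarrow> 'g \<Rightarrow> 'g" where
  "lie_conj U Z = re_part U Z - cs \<i> (im_part U Z)"

text \<open>Linear functionals on \<open>H\<close>, extended by \<open>0\<close> outside \<open>H\<close> so that distinct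
  functions are distinct functionals.\<close>

definition functionals :: "'g set \<Rightarrow> ('g \<Rightarrow> complex) set" where
  "functionals H = {\<phi>. (\<forall>X\<in>H. \<forall>Y\<in>H. \<phi> (X + Y) = \<phi> X + \<phi> Y) \<and>
     (\<forall>c. \<forall>X\<in>H. \<phi> (cs c X) = c * \<phi> X) \<and> (\<forall>X. X \<notin> H \<longrightarrow> \<phi> X = 0)}"

definition root_space :: "'g set \<Rightarrow> ('g \<Rightarrow> complex) \<Rightarrow> 'g set" where
  "root_space H \<phi> = {X. \<forall>T\<in>H. br T X = cs (\<phi> T) X}"

definition roots :: "'g set \<Rightarrow> ('g \<Rightarrow> complex) set" where
  "roots H = {\<phi>\<in>functionals H. \<phi> \<noteq> (\<lambda>X. 0) \<and> root_space H \<phi> \<noteq> {0}}"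

text \<open>An identification of an abstract root system \<open>R\<close> with the roots of \<open>H\<close>: an injective
  \<open>\<real>\<close>-linear map from the span of \<open>R\<close> to the dual of \<open>H\<close> that maps \<open>R\<close> onto the set of
  roots.\<close>

definition root_identification ::
    "'g set \<Rightarrow> 'v::real_vector set \<Rightarrow> ('v \<Rightarrow> 'g \<Rightarrow> complex) \<Rightarrow> bool" where
  "root_identification H R \<rho> \<longleftrightarrow>
     (\<forall>x\<in>span R. \<forall>y\<in>span R. \<forall>T. \<rho> (x + y) T = \<rho> x T + \<rho> y T) \<and>
     (\<forall>r. \<forall>x\<in>span R. \<forall>T. \<rho> (r *\<^sub>R x) T = of_real r * \<rho> x T) \<and>
     inj_on \<rho> (span R) \<and> \<rho> ` R = roots H"

definition lie_involution :: "('g \<Rightarrow> 'g) \<Rightarrow> bool" where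
  "lie_involution \<theta> \<longleftrightarrow> Vector_Spaces.linear cs cs \<theta> \<and>
     (\<forall>X Y. \<theta> (br X Y) = br (\<theta> X) (\<theta> Y)) \<and> (\<forall>X. \<theta> (\<theta> X) = X)"

text \<open>\<open>CR_symmetric U q\<close> omits the condition that \<open>q \<inter> U\<close> be almost compact, which is automatic
  for the subalgebras \<open>q\<close> considered below.\<close>

definition CR_symmetric :: "'g set \<Rightarrow> 'g set \<Rightarrow> bool" where
  "CR_symmetric U q \<longleftrightarrow> (\<exists>\<theta>. lie_involution \<theta> \<and> \<theta> ` U = U \<and>
     {X. X - \<theta> X = 0} \<subseteq> complex_subalgebra hull {Z + W | Z W. Z \<in> q \<and> W \<in> lie_conj U ` q} \<and>
     \<theta> ` q = q \<and> (\<forall>Z\<in>q. Z + \<theta> Z \<in> q \<inter> lie_conj U ` q))"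

definition weak_J :: "'g set \<Rightarrow> 'g set \<Rightarrow> 'g set \<Rightarrow> bool" where
  "weak_J U T q \<longleftrightarrow> (\<exists>J. derivation br U J \<and>
     (let \<Upsilon> = exp_end (\<lambda>X. (pi / 2) *\<^sub>R J X)
      in \<Upsilon> ` T = T \<and> (\<forall>X \<in> re_part U ` q. X + cs \<i> (\<Upsilon> X) \<in> q)))"

end

section \<open>Compact real forms with a given root system\<close>

locale compact_root_data = complex_lie_algebra cs br
  for cs :: "complex \<Rightarrow> 'g::euclidean_space \<Rightarrow> 'g" and br :: "'g \<Rightarrow> 'g \<Rightarrow> 'g" +
  fixes u0 t0 h :: "'g set" and R :: "'v::real_vector set" and \<rho> :: "'v \<Rightarrow> 'g \<Rightarrow> complex"
  assumes simple_g: simple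
    and compact_u0: "compact_real_form u0"
    and cartan_t0: "cartan_subalgebra br u0 t0"
    and h_eq: "h = complexification t0"
    and cartan_h: "cx.subspace h" "cartan_subalgebra br UNIV h"
    and root_id: "root_identification h R \<rho>"
begin

definition qq :: "'v set \<Rightarrow> 'g set" where
  "qq Q = cx.span (h \<union> (\<Union>\<alpha>\<in>Q. root_space h (\<rho> \<alpha>)))"

definition QQ_s :: "'v set set" where
  "QQ_s = {Q \<in> QQ R. CR_symmetric u0 (qq Q)}"

definition QQ_\<Upsilon> :: "'v set set" where
  "QQ_\<Upsilon> = {Q \<in> QQ R. weak_J u0 t0 (qq Q)}"

end

end

theory Submission
  imports Defs "HOL-Computational_Algebra.Fundamental_Theorem_Algebra"
begin

text \<open>The odd roots are those on which the product with a fixed vector \<open>b\<close> is odd, and the two facts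
  about them that matter are: any two orthogonal odd roots \<open>\<alpha>\<^sub>0, \<beta>\<close> admit an odd \<open>\<alpha>\<close> with
  \<open>(\<alpha>|\<alpha>\<^sub>0) = 1\<close> and \<open>(\<alpha>|\<beta>) = -1\<close>, and every odd root is orthogonal to some odd root.

  The involution defining the symmetry is \<open>1\<close> on the even and \<open>-1\<close> on the odd root spaces. For a
  larger \<open>Q'\<close>, its involution fixes \<open>h\<close> and is \<open>-1\<close> on the root spaces of \<open>\<plusminus>Q\<close>, which generate
  the algebra; so it is the same one and \<open>Q'\<close> consists of odd roots. An odd root \<open>\<beta>\<close> with
  \<open>(\<beta>|\<alpha>\<^sub>0) = 0\<close> cannot be added because of the \<open>\<alpha>\<close> above.

  If \<open>\<Upsilon>\<close> witnesses the weak-\<open>J\<close>-property, it is forced to be \<open>-i\<close> on the root spaces of \<open>Q\<close> and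
  \<open>i\<close> on those of \<open>-Q\<close>. For odd \<open>\<beta>\<close> orthogonal to \<open>\<alpha>\<^sub>0\<close>, both \<open>\<beta>\<close> and \<open>-\<beta>\<close> have the form
  \<open>\<alpha>\<^sub>1 + \<alpha>\<^sub>2 - \<alpha>\<^sub>0\<close> with \<open>\<alpha>\<^sub>1, \<alpha>\<^sub>2 \<in> Q\<close>, so \<open>\<Upsilon>\<close> is \<open>-i\<close> on both root spaces, although they are
  conjugate.

  On the side of Lie theory, the Killing form yields a real inner product for which \<open>ad Z\<close> has
  adjoint \<open>- ad (cj Z)\<close>; this gives the root decomposition and the surjectivity of the brackets
  \<open>[g\<^sup>\<alpha>, g\<^sup>\<beta>] = g\<^sup>\<alpha>\<^sup>+\<^sup>\<beta>\<close> without the representation theory of \<open>sl\<^sub>2\<close>.\<close>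

subsection \<open>Real forms and their conjugation\<close>

text \<open>Nothing ties the Euclidean product of the roots to the Killing form:
  \<open>root_identification\<close> only provides an injective linear map on the span of the roots.
  What passes from the combinatorics to the algebra is therefore always the information which sums
  of roots are roots, and the product in \<real>^8 serves to decide that.

  The dimension of a root space is never computed. Nonvanishing of brackets would then be too weak,
  both for generating the algebra and for determining \<Upsilon> on a whole root space; surjectivity
  is needed. It comes from root strings of length two, where \<open>ad Z\<close> composed with
  \<open>ad (cj Z)\<close> is a scalar on the upper space, and it suffices that this scalar is not
  0.

  The weak-J condition speaks only of real parts. Using it for the real parts of both Z and iZ
  isolates the vector conjugate to Z; this pins down \<Upsilon> on the root spaces of -Q, and
  conjugation then gives those of Q.\<close>

context complex_lie_algebra
begin

lemma br_zero_left [simp]: "br 0 Y = 0"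
  using br_add_left[of 0 0 Y] by simp

lemma br_zero_right [simp]: "br X 0 = 0"
  using br_add_right[of X 0 0] by simp

lemma br_scaleR_left: "br (r *\<^sub>R X) Y = r *\<^sub>R br X Y"
  by (metis br_scale_left cs_of_real)

lemma br_scaleR_right: "br X (r *\<^sub>R Y) = r *\<^sub>R br X Y"
  by (metis br_scale_right cs_of_real)

lemma br_minus_left: "br (- X) Y = - br X Y"
  using br_scaleR_left[of "-1" X Y] by simp

lemma br_minus_right: "br X (- Y) = - br X Y"
  using br_scaleR_right[of X "-1" Y] by simp

lemma br_diff_left: "br (X - X') Y = br X Y - br X' Y"
  using br_add_left[of X "- X'" Y] by (simp add: br_minus_left)

lemma br_diff_right: "br X (Y - Y') = br X Y - br X Y'"
  using br_add_right[of X Y "- Y'"] by (simp add: br_minus_right)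

lemma br_anti: "br X Y = - br Y X"
proof -
  have "br (X + Y) (X + Y) = br X X + br X Y + (br Y X + br Y Y)"
    by (simp only: br_add_left br_add_right) (simp add: algebra_simps)
  then show ?thesis by (simp add: br_self eq_neg_iff_add_eq_0)
qed

lemma br_br_left: "br (br X Y) Z = br X (br Y Z) - br Y (br X Z)"
proof -
  have "br X (br Y Z) + br Y (br Z X) + br Z (br X Y) = 0" by (rule jacobi)
  moreover have "br Z (br X Y) = - br (br X Y) Z" by (rule br_anti)
  moreover have "br Y (br Z X) = - br Y (br X Z)"
    by (subst br_anti[of Z X]) (rule br_minus_right)
  ultimately show ?thesis by (simp add: algebra_simps)
qed

lemma br_br_right: "br X (br Y Z) = br (br X Y) Z + br Y (br X Z)"
  by (simp add: br_br_left)

lemma cs_i_i [simp]: "cs \<i> (cs \<i> X) = - X"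
  by (simp add: cx.scale_scale)

lemma cs_i_scaleR: "cs \<i> (r *\<^sub>R X) = r *\<^sub>R cs \<i> X"
  by (metis cs_of_real cx.scale_left_commute)

lemma cs_eq: "cs c X = Re c *\<^sub>R X + cs \<i> (Im c *\<^sub>R X)"
proof -
  have "cs c X = cs (of_real (Re c) + \<i> * of_real (Im c)) X"
    by (simp add: complex_eq[symmetric])
  then show ?thesis
    by (simp only: cx.scale_left_distrib cx.scale_scale[symmetric] cs_of_real)
qed

lemma cx_subspace_subspace:
  assumes "cx.subspace V" shows "subspace V"
  using assms unfolding cx.subspace_def subspace_def by (metis cs_of_real)

end

locale real_form_lie_algebra = complex_lie_algebra cs br
  for cs :: "complex \<Rightarrow> 'g::euclidean_space \<Rightarrow> 'g" and br :: "'g \<Rightarrow> 'g \<Rightarrow> 'g" +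
  fixes U :: "'g set"
  assumes real_form: "real_form U"
begin

abbreviation re where "re \<equiv> re_part U"
abbreviation im where "im \<equiv> im_part U"
abbreviation cj where "cj \<equiv> lie_conj U"

lemma U_subspace: "subspace U" and U_br: "X \<in> U \<Longrightarrow> Y \<in> U \<Longrightarrow> br X Y \<in> U"
  using real_form by (auto simp: real_form_def lie_subalgebra_def)

lemmas U_closed = subspace_0[OF U_subspace] subspace_add[OF U_subspace]
  subspace_scale[OF U_subspace] subspace_neg[OF U_subspace] subspace_diff[OF U_subspace] U_br

lemma decomp_unique:
  assumes "X \<in> U" "Y \<in> U" "X' \<in> U" "Y' \<in> U" "X + cs \<i> Y = X' + cs \<i> Y'"
  shows "X = X'" "Y = Y'"
proof -
  have "X - X' = cs \<i> (Y' - Y)"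
    using assms(5) by (simp add: cx.scale_right_diff_distrib algebra_simps)
  moreover have "X - X' \<in> U" "Y' - Y \<in> U" using assms by (simp_all add: U_closed)
  ultimately have "X - X' \<in> U \<inter> cs \<i> ` U" by auto
  moreover have "U \<inter> cs \<i> ` U = {0}" using real_form by (simp add: real_form_def)
  ultimately have "X - X' = 0" by blast
  then show "X = X'" by simp
  then have "cs \<i> Y = cs \<i> Y'" using assms(5) by simp
  then show "Y = Y'" by simp
qed

lemma re_eq: "X \<in> U \<Longrightarrow> Y \<in> U \<Longrightarrow> re (X + cs \<i> Y) = X"
  unfolding re_part_def by (rule the_equality) (use decomp_unique in blast)+

lemma im_eq: "X \<in> U \<Longrightarrow> Y \<in> U \<Longrightarrow> im (X + cs \<i> Y) = Y"
  unfolding im_part_def by (rule the_equality) (use decomp_unique in blast)+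

lemma re_im_exist: "\<exists>X\<in>U. \<exists>Y\<in>U. Z = X + cs \<i> Y"
proof -
  have "Z \<in> complexification U" using real_form by (simp add: real_form_def)
  then show ?thesis by (auto simp: complexification_def)
qed

lemma re_in [simp]: "re Z \<in> U" and im_in [simp]: "im Z \<in> U"
  and re_im: "Z = re Z + cs \<i> (im Z)"
proof -
  obtain X Y where "X \<in> U" "Y \<in> U" "Z = X + cs \<i> Y" using re_im_exist by blast
  then show "re Z \<in> U" "im Z \<in> U" "Z = re Z + cs \<i> (im Z)" by (simp_all add: re_eq im_eq)
qed

lemma re_U [simp]: "X \<in> U \<Longrightarrow> re X = X" and im_U [simp]: "X \<in> U \<Longrightarrow> im X = 0"
  using re_eq[of X 0] im_eq[of X 0] by (simp_all add: U_closed)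

lemma re_im_add: "re (Z + W) = re Z + re W" "im (Z + W) = im Z + im W"
proof -
  have "Z + W = (re Z + re W) + cs \<i> (im Z + im W)"
    using re_im[of Z] re_im[of W] by (simp add: cx.scale_right_distrib algebra_simps)
  then show "re (Z + W) = re Z + re W" "im (Z + W) = im Z + im W"
    by (metis re_eq im_eq re_in im_in U_closed(2))+
qed

lemma re_im_scaleR: "re (r *\<^sub>R Z) = r *\<^sub>R re Z" "im (r *\<^sub>R Z) = r *\<^sub>R im Z"
proof -
  have "r *\<^sub>R Z = (r *\<^sub>R re Z) + cs \<i> (r *\<^sub>R im Z)"
    by (subst re_im[of Z]) (simp add: scaleR_add_right cs_i_scaleR)
  then show "re (r *\<^sub>R Z) = r *\<^sub>R re Z" "im (r *\<^sub>R Z) = r *\<^sub>R im Z"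
    by (metis re_eq im_eq re_in im_in U_closed(3))+
qed

lemma re_im_i: "re (cs \<i> Z) = - im Z" "im (cs \<i> Z) = re Z"
proof -
  have "cs \<i> Z = - im Z + cs \<i> (re Z)"
    by (subst re_im[of Z]) (simp add: cx.scale_right_distrib)
  then show "re (cs \<i> Z) = - im Z" "im (cs \<i> Z) = re Z"
    by (metis re_eq im_eq re_in im_in U_closed(4))+
qed

lemma re_im_br: "X \<in> U \<Longrightarrow> re (br X Z) = br X (re Z)" "X \<in> U \<Longrightarrow> im (br X Z) = br X (im Z)"
proof -
  assume X: "X \<in> U"
  have "br X Z = br X (re Z) + cs \<i> (br X (im Z))"
    by (subst re_im[of Z]) (simp add: br_add_right br_scale_right)
  then show "re (br X Z) = br X (re Z)" "im (br X Z) = br X (im Z)"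
    by (metis re_eq im_eq re_in im_in U_br X)+
qed

lemma cj_eq: "X \<in> U \<Longrightarrow> Y \<in> U \<Longrightarrow> cj (X + cs \<i> Y) = X - cs \<i> Y"
  by (simp add: lie_conj_def re_eq im_eq)

lemma cj_add: "cj (Z + W) = cj Z + cj W"
  by (simp add: lie_conj_def re_im_add cx.scale_right_distrib)

lemma cj_scaleR: "cj (r *\<^sub>R Z) = r *\<^sub>R cj Z"
  by (simp add: lie_conj_def re_im_scaleR cs_i_scaleR scaleR_diff_right)

lemma cj_i: "cj (cs \<i> Z) = - cs \<i> (cj Z)"
  by (simp add: lie_conj_def re_im_i cx.scale_right_diff_distrib)

lemma cj_minus: "cj (- Z) = - cj Z"
  using cj_scaleR[of "-1" Z] by simp

lemma cj_diff: "cj (Z - W) = cj Z - cj W"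
  using cj_add[of Z "- W"] by (simp add: cj_minus)

lemma cj_zero [simp]: "cj 0 = 0"
  using cj_scaleR[of 0 0] by simp

lemma cj_cs: "cj (cs c Z) = cs (cnj c) (cj Z)"
  by (subst (1 2) cs_eq) (simp add: cj_add cj_scaleR cj_i cs_i_scaleR)

lemma cj_U: "X \<in> U \<Longrightarrow> cj X = X"
  by (simp add: lie_conj_def)

lemma cj_cj [simp]: "cj (cj Z) = Z"
proof -
  have "cj Z = re Z - cs \<i> (im Z)" by (simp add: lie_conj_def)
  then have "cj (cj Z) = cj (re Z) - cj (cs \<i> (im Z))" by (simp add: cj_diff)
  also have "\<dots> = re Z + cs \<i> (im Z)" by (simp add: cj_i cj_U)
  finally show ?thesis using re_im by simp
qed

lemma cj_eq_0 [simp]: "cj Z = 0 \<longleftrightarrow> Z = 0"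
  by (metis cj_cj cj_zero)

lemma cj_br: "cj (br Z W) = br (cj Z) (cj W)"
proof -
  have *: "cj (br X W) = br X (cj W)" if "X \<in> U" for X W
    by (simp add: lie_conj_def that re_im_br br_diff_right br_scale_right)
  have "br Z W = br (re Z) W + cs \<i> (br (im Z) W)"
    by (subst re_im[of Z]) (simp add: br_add_left br_scale_left)
  then have "cj (br Z W) = br (re Z) (cj W) - cs \<i> (br (im Z) (cj W))"
    by (simp add: cj_add cj_i *)
  also have "\<dots> = br (cj Z) (cj W)"
    by (simp add: lie_conj_def[of _ Z] br_diff_left br_scale_left)
  finally show ?thesis .
qed

lemma cj_fixed_iff: "cj Z = Z \<longleftrightarrow> Z \<in> U"
proof
  assume "cj Z = Z"
  then have "re Z - cs \<i> (im Z) = re Z + cs \<i> (im Z)"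
    using re_im[of Z] by (simp add: lie_conj_def)
  then have "2 *\<^sub>R cs \<i> (im Z) = 0" by (simp add: scaleR_2 algebra_simps)
  then have "im Z = 0" by simp
  then show "Z \<in> U" by (metis re_im re_in cx.scale_zero_right add.right_neutral)
qed (rule cj_U)

lemma re_cj: "re Z = (1/2) *\<^sub>R (Z + cj Z)"
proof -
  have "Z + cj Z = 2 *\<^sub>R re Z"
    by (subst (1) re_im[of Z]) (simp add: lie_conj_def scaleR_2)
  then show ?thesis by simp
qed

end

subsection \<open>The Killing form\<close>

text \<open>The basis chosen in \<open>trace_on\<close> depends on \<open>V\<close> alone, so a
  single \<open>B\<close> serves all maps at once. The trace rules below compare sums over this one
  basis and never need independence of the basis.\<close>

lemma trace_on_basis:
  fixes V :: "'g::euclidean_space set"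
  assumes "subspace V"
  obtains B where "independent B" "span B = V" "finite B"
    "\<And>f. trace_on V f = (\<Sum>b\<in>B. representation B (f b) b)"
proof -
  define B where "B = (SOME B. independent B \<and> span B = V)"
  have "\<exists>B. independent B \<and> span B = V"
    using assms by (metis basis_exists span_subspace)
  then have "independent B \<and> span B = V" unfolding B_def by (rule someI_ex)
  then show ?thesis
    using that[of B] independent_imp_finite by (auto simp: trace_on_def B_def Let_def)
qed

lemma trace_on_add:
  fixes V :: "'g::euclidean_space set"
  assumes V: "subspace V" and "f ` V \<subseteq> V" "g ` V \<subseteq> V"
  shows "trace_on V (\<lambda>x. f x + g x) = trace_on V f + trace_on V g"
proof -
  obtain B where B: "independent B" "span B = V" "finite B"
    "\<And>f. trace_on V f = (\<Sum>b\<in>B. representation B (f b) b)" using trace_on_basis[OF V] by blast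
  have "f b \<in> span B" "g b \<in> span B" if "b \<in> B" for b
    using that assms B(2) span_base by blast+
  then show ?thesis using B by (simp add: representation_add sum.distrib)
qed

lemma trace_on_scaleR:
  fixes V :: "'g::euclidean_space set"
  assumes V: "subspace V" and "f ` V \<subseteq> V"
  shows "trace_on V (\<lambda>x. r *\<^sub>R f x) = r * trace_on V f"
proof -
  obtain B where B: "independent B" "span B = V" "finite B"
    "\<And>f. trace_on V f = (\<Sum>b\<in>B. representation B (f b) b)" using trace_on_basis[OF V] by blast
  have "f b \<in> span B" if "b \<in> B" for b
    using that assms B(2) span_base by blast+
  then show ?thesis using B by (simp add: representation_scale sum_distrib_left)
qed

text \<open>Both traces expand to the same double sum of products of matrix entries. Stability of
  \<open>V\<close> is what gives the values of \<open>f\<close> and \<open>g\<close> coordinates in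
  the chosen basis.\<close>

lemma trace_on_commute:
  fixes V :: "'g::euclidean_space set"
  assumes V: "subspace V" and f: "f ` V \<subseteq> V" "linear f" and g: "g ` V \<subseteq> V" "linear g"
  shows "trace_on V (\<lambda>x. f (g x)) = trace_on V (\<lambda>x. g (f x))"
proof -
  obtain B where B: "independent B" "span B = V" "finite B"
    "\<And>f. trace_on V f = (\<Sum>b\<in>B. representation B (f b) b)" using trace_on_basis[OF V] by blast
  \<comment> \<open>A diagonal entry of a matrix product, stated for arbitrary maps because it is
    used again with their roles exchanged.\<close>
  have *: "representation B (f (g b)) b = (\<Sum>c\<in>B. representation B (g b) c * representation B (f c) b)"
    if "b \<in> B" "f ` V \<subseteq> V" "linear f" "g ` V \<subseteq> V" for b f g
  proof -
    have fg: "f c \<in> span B" "g c \<in> span B" if "c \<in> B" for c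
      using that \<open>f ` V \<subseteq> V\<close> \<open>g ` V \<subseteq> V\<close> B(2) span_base by blast+
    have "g b = (\<Sum>c\<in>B. representation B (g b) c *\<^sub>R c)"
      using sum_representation_eq[OF B(1) _ B(3) order_refl] fg that by metis
    then have "f (g b) = (\<Sum>c\<in>B. representation B (g b) c *\<^sub>R f c)"
      by (metis (no_types, lifting) that(3) linear_sum linear_cmul sum.cong)
    then have "representation B (f (g b)) b
        = representation B (\<Sum>c\<in>B. representation B (g b) c *\<^sub>R f c) b"
      by simp
    also have "\<dots> = (\<Sum>c\<in>B. representation B (representation B (g b) c *\<^sub>R f c) b)"
      by (subst representation_sum[OF B(1)]) (use fg in \<open>auto intro: span_scale\<close>)
    also have "\<dots> = (\<Sum>c\<in>B. representation B (g b) c * representation B (f c) b)"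
      by (rule sum.cong) (simp_all add: representation_scale[OF B(1) fg(1)])
    finally show ?thesis .
  qed
  have "trace_on V (\<lambda>x. f (g x))
      = (\<Sum>b\<in>B. \<Sum>c\<in>B. representation B (g b) c * representation B (f c) b)"
    using B(4) * assms by simp
  also have "\<dots> = (\<Sum>c\<in>B. \<Sum>b\<in>B. representation B (f c) b * representation B (g b) c)"
    by (subst sum.swap) (simp add: mult.commute)
  also have "\<dots> = trace_on V (\<lambda>x. g (f x))"
    using B(4) *[where f=g and g=f] assms by simp
  finally show ?thesis .
qed

locale compact_lie_algebra = real_form_lie_algebra cs br U
  for cs :: "complex \<Rightarrow> 'g::euclidean_space \<Rightarrow> 'g" and br :: "'g \<Rightarrow> 'g \<Rightarrow> 'g" and U :: "'g set" +
  assumes killing_neg: "X \<in> U \<Longrightarrow> X \<noteq> 0 \<Longrightarrow> killing br U X X < 0"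
begin

abbreviation K where "K \<equiv> killing br U"

lemma ad_stable: "X \<in> U \<Longrightarrow> br X ` U \<subseteq> U" and ad_linear: "linear (br X)"
  by (auto intro: U_br) (rule linearI, simp_all add: br_add_right br_scaleR_right)

lemma ad2_stable: "X \<in> U \<Longrightarrow> Y \<in> U \<Longrightarrow> (\<lambda>Z. br X (br Y Z)) ` U \<subseteq> U"
  and ad3_stable: "X \<in> U \<Longrightarrow> Y \<in> U \<Longrightarrow> W \<in> U \<Longrightarrow> (\<lambda>Z. br W (br X (br Y Z))) ` U \<subseteq> U"
  by (auto intro!: U_br)

lemma K_sym: "X \<in> U \<Longrightarrow> Y \<in> U \<Longrightarrow> K X Y = K Y X"
  unfolding killing_def
  by (rule trace_on_commute[OF U_subspace]) (simp_all add: ad_stable ad_linear)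

lemma K_add: "X \<in> U \<Longrightarrow> X' \<in> U \<Longrightarrow> Y \<in> U \<Longrightarrow> K (X + X') Y = K X Y + K X' Y"
  unfolding killing_def br_add_left
  by (rule trace_on_add[OF U_subspace]) (simp_all add: ad2_stable)

lemma K_scaleR: "X \<in> U \<Longrightarrow> Y \<in> U \<Longrightarrow> K (r *\<^sub>R X) Y = r * K X Y"
  unfolding killing_def br_scaleR_left
  by (rule trace_on_scaleR[OF U_subspace]) (simp_all add: ad2_stable)

lemma K_minus: "X \<in> U \<Longrightarrow> Y \<in> U \<Longrightarrow> K (- X) Y = - K X Y"
  using K_scaleR[of X Y "-1"] by simp

lemma K_zero: "Y \<in> U \<Longrightarrow> K 0 Y = 0"
  using K_scaleR[of 0 Y 0] U_closed(1) by simp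

text \<open>After expanding the inner bracket by the Jacobi identity, both sides contain the trace
  of \<open>ad X ad Y ad Z\<close>; the remaining two traces differ by a cyclic permutation.\<close>

lemma K_invariant:
  assumes "X \<in> U" "Y \<in> U" "Z \<in> U"
  shows "K (br X Y) Z = K X (br Y Z)"
proof -
  let ?t = "\<lambda>A B C. trace_on U (\<lambda>W. br A (br B (br C W)))"
  have lin: "linear (\<lambda>W. br A (br B W))" for A B
    using linear_compose[OF ad_linear ad_linear] by (simp add: o_def)
  have cyc: "?t Y X Z = ?t X Z Y"
    by (rule trace_on_commute[OF U_subspace ad_stable ad_linear ad2_stable lin])
       (use assms in auto)
  have diff: "trace_on U (\<lambda>W. f W - g W) = trace_on U f - trace_on U g"
    if "f ` U \<subseteq> U" "g ` U \<subseteq> U" for f g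
  proof -
    have "(\<lambda>W. (-1) *\<^sub>R g W) ` U \<subseteq> U" using that U_closed by auto
    then have "trace_on U (\<lambda>W. f W + (-1) *\<^sub>R g W) = trace_on U f + (-1) * trace_on U g"
      using that by (subst trace_on_add[OF U_subspace]) (auto simp: trace_on_scaleR[OF U_subspace, of g "-1", simplified])
    then show ?thesis by simp
  qed
  have "K (br X Y) Z = ?t X Y Z - ?t Y X Z"
    unfolding killing_def br_br_left by (rule diff) (use assms ad3_stable in auto)
  moreover have "K X (br Y Z) = ?t X Y Z - ?t X Z Y"
    unfolding killing_def br_br_left br_diff_right by (rule diff) (use assms ad3_stable in auto)
  ultimately show ?thesis using cyc by simp
qed

text \<open>The real part of the Hermitian form -K(Z, cj W), with K extended complex bilinearly.
  Splitting into real and imaginary parts spares that extension.\<close>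

definition ip :: "'g \<Rightarrow> 'g \<Rightarrow> real" where
  "ip Z W = - K (re Z) (re W) - K (im Z) (im W)"

lemma ip_sym: "ip Z W = ip W Z"
  by (simp add: ip_def K_sym)

lemma ip_add_left: "ip (Z + Z') W = ip Z W + ip Z' W"
  by (simp add: ip_def re_im_add K_add)

lemma ip_scaleR_left: "ip (r *\<^sub>R Z) W = r * ip Z W"
  by (simp add: ip_def re_im_scaleR K_scaleR algebra_simps)

lemma ip_add_right: "ip W (Z + Z') = ip W Z + ip W Z'"
  by (simp add: ip_sym[of W] ip_add_left)

lemma ip_scaleR_right: "ip W (r *\<^sub>R Z) = r * ip W Z"
  by (simp add: ip_sym[of W] ip_scaleR_left)

lemma ip_minus_left: "ip (- Z) W = - ip Z W"
  using ip_scaleR_left[of "-1"] by simp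

lemma ip_minus_right: "ip W (- Z) = - ip W Z"
  using ip_scaleR_right[of _ "-1"] by simp

lemma ip_diff_left: "ip (Z - Z') W = ip Z W - ip Z' W"
  using ip_add_left[of Z "- Z'"] by (simp add: ip_minus_left)

lemma ip_diff_right: "ip W (Z - Z') = ip W Z - ip W Z'"
  by (simp add: ip_sym[of W] ip_diff_left)

lemma ip_zero [simp]: "ip 0 W = 0" "ip W 0 = 0"
  using ip_scaleR_left[of 0 0] ip_scaleR_right[of _ 0 0] by simp_all

lemma ip_pos: "Z \<noteq> 0 \<Longrightarrow> ip Z Z > 0"
proof -
  assume "Z \<noteq> 0"
  then have "re Z \<noteq> 0 \<or> im Z \<noteq> 0" using re_im[of Z] by auto
  moreover have "K X X \<le> 0" if "X \<in> U" for X
    using killing_neg[OF that] K_zero[OF U_closed(1)] by (cases "X = 0") auto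
  moreover have "K X X < 0" if "X \<in> U" "X \<noteq> 0" for X using killing_neg that by blast
  ultimately show ?thesis unfolding ip_def by (smt (verit) re_in im_in)
qed

lemma ip_eq_0 [simp]: "ip Z Z = 0 \<longleftrightarrow> Z = 0"
  using ip_pos by force

lemma ip_i: "ip (cs \<i> Z) W = - ip Z (cs \<i> W)"
  using K_minus[of "im W" "re Z"] K_sym[of "re Z" "- im W"] K_sym[of "im W" "re Z"]
  by (simp add: ip_def re_im_i K_minus U_closed)

lemma ip_i_self: "ip (cs \<i> Z) Z = 0"
  using ip_i[of Z Z] ip_sym[of Z] by simp

lemma ip_cs_self: "ip (cs c Z) Z = Re c * ip Z Z"
  by (subst cs_eq) (simp add: ip_add_left ip_scaleR_left cs_i_scaleR ip_i_self)

text \<open>Elements of \<open>U\<close> act skewly because the Killing form is invariant.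
  Multiplication by i is skew as well, which turns the imaginary part of Z around and produces
  \<open>cj Z\<close>.\<close>

lemma ip_br: "ip (br Z V) W = - ip V (br (cj Z) W)"
proof -
  have skew: "ip (br X V) W = - ip V (br X W)" if "X \<in> U" for X V W
  proof -
    have "K (br X A) C = - K A (br X C)" if "A \<in> U" "C \<in> U" for A C
      using K_invariant[OF \<open>A \<in> U\<close> \<open>X \<in> U\<close> \<open>C \<in> U\<close>] br_anti[of X A] that \<open>X \<in> U\<close>
      by (simp add: K_minus U_br)
    then show ?thesis by (simp add: ip_def re_im_br that)
  qed
  have "br Z V = br (re Z) V + cs \<i> (br (im Z) V)"
    by (subst re_im[of Z]) (simp add: br_add_left br_scale_left)
  then have "ip (br Z V) W = - ip V (br (re Z) W) + ip V (br (im Z) (cs \<i> W))"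
    by (simp add: ip_add_left skew ip_i)
  also have "\<dots> = - ip V (br (cj Z) W)"
    by (simp add: lie_conj_def br_diff_left br_scale_left br_scale_right ip_diff_right)
  finally show ?thesis .
qed

text \<open>Real and imaginary parts of a central element are central, and a central A has K(A, A) =
  0, while the Killing form is negative definite on \<open>U\<close>.\<close>

lemma center_trivial:
  assumes "\<And>Y. br X Y = 0" shows "X = 0"
proof -
  have "br (re X) Y = 0 \<and> br (im X) Y = 0" if "Y \<in> U" for Y
  proof -
    have "br X Y = br (re X) Y + cs \<i> (br (im X) Y)"
      by (subst re_im[of X]) (simp add: br_add_left br_scale_left)
    then have "br (re X) Y + cs \<i> (br (im X) Y) = 0 + cs \<i> 0" using assms by simp
    then show ?thesis using decomp_unique that by (metis U_br re_in im_in U_closed(1))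
  qed
  then have *: "br (re X) Y = 0" "br (im X) Y = 0" for Y
    using re_im[of Y] by (metis br_add_right br_scale_right re_in im_in cx.scale_zero_right add_0)+
  have "K A A = 0" if "\<And>Y. br A Y = 0" for A
    using that by (simp add: killing_def trace_on_def representation_zero)
  with * have "re X = 0" "im X = 0" using killing_neg[of "re X"] killing_neg[of "im X"] by fastforce+
  then show ?thesis using re_im[of X] by simp
qed

end

subsection \<open>Common eigenvectors\<close>

text \<open>Among the first \<open>DIM('g) + 1\<close> members of a sequence either all are
  distinct, hence too many to be independent, or two coincide and yield a relation with coefficients
  1 and -1.\<close>

lemma iterates_dependent:
  fixes v :: "'g::euclidean_space"
  obtains u :: "nat \<Rightarrow> real" and n k where "k \<le> n" "u k \<noteq> 0" "(\<Sum>k\<le>n. u k *\<^sub>R f k) = (0::'g)"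
proof (cases "inj_on f {..DIM('g)}")
  case True
  let ?S = "f ` {..DIM('g)}"
  have "dependent ?S"
    by (rule dependent_biggerset) (simp add: card_image[OF True])
  then obtain w x where w: "x \<in> ?S" "w x \<noteq> 0" "(\<Sum>y\<in>?S. w y *\<^sub>R y) = 0"
    using dependent_finite[of ?S] by auto
  then obtain k where "k \<le> DIM('g)" "w (f k) \<noteq> 0" by auto
  moreover have "(\<Sum>k\<le>DIM('g). w (f k) *\<^sub>R f k) = 0"
    using w(3) by (simp add: sum.reindex[OF True])
  ultimately show ?thesis using that[of k _ "w \<circ> f"] by (simp add: o_def)
next
  case False
  then obtain i j where ij: "i \<le> DIM('g)" "j \<le> DIM('g)" "f i = f j" "i \<noteq> j"
    by (auto simp: inj_on_def)
  let ?u = "\<lambda>k. (if k = i then 1 else 0) - (if k = j then 1 else 0 :: real)"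
  have "(\<Sum>k\<le>DIM('g). ?u k *\<^sub>R f k) = (\<Sum>k\<le>DIM('g). (if k = i then f k else 0) - (if k = j then f k else 0))"
    by (rule sum.cong) auto
  also have "\<dots> = 0" using ij by (simp add: sum_subtractf)
  finally show ?thesis using that[of i "DIM('g)" ?u] ij by auto
qed

context complex_lie_algebra
begin

definition poly_op :: "('g \<Rightarrow> 'g) \<Rightarrow> complex poly \<Rightarrow> 'g \<Rightarrow> 'g" where
  "poly_op A p v = (\<Sum>k\<le>degree p. cs (coeff p k) ((A ^^ k) v))"

lemma poly_op_upto:
  assumes "degree p \<le> n"
  shows "poly_op A p v = (\<Sum>k\<le>n. cs (coeff p k) ((A ^^ k) v))"
  unfolding poly_op_def
  by (rule sum.mono_neutral_left) (use assms in \<open>auto simp: coeff_eq_0\<close>)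

lemma poly_op_pCons:
  assumes "Vector_Spaces.linear cs cs A"
  shows "poly_op A (pCons a p) v = cs a v + A (poly_op A p v)"
proof -
  interpret A: Vector_Spaces.linear cs cs A by fact
  have "poly_op A (pCons a p) v
      = (\<Sum>k\<le>Suc (degree p). cs (coeff (pCons a p) k) ((A ^^ k) v))"
    by (rule poly_op_upto) (simp add: degree_pCons_le)
  also have "\<dots> = cs a v + (\<Sum>k\<le>degree p. cs (coeff p k) (A ((A ^^ k) v)))"
    by (subst sum.atMost_Suc_shift) simp
  also have "(\<Sum>k\<le>degree p. cs (coeff p k) (A ((A ^^ k) v))) = A (poly_op A p v)"
    by (simp add: poly_op_def A.sum A.scale)
  finally show ?thesis .
qed

lemma poly_op_diff_smult: "poly_op A (p - smult c q) v = poly_op A p v - cs c (poly_op A q v)"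
proof -
  define n where "n = max (degree p) (degree q)"
  have "degree (p - smult c q) \<le> n"
    by (metis n_def degree_diff_le degree_smult_le max.cobounded1 max.cobounded2 order.trans)
  then show ?thesis
    by (simp add: poly_op_upto[of _ n] n_def cx.scale_left_diff_distrib sum_subtractf
        cx.scale_sum_right)
qed

text \<open>Split off a root c of p, so that p = (x - c) q. Either q(A) v = 0, and q has smaller
  degree, or q(A) v is an eigenvector for c; it stays in \<open>N\<close> because \<open>N\<close>
  is stable.\<close>

lemma eigenvector_of_annihilator:
  assumes A: "Vector_Spaces.linear cs cs A" and N: "cx.subspace N" "A ` N \<subseteq> N"
    and v: "v \<in> N" "v \<noteq> 0" and p: "p \<noteq> 0" "poly_op A p v = 0"
  shows "\<exists>c. \<exists>w\<in>N. w \<noteq> 0 \<and> A w = cs c w"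
  using p
proof (induction "degree p" arbitrary: p rule: less_induct)
  case less
  show ?case
  proof (cases "degree p = 0")
    case True
    then obtain a where "p = [:a:]" by (rule degree_eq_zeroE)
    then show ?thesis using less.prems v by (simp add: poly_op_def)
  next
    case False
    then have "\<not> constant (poly p)" by (simp add: constant_degree)
    then obtain c where "poly p c = 0" using fundamental_theorem_of_algebra by blast
    then obtain q where q: "p = [:- c, 1:] * q" by (metis dvdE poly_eq_0_iff_dvd)
    then have q0: "q \<noteq> 0" using less.prems by auto
    have p_eq: "p = pCons 0 q - smult c q" by (simp add: q)
    have N_it: "(A ^^ k) v \<in> N" for k by (induction k) (use v N in auto)
    have w: "poly_op A q v \<in> N"
      unfolding poly_op_def by (intro cx.subspace_sum cx.subspace_scale N N_it)
    show ?thesis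
    proof (cases "poly_op A q v = 0")
      case True
      have "degree q < degree p"
        using q0 by (simp add: q degree_mult_eq del: mult_pCons_left)
      then show ?thesis using less.hyps True q0 by blast
    next
      case False
      have "A (poly_op A q v) = cs c (poly_op A q v)"
        using less.prems(2) unfolding p_eq poly_op_diff_smult by (simp add: poly_op_pCons[OF A])
      then show ?thesis using False w by blast
    qed
  qed
qed

text \<open>A real linear relation among the iterates of v is already a nonzero annihilating
  polynomial, so the real dimension of the space is enough.\<close>

lemma eigenvector_exists:
  assumes A: "Vector_Spaces.linear cs cs A" and N: "cx.subspace N" "A ` N \<subseteq> N" "N \<noteq> {0}"
  shows "\<exists>c. \<exists>w\<in>N. w \<noteq> 0 \<and> A w = cs c w"
proof -
  obtain v where v: "v \<in> N" "v \<noteq> 0" using N cx.subspace_0 by blast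
  obtain u n k where u: "k \<le> n" "u k \<noteq> 0" "(\<Sum>k\<le>n. u k *\<^sub>R (A ^^ k) v) = 0"
    by (rule iterates_dependent[of "\<lambda>k. (A ^^ k) v"])
  define p where "p = (\<Sum>k\<le>n. monom (complex_of_real (u k)) k)"
  have cf: "coeff p k = (if k \<le> n then of_real (u k) else 0)" for k
    by (simp add: p_def coeff_sum coeff_monom)
  then have "p \<noteq> 0" using u by (metis coeff_0 of_real_eq_0_iff)
  moreover have "degree p \<le> n" using cf by (intro degree_le) auto
  then have "poly_op A p v = 0" using u(3) by (simp add: poly_op_upto[of _ n] cf cs_of_real)
  ultimately show ?thesis using eigenvector_of_annihilator[OF A N(1,2) v] by blast
qed

text \<open>If some \<open>f\<close> is not a scalar on \<open>N\<close>, one of its eigenspaces in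
  \<open>N\<close> is nonzero and proper, and it is stable under all maps commuting with
  \<open>f\<close>. The induction runs on the real dimension.\<close>

lemma common_eigenvector:
  assumes F: "\<And>f. f \<in> F \<Longrightarrow> Vector_Spaces.linear cs cs f"
    and comm: "\<And>f g x. f \<in> F \<Longrightarrow> g \<in> F \<Longrightarrow> f (g x) = g (f x)"
    and N: "cx.subspace N" "\<And>f. f \<in> F \<Longrightarrow> f ` N \<subseteq> N" "N \<noteq> {0}"
  shows "\<exists>w\<in>N. w \<noteq> 0 \<and> (\<forall>f\<in>F. \<exists>c. f w = cs c w)"
  using N
proof (induction "dim N" arbitrary: N rule: less_induct)
  case less
  show ?case
  proof (cases "\<forall>f\<in>F. \<exists>c. \<forall>x\<in>N. f x = cs c x")
    case True
    moreover obtain w where "w \<in> N" "w \<noteq> 0" using less.prems cx.subspace_0 by blast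
    ultimately show ?thesis by blast
  next
    case False
    then obtain f where f: "f \<in> F" "\<And>c. \<exists>x\<in>N. f x \<noteq> cs c x" by blast
    interpret f: Vector_Spaces.linear cs cs f using F f by blast
    obtain c v where v: "v \<in> N" "v \<noteq> 0" "f v = cs c v"
      using eigenvector_exists[OF F[OF f(1)] less.prems(1,2,3)] f(1) by blast
    define N' where "N' = {x\<in>N. f x = cs c x}"
    have sub: "cx.subspace N'"
      using less.prems(1) unfolding N'_def cx.subspace_def
      by (auto simp: f.add f.scale cx.scale_right_distrib cx.scale_left_commute)
    have "N' \<subset> N" using f(2)[of c] by (auto simp: N'_def)
    then have "dim N' < dim N"
      using subspace_dim_equal[of N' N] dim_subset[of N' N] cx_subspace_subspace sub less.prems(1)
      by (metis order_le_less psubset_eq nat_less_le)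
    moreover have "g ` N' \<subseteq> N'" if "g \<in> F" for g
    proof -
      interpret g: Vector_Spaces.linear cs cs g using F that by blast
      show ?thesis using less.prems(2)[OF that] comm[OF f(1) that] by (auto simp: N'_def g.scale)
    qed
    moreover have "N' \<noteq> {0}" using v by (auto simp: N'_def)
    ultimately have "\<exists>w\<in>N'. w \<noteq> 0 \<and> (\<forall>f\<in>F. \<exists>c. f w = cs c w)"
      using less.hyps sub by blast
    then show ?thesis by (auto simp: N'_def)
  qed
qed

lemma br_linear: "Vector_Spaces.linear cs cs (br X)"
  by unfold_locales (simp_all add: br_add_right br_scale_right)

end

section \<open>Orthogonal projection for the Killing product\<close>

context compact_lie_algebra
begin

lemma ip_span:
  assumes "\<And>s. s \<in> S \<Longrightarrow> ip Y s = 0" "x \<in> span S" shows "ip Y x = 0"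
  using assms(2) by (induction rule: span_induct_alt) (simp_all add: ip_add_right ip_scaleR_right assms(1))

text \<open>\<open>ip\<close> is only real bilinear, so orthogonality to a complex span has to be
  checked on all complex multiples of the generators.\<close>

lemma ip_cx_span:
  assumes S: "\<And>s c. s \<in> S \<Longrightarrow> ip Y (cs c s) = 0" "x \<in> cx.span S" shows "ip Y x = 0"
  using S(2) by (induction rule: cx.span_induct_alt) (simp_all add: ip_add_right S(1))

text \<open>Gram-Schmidt for \<open>ip\<close>, one generator at a time: a new generator
  \<open>a\<close> is replaced by its part \<open>a'\<close> orthogonal to the earlier ones, so that
  the correction along \<open>a'\<close> leaves their conditions intact.\<close>

lemma ip_projection:
  assumes "finite S" shows "\<exists>m\<in>span S. \<forall>s\<in>S. ip (X - m) s = 0"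
  using assms
proof (induction S arbitrary: X rule: finite_induct)
  case empty
  then show ?case by simp
next
  case (insert a S)
  obtain m where m: "m \<in> span S" "\<And>s. s \<in> S \<Longrightarrow> ip (X - m) s = 0" using insert.IH by blast
  obtain ma where ma: "ma \<in> span S" "\<And>s. s \<in> S \<Longrightarrow> ip (a - ma) s = 0" using insert.IH by blast
  define a' where "a' = a - ma"
  have a': "a' \<in> span (insert a S)"
    unfolding a'_def using ma(1) by (meson insertI1 span_base span_diff span_mono subsetD subset_insertI)
  have mm: "m \<in> span (insert a S)"
    using m(1) by (meson span_mono subsetD subset_insertI)
  show ?case
  proof (cases "a' = 0")
    case True
    then have "a \<in> span S" using ma(1) by (simp add: a'_def)
    then have "ip (X - m) a = 0" using ip_span m(2) by blast
    then show ?thesis using m mm by blast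
  next
    case False
    define t where "t = ip (X - m) a / ip a' a'"
    have "ip a' ma = 0" using ip_span[OF ma(2) ma(1)] by (simp add: a'_def)
    then have "ip a' a = ip a' a'" by (simp add: a'_def ip_diff_right)
    then have "ip (X - (m + t *\<^sub>R a')) a = 0"
      using False by (simp add: t_def ip_diff_left ip_add_left ip_scaleR_left)
    moreover have "ip (X - (m + t *\<^sub>R a')) s = 0" if "s \<in> S" for s
      using that m(2)[OF that] ma(2)[OF that] unfolding a'_def[symmetric]
      by (simp add: ip_diff_left ip_add_left ip_scaleR_left)
    moreover have "m + t *\<^sub>R a' \<in> span (insert a S)" using mm a' by (simp add: span_add span_scale)
    ultimately show ?thesis by blast
  qed
qed

lemma ip_complement:
  assumes "subspace M" "M \<noteq> UNIV"
  obtains Y where "Y \<noteq> 0" "\<And>m. m \<in> M \<Longrightarrow> ip Y m = 0"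
proof -
  obtain B where B: "independent B" "span B = M" using assms(1) by (metis basis_exists span_subspace)
  obtain X where "X \<notin> M" using assms(2) by blast
  moreover obtain m where m: "m \<in> span B" "\<And>s. s \<in> B \<Longrightarrow> ip (X - m) s = 0"
    using ip_projection[OF independent_imp_finite[OF B(1)]] by blast
  ultimately show ?thesis using that[of "X - m"] ip_span[OF m(2)] B(2) by auto
qed

end

subsection \<open>The root space decomposition\<close>

sublocale compact_root_data \<subseteq> compact_lie_algebra cs br u0
  using compact_u0 by unfold_locales (simp_all add: compact_real_form_def)

context compact_root_data
begin

lemma t0_sub: "T \<in> t0 \<Longrightarrow> T \<in> u0" and t0_subspace: "subspace t0"
  using cartan_t0 by (auto simp: cartan_subalgebra_def lie_subalgebra_def)

text \<open>For X in the compact form \<open>ad X\<close> is skew, hence has the same kernel as its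
  square, and the exponent can be lowered down to 1.\<close>

lemma ad_nilpotent_zero:
  assumes X: "X \<in> u0" and "(br X ^^ n) Y = 0" "n > 0"
  shows "br X Y = 0"
  using assms(2,3)
proof (induction n)
  case (Suc n)
  show ?case
  proof (cases n)
    case 0
    then show ?thesis using Suc by simp
  next
    case (Suc k)
    let ?Z = "(br X ^^ k) Y"
    have "ip (br X ?Z) (br X ?Z) = - ip ?Z (br X (br X ?Z))" by (simp add: ip_br cj_U X)
    also have "br X (br X ?Z) = 0" using Suc Suc.prems by simp
    finally have "br X ?Z = 0" by simp
    then show ?thesis using Suc.IH Suc by simp
  qed
qed simp

text \<open>A Cartan subalgebra is only assumed nilpotent. The iterates of \<open>ad X\<close> on Y
  descend the lower central series, so \<open>ad X\<close> is nilpotent on Y and skewness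
  applies.\<close>

lemma t0_abelian: assumes "X \<in> t0" "Y \<in> t0" shows "br X Y = 0"
proof -
  have it: "(br X ^^ n) Y \<in> lower_central br t0 n" for n
    by (induction n) (use assms in \<open>auto intro: span_base\<close>)
  obtain n where n: "lower_central br t0 n = {0}"
    using cartan_t0 by (auto simp: cartan_subalgebra_def lie_nilpotent_def)
  then have "(br X ^^ Suc n) Y = 0" using it[of n] by simp
  then show ?thesis using ad_nilpotent_zero[OF t0_sub[OF assms(1)]] by blast
qed

lemma h_form: "T \<in> h \<longleftrightarrow> (\<exists>X\<in>t0. \<exists>Y\<in>t0. T = X + cs \<i> Y)"
  by (auto simp: h_eq complexification_def)

lemma t0_h: "T \<in> t0 \<Longrightarrow> T \<in> h"
  using h_form subspace_0[OF t0_subspace] by (metis add.right_neutral cx.scale_zero_right)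

lemma h_abelian: "S \<in> h \<Longrightarrow> T \<in> h \<Longrightarrow> br S T = 0"
  by (auto simp: h_form br_add_left br_add_right br_scale_left br_scale_right t0_abelian)

lemma cj_h: "T \<in> h \<Longrightarrow> cj T \<in> h"
  unfolding h_form
proof clarify
  fix X Y assume "X \<in> t0" "Y \<in> t0"
  then show "\<exists>X'\<in>t0. \<exists>Y'\<in>t0. cj (X + cs \<i> Y) = X' + cs \<i> Y'"
    by (intro bexI[of _ X] bexI[of _ "- Y"]) (auto simp: cj_eq t0_sub subspace_neg[OF t0_subspace])
qed

lemma br_h_commute: "S \<in> h \<Longrightarrow> T \<in> h \<Longrightarrow> br S (br T X) = br T (br S X)"
  using br_br_left[of S T X] by (simp add: h_abelian)

text \<open>Eigenvectors of a skew map for different eigenvalues. The eigenvalues are purely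
  imaginary, so only their imaginary parts have to be told apart.\<close>

lemma ip_eigenvectors:
  assumes T: "T \<in> t0" and X: "br T X = cs c X" and Y: "br T Y = cs d Y" and "c \<noteq> d"
  shows "ip X Y = 0"
proof (cases "X = 0 \<or> Y = 0")
  case False
  have cT: "cj T = T" using T by (simp add: cj_U t0_sub)
  have imag: "Re e = 0" if "br T Z = cs e Z" "Z \<noteq> 0" for Z e
  proof -
    have "ip (br T Z) Z = - ip Z (br T Z)" by (simp add: ip_br cT)
    then have "ip (cs e Z) Z = 0" using that(1) ip_sym[of Z "cs e Z"] by simp
    then show ?thesis using that(2) by (simp add: ip_cs_self)
  qed
  have ci: "cs c' Z = Im c' *\<^sub>R cs \<i> Z" if "Re c' = 0" for c' Z
    by (subst cs_eq) (simp add: that cs_i_scaleR)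
  have re: "Re c = 0" "Re d = 0" using imag X Y False by auto
  then have "Im c \<noteq> Im d" using \<open>c \<noteq> d\<close> by (simp add: complex_eq_iff)
  \<comment> \<open>Testing against iY instead of Y turns both sides into real multiples of
    \<open>ip X Y\<close>, with factors Im c and Im d.\<close>
  have "ip (br T X) (cs \<i> Y) = - ip X (br T (cs \<i> Y))" by (simp add: ip_br cT)
  then have "Im c * ip (cs \<i> X) (cs \<i> Y) = - Im d * ip X (cs \<i> (cs \<i> Y))"
    using X Y by (simp add: br_scale_right ci[OF re(1)] ci[OF re(2)] ip_scaleR_left ip_scaleR_right ip_minus_right cs_i_scaleR)
  then have "Im c * ip X Y = Im d * ip X Y" by (simp add: ip_i ip_minus_right ip_minus_left)
  then show ?thesis using \<open>Im c \<noteq> Im d\<close> by simp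
qed auto

lemma functional_eq_on_t0:
  assumes "\<phi> \<in> functionals h" "\<psi> \<in> functionals h" "\<And>T. T \<in> t0 \<Longrightarrow> \<phi> T = \<psi> T"
  shows "\<phi> = \<psi>"
proof
  fix T
  show "\<phi> T = \<psi> T"
  proof (cases "T \<in> h")
    case True
    then obtain X Y where XY: "X \<in> t0" "Y \<in> t0" "T = X + cs \<i> Y" by (auto simp: h_form)
    then have "X \<in> h" "Y \<in> h" "cs \<i> Y \<in> h" using t0_h cartan_h(1) by (auto intro: cx.subspace_scale)
    then show ?thesis using assms XY by (simp add: functionals_def)
  qed (use assms in \<open>simp add: functionals_def\<close>)
qed

lemma root_spaces_orthogonal:
  assumes "\<phi> \<in> functionals h" "\<psi> \<in> functionals h" "\<phi> \<noteq> \<psi>"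
    "X \<in> root_space h \<phi>" "Y \<in> root_space h \<psi>"
  shows "ip X Y = 0"
proof -
  obtain T where T: "T \<in> t0" "\<phi> T \<noteq> \<psi> T" using functional_eq_on_t0 assms(1-3) by blast
  show ?thesis
    by (rule ip_eigenvectors[OF T(1) _ _ T(2)])
      (use assms(4,5) t0_h[OF T(1)] in \<open>auto simp: root_space_def\<close>)
qed

lemma root_space_subspace: "cx.subspace (root_space h \<phi>)"
  unfolding cx.subspace_def root_space_def
  by (auto simp: br_add_right br_scale_right cx.scale_right_distrib cx.scale_left_commute)

lemma functional_of_eigenvector:
  assumes "v \<noteq> 0" "\<And>T. T \<in> h \<Longrightarrow> \<exists>c. br T v = cs c v"
  shows "\<exists>\<phi>\<in>functionals h. v \<in> root_space h \<phi>"
proof -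
  obtain \<phi>' where \<phi>': "\<And>T. T \<in> h \<Longrightarrow> br T v = cs (\<phi>' T) v" using assms(2) by metis
  \<comment> \<open>The value 0 off \<open>h\<close> is the normalization that
    \<open>functionals\<close> requires.\<close>
  define \<phi> where "\<phi> T = (if T \<in> h then \<phi>' T else 0)" for T
  have eig: "br T v = cs (\<phi> T) v" if "T \<in> h" for T using that \<phi>' by (simp add: \<phi>_def)
  have inj: "c = d" if "cs c v = cs d v" for c d using that assms(1) by simp
  have "\<phi> (S + T) = \<phi> S + \<phi> T" if "S \<in> h" "T \<in> h" for S T
    by (rule inj) (metis that eig br_add_left cx.scale_left_distrib cx.subspace_add cartan_h(1))
  moreover have "\<phi> (cs c T) = c * \<phi> T" if "T \<in> h" for c T
    by (rule inj) (metis that eig br_scale_left cx.scale_scale cx.subspace_scale cartan_h(1))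
  ultimately have "\<phi> \<in> functionals h" by (simp add: functionals_def \<phi>_def)
  then show ?thesis using eig by (auto simp: root_space_def)
qed

text \<open>Otherwise the orthogonal complement of the sum of the weight spaces is nonzero. It is
  stable under \<open>h\<close>, since the adjoint of \<open>ad T\<close> is
  \<open>- ad (cj T)\<close> and \<open>cj T\<close> lies in \<open>h\<close>. A common eigenvector
  in it would lie in a weight space and be orthogonal to itself.\<close>

lemma span_weight_spaces: "cx.span (\<Union>\<phi>\<in>functionals h. root_space h \<phi>) = UNIV"
proof (rule ccontr)
  let ?M = "cx.span (\<Union>\<phi>\<in>functionals h. root_space h \<phi>)"
  assume "?M \<noteq> UNIV"
  then obtain Y where Y: "Y \<noteq> 0" "\<And>m. m \<in> ?M \<Longrightarrow> ip Y m = 0"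
    using ip_complement cx_subspace_subspace cx.subspace_span by metis
  define N where "N = {X. \<forall>m\<in>?M. ip X m = 0}"
  have "ip (cs c X) m = 0" if "X \<in> N" "m \<in> ?M" for c X m
  proof -
    have "ip (cs \<i> X) m = 0"
      using that cx.subspace_scale[OF cx.subspace_span that(2), of "\<i>"] by (simp add: ip_i N_def)
    then show ?thesis using that
      by (subst cs_eq) (simp add: ip_add_left cs_i_scaleR ip_scaleR_left N_def)
  qed
  then have N: "cx.subspace N" by (auto simp: cx.subspace_def N_def ip_add_left)
  have inv: "br T ` N \<subseteq> N" if "T \<in> h" for T
  proof -
    have "br S m \<in> ?M" if S: "S \<in> h" "m \<in> ?M" for S m
      using S(2)
    proof (induction rule: cx.span_induct_alt)
      case (step c x y)
      then obtain \<phi> where "br S x = cs (\<phi> S) x" using S(1) by (auto simp: root_space_def)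
      then have "br S x \<in> ?M" using step(1) by (simp add: cx.span_scale cx.span_base)
      then show ?case using step by (simp add: br_add_right br_scale_right cx.span_add cx.span_scale)
    qed (simp add: cx.span_zero)
    then show ?thesis using cj_h[OF that] by (auto simp: N_def ip_br)
  qed
  have "\<exists>w\<in>N. w \<noteq> 0 \<and> (\<forall>f\<in>br ` h. \<exists>c. f w = cs c w)"
  proof (rule common_eigenvector)
    show "N \<noteq> {0}" using Y by (auto simp: N_def)
  qed (use N inv br_linear br_h_commute in auto)
  then obtain w where w: "w \<in> N" "w \<noteq> 0" "\<And>T. T \<in> h \<Longrightarrow> \<exists>c. br T w = cs c w" by blast
  then have "w \<in> ?M" using functional_of_eigenvector by (meson UN_I cx.span_base)
  then show False using w by (auto simp: N_def)
qed

end

context complex_lie_algebra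
begin

lemma br_span_span:
  assumes "\<And>a b. a \<in> A \<Longrightarrow> b \<in> B \<Longrightarrow> br a b \<in> W" "cx.subspace W"
    and x: "x \<in> cx.span A" and y: "y \<in> cx.span B"
  shows "br x y \<in> W"
  using x
proof (induction rule: cx.span_induct_alt)
  case base
  then show ?case using assms(2) cx.subspace_0 by simp
next
  case (step c a x)
  have "br a y \<in> W" using y
    by (induction rule: cx.span_induct_alt)
      (use assms(1)[OF step(1)] assms(2) in
        \<open>simp_all add: cx.subspace_0 br_add_right br_scale_right cx.subspace_add cx.subspace_scale\<close>)
  then show ?case
    using step assms(2) by (simp add: br_add_left br_scale_left cx.subspace_add cx.subspace_scale)
qed

end

context compact_lie_algebra
begin

lemma ip_cj: "ip (cj Z) (cj W) = ip Z W"
proof -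
  have re: "re (cj Z) = re Z" for Z using re_cj[of Z] re_cj[of "cj Z"] by (simp add: add.commute)
  have im: "im (cj Z) = - im Z" for Z
    using im_eq[OF re_in U_closed(4)[OF im_in], of Z Z] by (simp add: lie_conj_def)
  show ?thesis
    using K_minus[of "im Z" "- im W"] K_minus[of "im W" "im Z"] K_sym[of "im Z" "- im W"] K_sym[of "im Z" "im W"]
    by (simp add: ip_def re im U_closed)
qed

end

section \<open>Root spaces indexed by the abstract roots\<close>

context compact_root_data
begin

abbreviation gsp where "gsp x \<equiv> root_space h (\<rho> x)"

lemma rho_add: "x \<in> span R \<Longrightarrow> y \<in> span R \<Longrightarrow> \<rho> (x + y) T = \<rho> x T + \<rho> y T"
  and rho_scaleR: "x \<in> span R \<Longrightarrow> \<rho> (r *\<^sub>R x) T = of_real r * \<rho> x T"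
  and rho_inj: "x \<in> span R \<Longrightarrow> y \<in> span R \<Longrightarrow> \<rho> x = \<rho> y \<Longrightarrow> x = y"
  and rho_R: "\<rho> ` R = roots h"
  using root_id by (auto simp: root_identification_def inj_on_def)

lemma rho_zero: "\<rho> 0 = (\<lambda>T. 0)"
  using rho_scaleR[OF span_zero, of 0] by auto

lemma rho_minus: "x \<in> span R \<Longrightarrow> \<rho> (- x) T = - \<rho> x T"
  using rho_scaleR[of x "-1" T] by simp

lemma rho_functional:
  assumes "x \<in> span R" shows "\<rho> x \<in> functionals h"
proof -
  have "x \<in> span R \<and> \<rho> x \<in> functionals h" using assms
  proof (induction rule: span_induct_alt)
    case base
    then show ?case by (simp add: rho_zero functionals_def span_zero)
  next
    case (step c x y)
    then have "\<rho> x \<in> functionals h" using rho_R by (auto simp: roots_def)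
    moreover have "\<rho> (c *\<^sub>R x + y) = (\<lambda>T. of_real c * \<rho> x T + \<rho> y T)"
      by (rule ext) (use step in \<open>simp add: rho_add rho_scaleR span_base span_scale\<close>)
    ultimately show ?case
      using step by (simp add: functionals_def algebra_simps span_add span_base span_scale)
  qed
  then show ?thesis ..
qed

lemma rho_h:
  assumes "x \<in> span R" "S \<in> h" "T \<in> h"
  shows "\<rho> x (S + T) = \<rho> x S + \<rho> x T" "\<rho> x (S - T) = \<rho> x S - \<rho> x T" "\<rho> x (cs c T) = c * \<rho> x T"
proof -
  have f: "\<rho> x (S + T) = \<rho> x S + \<rho> x T" "\<rho> x (cs c T) = c * \<rho> x T"
    if "S \<in> h" "T \<in> h" for S T c
    using rho_functional[OF assms(1)] that by (auto simp: functionals_def)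
  show "\<rho> x (S + T) = \<rho> x S + \<rho> x T" "\<rho> x (cs c T) = c * \<rho> x T" using f assms by auto
  have "cs (-1) T \<in> h" using assms cartan_h(1) cx.subspace_scale by blast
  then have "\<rho> x (S + cs (-1) T) = \<rho> x S + \<rho> x (cs (-1) T)" using f assms by blast
  then show "\<rho> x (S - T) = \<rho> x S - \<rho> x T" using f(2)[OF assms(2,3), of "-1"] by simp
qed

lemma gsp_eig: "X \<in> gsp x \<Longrightarrow> T \<in> h \<Longrightarrow> br T X = cs (\<rho> x T) X"
  by (simp add: root_space_def)

lemma gsp_cs: "X \<in> gsp x \<Longrightarrow> cs c X \<in> gsp x"
  using root_space_subspace cx.subspace_scale by blast

text \<open>The centralizer of \<open>h\<close> lies in its normalizer, and a Cartan subalgebra is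
  its own normalizer.\<close>

lemma gsp_zero: "gsp 0 = h"
proof
  show "h \<subseteq> gsp 0" using h_abelian by (auto simp: root_space_def rho_zero)
  have "X \<in> {X \<in> UNIV. \<forall>Y\<in>h. br X Y \<in> h}" if "X \<in> gsp 0" for X
  proof -
    have "br X Y = 0" if "Y \<in> h" for Y
      using gsp_eig[OF \<open>X \<in> gsp 0\<close> that] br_anti[of X Y] by (simp add: rho_zero)
    then show ?thesis using cartan_h(1) cx.subspace_0 by auto
  qed
  then show "gsp 0 \<subseteq> h" using cartan_h(2) by (auto simp: cartan_subalgebra_def)
qed

lemma gsp_nontrivial: "x \<in> R \<Longrightarrow> \<exists>X\<in>gsp x. X \<noteq> 0"
proof -
  assume "x \<in> R"
  then have "gsp x \<noteq> {0}" using rho_R by (auto simp: roots_def)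
  then show ?thesis using root_space_subspace cx.subspace_0 by blast
qed

text \<open>Injectivity of \<open>\<rho>\<close> on the span excludes that a vector outside
  \<open>R\<close> is sent to a root. This is what makes a bracket vanish when the sum of two roots
  is neither a root nor 0.\<close>

lemma gsp_trivial:
  assumes "x \<in> span R" "x \<notin> R" "x \<noteq> 0" "X \<in> gsp x" shows "X = 0"
proof (rule ccontr)
  assume "X \<noteq> 0"
  then have "\<rho> x \<in> roots h"
    using assms rho_functional rho_zero rho_inj[OF assms(1) span_zero] by (auto simp: roots_def)
  then obtain y where "y \<in> R" "\<rho> y = \<rho> x" using rho_R by (metis imageE)
  then show False using rho_inj assms(1,2) span_base by metis
qed

lemma gsp_br:
  assumes "x \<in> span R" "y \<in> span R" "X \<in> gsp x" "Y \<in> gsp y" shows "br X Y \<in> gsp (x + y)"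
proof -
  have "br T (br X Y) = cs (\<rho> (x + y) T) (br X Y)" if "T \<in> h" for T
    using br_br_right[of T X Y] gsp_eig[OF assms(3) that] gsp_eig[OF assms(4) that] assms(1,2)
    by (simp add: rho_add br_scale_left br_scale_right cx.scale_left_distrib)
  then show ?thesis by (simp add: root_space_def)
qed

lemma gsp_orthogonal:
  "x \<in> span R \<Longrightarrow> y \<in> span R \<Longrightarrow> x \<noteq> y \<Longrightarrow> X \<in> gsp x \<Longrightarrow> Y \<in> gsp y \<Longrightarrow> ip X Y = 0"
  using root_spaces_orthogonal rho_functional rho_inj by metis

text \<open>On \<open>t0\<close> the values are imaginary because \<open>ad T\<close> is skew there;
  complex linearity extends the relation to T = A + iB, with conjugate A - iB. It is the reason why
  \<open>cj\<close> exchanges the spaces of x and -x.\<close>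

lemma rho_imaginary:
  assumes x: "x \<in> span R" and X: "X \<in> gsp x" "X \<noteq> 0" and T: "T \<in> h"
  shows "cnj (\<rho> x (cj T)) = - \<rho> x T"
proof -
  have im: "cnj (\<rho> x S) = - \<rho> x S" if "S \<in> t0" for S
  proof -
    have "ip (br S X) X = - ip X (br S X)" using that by (simp add: ip_br cj_U t0_sub)
    then have "ip (cs (\<rho> x S) X) X = 0"
      using gsp_eig[OF X(1) t0_h[OF that]] ip_sym[of X "br S X"] by simp
    then have "Re (\<rho> x S) = 0" using X(2) by (simp add: ip_cs_self)
    then show ?thesis by (simp add: complex_eq_iff)
  qed
  obtain A B where AB: "A \<in> t0" "B \<in> t0" "T = A + cs \<i> B" using T h_form by blast
  have "\<rho> x T = \<rho> x A + \<i> * \<rho> x B" "\<rho> x (cj T) = \<rho> x A - \<i> * \<rho> x B"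
    using AB rho_h[OF x t0_h[OF AB(1)], of "cs \<i> B"] rho_h(3)[OF x t0_h[OF AB(1)] t0_h[OF AB(2)], of "\<i>"]
      t0_h[OF AB(2)] cartan_h(1)
    by (auto simp: cj_eq t0_sub cx.subspace_scale)
  then show ?thesis by (simp add: im[OF AB(1)] im[OF AB(2)])
qed

lemma cj_gsp: assumes x: "x \<in> span R" and X: "X \<in> gsp x" shows "cj X \<in> gsp (- x)"
proof (cases "X = 0")
  case True
  then show ?thesis using root_space_subspace cx.subspace_0 by auto
next
  case False
  have "br T (cj X) = cs (\<rho> (- x) T) (cj X)" if "T \<in> h" for T
  proof -
    have "br T (cj X) = cj (br (cj T) X)" by (simp add: cj_br)
    also have "\<dots> = cs (\<rho> (- x) T) (cj X)"
      using gsp_eig[OF X cj_h[OF that]] rho_imaginary[OF x X False that] x by (simp add: cj_cs rho_minus)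
    finally show ?thesis .
  qed
  then show ?thesis by (simp add: root_space_def)
qed

lemma span_root_spaces: "cx.span (\<Union>x\<in>insert 0 R. gsp x) = UNIV"
proof -
  have "root_space h \<phi> \<subseteq> insert 0 (\<Union>x\<in>insert 0 R. gsp x)" if "\<phi> \<in> functionals h" for \<phi>
  proof (cases "\<phi> = (\<lambda>X. 0) \<or> root_space h \<phi> = {0}")
    case True
    then show ?thesis using rho_zero by auto
  next
    case False
    then have "\<phi> \<in> \<rho> ` R" using that rho_R by (simp add: roots_def)
    then show ?thesis by blast
  qed
  then have "cx.span (\<Union>\<phi>\<in>functionals h. root_space h \<phi>) \<subseteq> cx.span (insert 0 (\<Union>x\<in>insert 0 R. gsp x))"
    by (intro cx.span_mono) blast
  then show ?thesis unfolding span_weight_spaces cx.span_insert_0 by blast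
qed

subsection \<open>Root strings of length two\<close>

text \<open>With H = [Z, cj Z], the product of H with any T in \<open>h\<close> is -Re(\<rho> x T)
  times the squared length of \<open>cj Z\<close>. As the root is not the zero functional, H is
  nonzero, and T = H gives the sign.\<close>

lemma coroot_negative:
  assumes x: "x \<in> R" and Z: "Z \<in> gsp x" "Z \<noteq> 0"
  shows "br Z (cj Z) \<in> h" "Re (\<rho> x (br Z (cj Z))) < 0"
proof -
  let ?H = "br Z (cj Z)"
  have xs: "x \<in> span R" "- x \<in> span R" using x by (auto intro: span_base span_neg)
  show H: "?H \<in> h" using gsp_br[OF xs Z(1) cj_gsp[OF xs(1) Z(1)]] gsp_zero by simp
  have ipH: "ip ?H T = - Re (\<rho> x T) * ip (cj Z) (cj Z)" if "T \<in> h" for T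
  proof -
    have "ip ?H T = ip (cj Z) (br T (cj Z))" by (simp add: ip_br br_anti[of "cj Z" T] ip_minus_right)
    also have "\<dots> = ip (cs (- \<rho> x T) (cj Z)) (cj Z)"
      using gsp_eig[OF cj_gsp[OF xs(1) Z(1)] that] xs by (simp add: rho_minus ip_sym)
    finally show ?thesis by (simp only: ip_cs_self) simp
  qed
  have pos: "ip (cj Z) (cj Z) > 0" using Z ip_pos by simp
  have "?H \<noteq> 0"
  proof
    assume "?H = 0"
    then have "Re (\<rho> x T) = 0" if "T \<in> h" for T using ipH[OF that] pos Z(2) by simp
    moreover have "Im (\<rho> x T) = 0" if "T \<in> h" for T
      using calculation[of "cs \<i> T"] that rho_h(3)[OF xs(1) that that, of "\<i>"] cartan_h(1)
      by (simp add: cx.subspace_scale)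
    ultimately have "\<rho> x T = 0" if "T \<in> h" for T using that by (simp add: complex_eq_iff)
    moreover have "\<rho> x T = 0" if "T \<notin> h" for T
      using rho_functional[OF xs(1)] that by (simp add: functionals_def)
    ultimately have "\<rho> x = (\<lambda>T. 0)" by blast
    then show False using x rho_R by (auto simp: roots_def)
  qed
  then have "- Re (\<rho> x ?H) * ip (cj Z) (cj Z) > 0" using ipH[OF H] ip_pos by metis
  then show "Re (\<rho> x ?H) < 0" using pos by (simp add: mult_less_0_iff)
qed

text \<open>The x-string through y consists of y and x + y only. As \<open>ad Z\<close> kills the
  upper space, \<open>ad Z\<close> after \<open>ad (cj Z)\<close> is there the scalar \<rho>(x +
  y)(H), so a preimage of v is a multiple of [cj Z, v] once this scalar is nonzero.\<close>

lemma ad_root_vector_surj: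
  assumes x: "x \<in> R" and y: "y \<in> R" "x + y \<in> R"
    and string: "y - x \<notin> R" "y - x \<noteq> 0" "x + (x + y) \<notin> R" "x + (x + y) \<noteq> 0"
    and Z: "Z \<in> gsp x" "Z \<noteq> 0" and v: "v \<in> gsp (x + y)"
  shows "\<exists>w\<in>gsp y. v = br Z w"
proof -
  let ?H = "br Z (cj Z)"
  have sp: "x \<in> span R" "y \<in> span R" "x + y \<in> span R" "- x \<in> span R"
    using x y by (auto intro: span_base span_neg)
  have H: "?H \<in> h" "Re (\<rho> x ?H) < 0" using coroot_negative[OF x Z] by auto
  have cZ: "cj Z \<in> gsp (- x)" using cj_gsp[OF sp(1) Z(1)] .
  have up: "br Z u = 0" if "u \<in> gsp (x + y)" for u
    by (rule gsp_trivial[OF _ string(3,4) gsp_br[OF sp(1,3) Z(1) that]]) (intro span_add sp)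
  have down: "br (cj Z) u = 0" if "u \<in> gsp y" for u
    using gsp_trivial[OF _ string(1,2), of "br (cj Z) u"] gsp_br[OF sp(4,2) cZ that] sp
    by (simp add: span_diff)
  have ZZ: "br Z (br (cj Z) u) = cs (\<rho> (x + y) ?H) u" "br (cj Z) u \<in> gsp y" if "u \<in> gsp (x + y)" for u
    using br_br_left[of Z "cj Z" u] gsp_eig[OF that H(1)] up[OF that] gsp_br[OF sp(4,3) cZ that] by simp_all
  \<comment> \<open>If the scalar were 0, \<rho>(y)(H) would have positive real part by
    \<open>coroot_negative\<close>, which makes [Z, u] nonzero. But the vanishing scalar gives [cj
    Z, [Z, u]] = 0, and by adjointness [Z, u] = 0.\<close>
  have "\<rho> (x + y) ?H \<noteq> 0"
  proof
    assume 0: "\<rho> (x + y) ?H = 0"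
    then have pos: "Re (\<rho> y ?H) > 0" using H(2) sp by (simp add: rho_add add_eq_0_iff2)
    obtain u where u: "u \<in> gsp y" "u \<noteq> 0" using gsp_nontrivial y by blast
    have "br (cj Z) (br Z u) = - cs (\<rho> y ?H) u"
      using br_br_left[of Z "cj Z" u] down[OF u(1)] gsp_eig[OF u(1) H(1)] by simp
    moreover have "ip (br Z u) (br Z u) = - ip (br (cj Z) (br Z u)) u"
      by (subst ip_br) (simp add: ip_sym)
    ultimately have "ip (br Z u) (br Z u) > 0" using pos ip_pos[OF u(2)] by (simp add: ip_minus_left ip_cs_self)
    moreover have zu: "br Z u \<in> gsp (x + y)" using gsp_br[OF sp(1,2) Z(1) u(1)] .
    then have "ip (br (cj Z) (br Z u)) (br (cj Z) (br Z u)) = - ip (br Z u) (br Z (br (cj Z) (br Z u)))"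
      by (subst ip_br) simp
    then have "br (cj Z) (br Z u) = 0" using ZZ(1)[OF zu] 0 by simp
    then have "ip (br Z u) (br Z u) = 0" by (simp add: ip_br)
    ultimately show False by simp
  qed
  then show ?thesis
    using ZZ[OF v] by (intro bexI[of _ "cs (inverse (\<rho> (x + y) ?H)) (br (cj Z) v)"])
      (simp_all add: br_scale_right gsp_cs)
qed

subsection \<open>The subspaces attached to sets of roots\<close>

lemma qq_subspace: "cx.subspace (qq Q)"
  by (simp add: qq_def)

lemma h_qq: "T \<in> h \<Longrightarrow> T \<in> qq Q" and gsp_qq: "x \<in> Q \<Longrightarrow> X \<in> gsp x \<Longrightarrow> X \<in> qq Q"
  by (auto simp: qq_def intro: cx.span_base)

lemma qq_orthogonal:
  assumes "Q \<subseteq> R" "x \<in> R" "x \<notin> Q" "0 \<notin> R" "X \<in> qq Q" "Y \<in> gsp x"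
  shows "ip Y X = 0"
proof (rule ip_cx_span)
  show "X \<in> cx.span (h \<union> (\<Union>\<alpha>\<in>Q. gsp \<alpha>))" using assms by (simp add: qq_def)
  fix s c assume "s \<in> h \<union> (\<Union>\<alpha>\<in>Q. gsp \<alpha>)"
  then obtain y where y: "y \<in> insert 0 Q" "s \<in> gsp y" using gsp_zero by auto
  then have "y \<noteq> x" "y \<in> span R" using assms by (auto intro: span_base span_zero)
  then show "ip Y (cs c s) = 0"
    using gsp_orthogonal[OF span_base[OF assms(2)] _ _ assms(6) gsp_cs[OF y(2)]] by blast
qed

text \<open>An element of the intersection is orthogonal to the root spaces outside \<open>Q\<close>
  as a member of \<open>qq Q\<close>, and to those in \<open>Q\<close> as a member of the conjugate,
  whose roots are in -Q. Hence its component in the sum of the root spaces is orthogonal to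
  itself.\<close>

lemma qq_cj_qq:
  assumes Q: "Q \<subseteq> R" "\<And>\<alpha>. \<alpha> \<in> Q \<Longrightarrow> - \<alpha> \<notin> Q" "0 \<notin> R" "\<And>\<alpha>. \<alpha> \<in> R \<Longrightarrow> - \<alpha> \<in> R"
    and X: "X \<in> qq Q" "X \<in> cj ` qq Q"
  shows "X \<in> h"
proof -
  have orth: "ip Y X = 0" if "x \<in> R" "Y \<in> gsp x" for x Y
  proof (cases "x \<in> Q")
    case False
    then show ?thesis using qq_orthogonal Q X(1) that by blast
  next
    case True
    then have "- x \<notin> Q" "- x \<in> R" using Q that by blast+
    moreover obtain W where W: "W \<in> qq Q" "X = cj W" using X(2) by blast
    moreover have "cj Y \<in> gsp (- x)" using cj_gsp that span_base by blast
    ultimately have "ip (cj Y) W = 0" using qq_orthogonal Q by blast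
    then show ?thesis using ip_cj[of "cj Y" W] W by simp
  qed
  have "X \<in> cx.span (h \<union> (\<Union>x\<in>R. gsp x))" using span_root_spaces gsp_zero by (simp add: Un_commute)
  then obtain T Y where TY: "X = T + Y" "T \<in> cx.span h" "Y \<in> cx.span (\<Union>x\<in>R. gsp x)"
    unfolding cx.span_Un by blast
  have T: "T \<in> h" using TY(2) cartan_h(1) by (metis cx.span_eq_iff)
  have "ip X Y = 0"
    by (rule ip_cx_span[OF _ TY(3)]) (use orth gsp_cs ip_sym in fastforce)
  moreover have "ip T Y = 0"
  proof (rule ip_cx_span[OF _ TY(3)])
    fix s c assume "s \<in> (\<Union>x\<in>R. gsp x)"
    then obtain x where x: "x \<in> R" "s \<in> gsp x" by blast
    then show "ip T (cs c s) = 0"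
      using gsp_orthogonal[OF span_zero span_base[OF x(1)] _ _ gsp_cs[OF x(2)]] T gsp_zero Q(3) by metis
  qed
  ultimately have "ip Y Y = 0" using TY(1) by (metis ip_add_left add_0)
  then show ?thesis using TY(1) T by simp
qed

end

subsection \<open>Gradations of simply laced root systems\<close>

text \<open>\<open>R_diff\<close> is closure under reflections in the one nontrivial case: for
  vectors of norm 2 the integral products are \<plusminus>2, \<plusminus>1, 0, and the sign is
  handled by \<open>R_minus\<close>.\<close>

locale simply_laced =
  fixes R :: "'v::real_inner set"
  assumes R_norm: "\<alpha> \<in> R \<Longrightarrow> \<alpha> \<bullet> \<alpha> = 2"
    and R_minus: "\<alpha> \<in> R \<Longrightarrow> - \<alpha> \<in> R"
    and R_int: "\<alpha> \<in> R \<Longrightarrow> \<beta> \<in> R \<Longrightarrow> \<alpha> \<bullet> \<beta> \<in> \<int>"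
    and R_diff: "\<alpha> \<in> R \<Longrightarrow> \<beta> \<in> R \<Longrightarrow> \<alpha> \<bullet> \<beta> = 1 \<Longrightarrow> \<alpha> - \<beta> \<in> R"
begin

lemma R_nonzero: "0 \<notin> R"
  using R_norm by fastforce

text \<open>The norms of \<alpha> - \<beta> and \<alpha> + \<beta> are 4 - 2k and 4 + 2k for the
  product k; nonnegativity bounds k, and the extreme values make one of these vectors 0.\<close>

lemma R_inner_cases:
  assumes "\<alpha> \<in> R" "\<beta> \<in> R"
  shows "\<alpha> \<bullet> \<beta> \<in> {-1, 0, 1} \<or> (\<alpha> = \<beta> \<and> \<alpha> \<bullet> \<beta> = 2) \<or> (\<alpha> = - \<beta> \<and> \<alpha> \<bullet> \<beta> = -2)"
proof -
  obtain k where k: "\<alpha> \<bullet> \<beta> = of_int k" using R_int[OF assms] by (auto elim: Ints_cases)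
  have d: "(\<alpha> - \<beta>) \<bullet> (\<alpha> - \<beta>) = 4 - 2 * of_int k" "(\<alpha> + \<beta>) \<bullet> (\<alpha> + \<beta>) = 4 + 2 * of_int k"
    using R_norm[OF assms(1)] R_norm[OF assms(2)] k
    by (simp_all add: inner_diff inner_add inner_commute[of \<beta> \<alpha>])
  then have "- 2 \<le> k" "k \<le> 2"
    using inner_ge_zero[of "\<alpha> - \<beta>"] inner_ge_zero[of "\<alpha> + \<beta>"] by simp_all
  then consider "k = -2" | "k = -1" | "k = 0" | "k = 1" | "k = 2" by linarith
  then show ?thesis
  proof cases
    case 1
    then have "\<alpha> + \<beta> = 0" using d(2) by simp
    then show ?thesis using k 1 by (simp add: eq_neg_iff_add_eq_0)
  next
    case 5
    then have "\<alpha> = \<beta>" using d(1) by simp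
    then show ?thesis using k 5 by simp
  qed (simp_all add: k)
qed

lemma R_add: "\<alpha> \<in> R \<Longrightarrow> \<beta> \<in> R \<Longrightarrow> \<alpha> \<bullet> \<beta> = -1 \<Longrightarrow> \<alpha> + \<beta> \<in> R"
  using R_diff[of \<alpha> "- \<beta>"] R_minus by simp

lemma group_closure_sum_list:
  "x \<in> group_closure Q \<Longrightarrow> \<exists>xs. set xs \<subseteq> Q \<union> uminus ` Q \<and> x = sum_list xs"
proof (induction rule: group_closure.induct)
  case (base s)
  then show ?case by (cases "s = 0") (auto intro: exI[of _ "[]"] exI[of _ "[s]"])
next
  case (diff s t)
  then obtain xs ys where "set xs \<subseteq> Q \<union> uminus ` Q" "s = sum_list xs"
    "set ys \<subseteq> Q \<union> uminus ` Q" "t = sum_list ys" by blast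
  moreover have "sum_list (map uminus ys) = - sum_list ys" by (induction ys) simp_all
  ultimately show ?case by (intro exI[of _ "xs @ map uminus ys"]) auto
qed

text \<open>A root that is a sum of elements of \<open>\<plusminus>Q\<close> has positive product with one of the
  summands; subtracting that summand leaves a root with a shorter such expression.\<close>

lemma root_induct:
  assumes Q: "Q \<subseteq> R" "R \<subseteq> group_closure Q"
    and base: "\<And>x. x \<in> Q \<Longrightarrow> P x" "\<And>x. x \<in> Q \<Longrightarrow> P (- x)"
    and step: "\<And>x y. x \<in> R \<Longrightarrow> y \<in> R \<Longrightarrow> x \<bullet> y = -1 \<Longrightarrow> P x \<Longrightarrow> P y \<Longrightarrow> P (x + y)"
    and x: "x \<in> R"
  shows "P x"
proof -
  have "P x" if "set xs \<subseteq> Q \<union> uminus ` Q" "x \<in> R" "x = sum_list xs" for xs x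
    using that
  proof (induction "length xs" arbitrary: x xs rule: less_induct)
    case less
    have "sum_list (map (\<lambda>y. y \<bullet> x) ys) = sum_list ys \<bullet> x" for ys
      by (induction ys) (simp_all add: inner_add_left)
    then have "sum_list (map (\<lambda>y. y \<bullet> x) xs) > 0" using less.prems R_norm[of x] by simp
    then obtain y where y: "y \<in> set xs" "y \<bullet> x > 0"
      by (metis (no_types, lifting) sum_list_nonpos imageE list.set_map not_less)
    have yR: "y \<in> R" and Py: "P y" using y less.prems(1) Q R_minus base by auto
    show ?case
    proof (cases "x = y")
      case False
      then have xy: "x \<bullet> y = 1" using R_inner_cases[OF less.prems(2) yR] y(2) by (auto simp: inner_commute)
      have d: "x - y \<in> R" using R_diff[OF less.prems(2) yR xy] .
      have rem: "sum_list (remove1 y zs) = sum_list zs - y" if "y \<in> set zs" for zs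
        using that by (induction zs) (auto simp: algebra_simps)
      have "P (x - y)"
      proof (rule less.hyps[of "remove1 y xs"])
        show "length (remove1 y xs) < length xs"
          using y(1) by (metis One_nat_def Suc_pred length_pos_if_in_set length_remove1 lessI)
        show "set (remove1 y xs) \<subseteq> Q \<union> uminus ` Q" using less.prems(1) set_remove1_subset by fast
      qed (use d rem[OF y(1)] less.prems in auto)
      moreover have "(x - y) \<bullet> y = -1" using xy R_norm[OF yR] by (simp add: inner_diff_left)
      ultimately show ?thesis using step[OF d yR] Py by simp
    qed (use Py in simp)
  qed
  then show ?thesis using group_closure_sum_list[of x Q] x Q by blast
qed

end

section \<open>Parity of roots\<close>

locale graded_root_system = simply_laced R for R :: "'v::real_inner set" +
  fixes b :: 'v
  assumes b_int: "\<alpha> \<in> R \<Longrightarrow> \<alpha> \<bullet> b \<in> \<int>"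
begin

text \<open>The floor only converts a real into an integer: on \<open>insert 0 R\<close> the product
  is integral, and all rules for \<open>par\<close> are restricted to that set.\<close>

definition par :: "'v \<Rightarrow> bool" where "par x \<longleftrightarrow> odd \<lfloor>x \<bullet> b\<rfloor>"

definition S :: "'v set" where "S = {\<alpha> \<in> R. par \<alpha>}"

definition Q :: "'v \<Rightarrow> 'v set" where "Q \<alpha> = {\<beta> \<in> S. \<beta> \<bullet> \<alpha> > 0}"

lemma S_R: "x \<in> S \<Longrightarrow> x \<in> R" and Q_S: "x \<in> Q y \<Longrightarrow> x \<in> S"
  by (auto simp: S_def Q_def)

lemma insert_0_int: "x \<in> insert 0 R \<Longrightarrow> x \<bullet> b \<in> \<int>"
  using b_int by auto

lemma floor_int: "x \<in> insert 0 R \<Longrightarrow> x \<bullet> b = of_int \<lfloor>x \<bullet> b\<rfloor>"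
  using insert_0_int by (metis Ints_cases floor_of_int)

lemma par_add:
  assumes "x \<in> insert 0 R" "y \<in> insert 0 R" shows "par (x + y) \<longleftrightarrow> par x \<noteq> par y"
proof -
  have "(x + y) \<bullet> b = of_int (\<lfloor>x \<bullet> b\<rfloor> + \<lfloor>y \<bullet> b\<rfloor>)"
    using floor_int assms by (metis inner_add_left of_int_add)
  then show ?thesis by (simp only: par_def floor_of_int) auto
qed

lemma par_minus: "x \<in> insert 0 R \<Longrightarrow> par (- x) \<longleftrightarrow> par x"
proof -
  assume "x \<in> insert 0 R"
  then have "(- x) \<bullet> b = of_int (- \<lfloor>x \<bullet> b\<rfloor>)" using floor_int by (metis inner_minus_left of_int_minus)
  then show ?thesis by (simp only: par_def floor_of_int) auto
qed

lemma par_diff: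
  assumes "x \<in> insert 0 R" "y \<in> insert 0 R" shows "par (x - y) \<longleftrightarrow> par x \<noteq> par y"
  using par_add[of x "- y"] par_minus[of y] assms R_minus by auto

lemma par_zero: "\<not> par 0"
  by (simp add: par_def)

lemma S_minus: "x \<in> S \<Longrightarrow> - x \<in> S"
  using R_minus par_minus by (auto simp: S_def)

end

text \<open>\<open>S_spanning\<close> provides, for every even root, an odd root not orthogonal to
  it. The even root is then a difference of two odd roots, and the group generated by the odd roots
  contains it.\<close>

locale rich_graded_root_system = graded_root_system +
  assumes connecting: "\<alpha>\<^sub>0 \<in> S \<Longrightarrow> \<beta> \<in> S \<Longrightarrow> \<beta> \<bullet> \<alpha>\<^sub>0 = 0 \<Longrightarrow> \<exists>\<alpha>\<in>S. \<alpha> \<bullet> \<alpha>\<^sub>0 = 1 \<and> \<alpha> \<bullet> \<beta> = -1"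
    and orthogonal_exists: "\<alpha>\<^sub>0 \<in> S \<Longrightarrow> \<exists>\<beta>\<in>S. \<beta> \<bullet> \<alpha>\<^sub>0 = 0"
    and S_spanning: "\<gamma> \<in> R \<Longrightarrow> (\<And>\<alpha>. \<alpha> \<in> S \<Longrightarrow> \<alpha> \<bullet> \<gamma> = 0) \<Longrightarrow> False"
begin

text \<open>\<open>connecting\<close> for -\<beta> gives an odd \<alpha> with product 1 with both
  \<open>\<alpha>\<^sub>0\<close> and \<beta>; the second summand is
  \<open>\<alpha>\<^sub>0 + \<beta> - \<alpha>\<close>. The two recorded products -1 say that every
  partial sum is a root, as is required for lifting through successive brackets.\<close>

lemma orthogonal_split:
  assumes "\<alpha>\<^sub>0 \<in> S" "\<beta> \<in> S" "\<beta> \<bullet> \<alpha>\<^sub>0 = 0"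
  obtains \<alpha>\<^sub>1 \<alpha>\<^sub>2 where "\<alpha>\<^sub>1 \<in> Q \<alpha>\<^sub>0" "\<alpha>\<^sub>2 \<in> Q \<alpha>\<^sub>0" "\<beta> = \<alpha>\<^sub>1 + (\<alpha>\<^sub>2 + - \<alpha>\<^sub>0)" "\<alpha>\<^sub>2 \<bullet> - \<alpha>\<^sub>0 = -1" "\<alpha>\<^sub>1 \<bullet> (\<alpha>\<^sub>2 + - \<alpha>\<^sub>0) = -1"
proof -
  obtain \<alpha> where a: "\<alpha> \<in> S" "\<alpha> \<bullet> \<alpha>\<^sub>0 = 1" "\<alpha> \<bullet> \<beta> = 1"
    using connecting[OF assms(1) S_minus[OF assms(2)]] assms(3) by auto
  have n: "\<alpha> \<bullet> \<alpha> = 2" "\<beta> \<bullet> \<beta> = 2" "\<alpha>\<^sub>0 \<bullet> \<alpha>\<^sub>0 = 2" using assms a S_R R_norm by blast+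
  have ab: "\<alpha> - \<beta> \<in> R" using R_diff a assms S_R by blast
  define \<alpha>' where "\<alpha>' = \<alpha>\<^sub>0 - (\<alpha> - \<beta>)"
  have "\<alpha>\<^sub>0 \<bullet> (\<alpha> - \<beta>) = 1" using a assms by (simp add: inner_diff_right inner_commute)
  then have "\<alpha>' \<in> R" using R_diff ab assms S_R unfolding \<alpha>'_def by blast
  moreover have "par \<alpha>'"
    unfolding \<alpha>'_def using ab assms a par_diff by (auto simp: S_def)
  ultimately have "\<alpha>' \<in> S" by (simp add: S_def)
  moreover have "\<alpha>' \<bullet> \<alpha>\<^sub>0 = 1"
    using a assms n by (simp add: \<alpha>'_def inner_diff_left)
  moreover have "\<alpha> \<bullet> (\<alpha>' + - \<alpha>\<^sub>0) = -1"
    using a n by (simp add: \<alpha>'_def inner_diff_right)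
  moreover have "\<beta> = \<alpha> + (\<alpha>' + - \<alpha>\<^sub>0)" by (simp add: \<alpha>'_def)
  ultimately show ?thesis using a by (intro that[of \<alpha> \<alpha>']) (simp_all add: Q_def)
qed

lemma S_group_closure: "\<alpha>\<^sub>0 \<in> S \<Longrightarrow> \<beta> \<in> S \<Longrightarrow> \<beta> \<in> group_closure (Q \<alpha>\<^sub>0)"
proof -
  assume S: "\<alpha>\<^sub>0 \<in> S" "\<beta> \<in> S"
  have cl: "x \<in> group_closure (Q \<alpha>\<^sub>0)" if "x \<in> Q \<alpha>\<^sub>0" for x using that group_closure.base by blast
  consider "\<beta> \<bullet> \<alpha>\<^sub>0 > 0" | "\<beta> \<bullet> \<alpha>\<^sub>0 = 0" | "\<beta> \<bullet> \<alpha>\<^sub>0 < 0" by linarith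
  then show ?thesis
  proof cases
    case 1
    then show ?thesis using S cl by (simp add: Q_def)
  next
    case 2
    have "\<alpha>\<^sub>0 \<in> Q \<alpha>\<^sub>0" using S R_norm[OF S_R] by (simp add: Q_def)
    then show ?thesis using orthogonal_split[OF S 2] by (metis cl group_closure_add group_closure_minus_iff)
  next
    case 3
    then have "- \<beta> \<in> Q \<alpha>\<^sub>0" using S S_minus by (simp add: Q_def)
    then show ?thesis using cl group_closure_minus_iff by blast
  qed
qed

text \<open>A root that is a sum of two elements of \<open>Q\<close> would have product at least 2
  with \<open>\<alpha>\<^sub>0\<close>, hence equal \<open>\<alpha>\<^sub>0\<close>; but such a sum
  is even and \<open>\<alpha>\<^sub>0\<close> is odd.\<close>

lemma Q_in_QQ:
  assumes "\<alpha>\<^sub>0 \<in> S" shows "Q \<alpha>\<^sub>0 \<in> QQ R"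
proof -
  have "\<alpha> + \<beta> \<notin> R" if "\<alpha> \<in> Q \<alpha>\<^sub>0" "\<beta> \<in> Q \<alpha>\<^sub>0" for \<alpha> \<beta>
  proof
    assume ab: "\<alpha> + \<beta> \<in> R"
    have R: "\<alpha> \<in> R" "\<beta> \<in> R" "\<alpha>\<^sub>0 \<in> R" using that assms Q_S S_R by blast+
    have "\<not> par (\<alpha> + \<beta>)" using that par_add[of \<alpha> \<beta>] R by (auto simp: Q_def S_def)
    then have "\<alpha> + \<beta> \<noteq> \<alpha>\<^sub>0" using assms by (auto simp: S_def)
    moreover have "\<alpha> \<bullet> \<alpha>\<^sub>0 > 0" "\<beta> \<bullet> \<alpha>\<^sub>0 > 0" using that by (auto simp: Q_def)
    then have "\<alpha> \<bullet> \<alpha>\<^sub>0 \<ge> 1" "\<beta> \<bullet> \<alpha>\<^sub>0 \<ge> 1"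
      using R_inner_cases[OF R(1) R(3)] R_inner_cases[OF R(2) R(3)] by auto
    ultimately show False using R_inner_cases[OF ab R(3)] by (auto simp: inner_add_left)
  qed
  moreover have "x \<in> group_closure (Q \<alpha>\<^sub>0)" if "x \<in> R" for x
  proof (cases "par x")
    case True
    then show ?thesis using S_group_closure[OF assms] that by (simp add: S_def)
  next
    case False
    obtain s where s: "s \<in> S" "s \<bullet> x \<noteq> 0" using S_spanning \<open>x \<in> R\<close> by blast
    have "s \<noteq> x" "s \<noteq> - x" using False s S_minus par_minus[of x] that by (auto simp: S_def)
    then have "s \<bullet> x = 1 \<or> s \<bullet> x = -1" using R_inner_cases[OF S_R[OF s(1)] that] s(2) by auto
    then show ?thesis
    proof
      assume "s \<bullet> x = 1"
      then have "s - x \<in> S" using R_diff[OF S_R[OF s(1)] that] s par_diff[of s x] that False by (auto simp: S_def)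
      then have "s - (s - x) \<in> group_closure (Q \<alpha>\<^sub>0)"
        using S_group_closure[OF assms] s(1) by (blast intro: group_closure.diff)
      then show ?thesis by simp
    next
      assume "s \<bullet> x = -1"
      then have "s + x \<in> S" using R_add[OF S_R[OF s(1)] that] s par_add[of s x] that False by (auto simp: S_def)
      then have "(s + x) - s \<in> group_closure (Q \<alpha>\<^sub>0)"
        using S_group_closure[OF assms] s(1) by (blast intro: group_closure.diff)
      then show ?thesis by simp
    qed
  qed
  ultimately show ?thesis
    by (auto simp: QQ_def Q_def S_def)
qed

lemma Q_maximal_in_S:
  assumes "\<alpha>\<^sub>0 \<in> S" "Q' \<in> QQ R" "Q \<alpha>\<^sub>0 \<subseteq> Q'" "Q' \<subseteq> S" shows "Q' = Q \<alpha>\<^sub>0"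
proof (rule antisym)
  show "Q' \<subseteq> Q \<alpha>\<^sub>0"
  proof
    fix \<beta> assume \<beta>: "\<beta> \<in> Q'"
    then have S: "\<beta> \<in> S" using assms by blast
    have "\<not> \<beta> \<bullet> \<alpha>\<^sub>0 < 0"
    proof
      assume "\<beta> \<bullet> \<alpha>\<^sub>0 < 0"
      then have "- \<beta> \<in> Q \<alpha>\<^sub>0" using S S_minus by (simp add: Q_def)
      then show False using assms \<beta> by (auto simp: QQ_def)
    qed
    moreover have "\<beta> \<bullet> \<alpha>\<^sub>0 \<noteq> 0"
    proof
      assume "\<beta> \<bullet> \<alpha>\<^sub>0 = 0"
      then obtain \<alpha> where a: "\<alpha> \<in> S" "\<alpha> \<bullet> \<alpha>\<^sub>0 = 1" "\<alpha> \<bullet> \<beta> = -1" using connecting assms S by blast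
      then have "\<alpha> \<in> Q'" using assms(3) by (auto simp: Q_def)
      moreover have "\<alpha> + \<beta> \<in> R" using R_add a S S_R by blast
      ultimately show False using assms(2) \<beta> by (auto simp: QQ_def)
    qed
    ultimately show "\<beta> \<in> Q \<alpha>\<^sub>0" using S by (simp add: Q_def)
  qed
qed (rule assms(3))

end

subsection \<open>Lie algebras with a simply laced root system\<close>

locale simply_laced_root_data = compact_root_data cs br u0 t0 h R \<rho> + simply_laced R
  for cs :: "complex \<Rightarrow> 'g::euclidean_space \<Rightarrow> 'g" and br :: "'g \<Rightarrow> 'g \<Rightarrow> 'g"
    and u0 t0 h :: "'g set" and R :: "'v::real_inner set" and \<rho> :: "'v \<Rightarrow> 'g \<Rightarrow> complex"
begin

lemma ad_surj:
  assumes "x \<in> R" "y \<in> R" "x \<bullet> y = -1" "Z \<in> gsp x" "Z \<noteq> 0" "v \<in> gsp (x + y)"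
  shows "\<exists>w\<in>gsp y. v = br Z w"
proof (rule ad_root_vector_surj[OF assms(1,2) R_add[OF assms(1-3)] _ _ _ _ assms(4-6)])
  have n: "x \<bullet> x = 2" "y \<bullet> y = 2" "y \<bullet> x = -1" using R_norm assms by (auto simp: inner_commute)
  \<comment> \<open>The neighbours beyond both ends of the string have norm 6, so they are neither
    roots nor 0.\<close>
  have "(y - x) \<bullet> (y - x) = 6" "(x + (x + y)) \<bullet> (x + (x + y)) = 6"
    using n assms(3) by (simp_all add: inner_diff inner_add)
  then show "y - x \<notin> R" "y - x \<noteq> 0" "x + (x + y) \<notin> R" "x + (x + y) \<noteq> 0"
    using R_norm by fastforce+
qed

text \<open>In \<open>root_induct\<close> the step needs the whole space of x + y to consist of
  brackets; this is where surjectivity replaces one-dimensionality of root spaces.\<close>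

lemma subalgebra_generated:
  assumes V: "complex_subalgebra V" and "h \<subseteq> V" and Q: "Q \<subseteq> R" "R \<subseteq> group_closure Q"
    and base: "\<And>x. x \<in> Q \<Longrightarrow> gsp x \<subseteq> V" "\<And>x. x \<in> Q \<Longrightarrow> gsp (- x) \<subseteq> V"
  shows "V = UNIV"
proof -
  have "gsp x \<subseteq> V" if "x \<in> R" for x
    using Q base _ that
  proof (rule root_induct)
    fix x y assume xy: "x \<in> R" "y \<in> R" "x \<bullet> y = -1" "gsp x \<subseteq> V" "gsp y \<subseteq> V"
    show "gsp (x + y) \<subseteq> V"
    proof
      fix v assume v: "v \<in> gsp (x + y)"
      obtain Z where Z: "Z \<in> gsp x" "Z \<noteq> 0" using gsp_nontrivial xy(1) by blast
      obtain w where "w \<in> gsp y" "v = br Z w" using ad_surj[OF xy(1-3) Z v] by blast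
      then show "v \<in> V" using V xy Z by (auto simp: complex_subalgebra_def)
    qed
  qed
  then have "cx.span (\<Union>x\<in>insert 0 R. gsp x) \<subseteq> V"
    using V assms(2) gsp_zero by (intro cx.span_minimal) (auto simp: complex_subalgebra_def)
  then show ?thesis using span_root_spaces by auto
qed

lemma qq_orth: "Q \<subseteq> R \<Longrightarrow> x \<in> R \<Longrightarrow> x \<notin> Q \<Longrightarrow> X \<in> qq Q \<Longrightarrow> Y \<in> gsp x \<Longrightarrow> ip Y X = 0"
  using qq_orthogonal R_nonzero by blast

text \<open>All rests on Z + \<theta> Z lying in the intersection of \<open>qq Q'\<close> with its
  conjugate, which is \<open>h\<close> by \<open>qq_cj_qq\<close>. So \<theta> preserves
  \<open>h\<close>, and on a root vector it is -1 up to an element of \<open>h\<close>.\<close>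

lemma symmetry_on_qq:
  assumes Q': "Q' \<in> QQ R"
    and \<theta>: "lie_involution \<theta>" "\<theta> ` u0 = u0" "\<theta> ` qq Q' = qq Q'"
      "\<And>Z. Z \<in> qq Q' \<Longrightarrow> Z + \<theta> Z \<in> qq Q' \<inter> cj ` qq Q'"
  shows "\<And>T. T \<in> h \<Longrightarrow> \<theta> T = T" "\<And>x X. x \<in> Q' \<Longrightarrow> X \<in> gsp x \<Longrightarrow> \<theta> X = - X"
    "\<And>x X. x \<in> Q' \<Longrightarrow> X \<in> gsp (- x) \<Longrightarrow> \<theta> X = - X"
proof -
  interpret \<theta>: Vector_Spaces.linear cs cs \<theta> using \<theta>(1) by (simp add: lie_involution_def)
  have br: "\<theta> (br X Y) = br (\<theta> X) (\<theta> Y)" for X Y using \<theta>(1) by (simp add: lie_involution_def)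
  have R: "x \<in> R" "x \<in> span R" if "x \<in> Q'" for x
    using that Q' by (auto simp: QQ_def intro: span_base)
  have sum_h: "Z + \<theta> Z \<in> h" if "Z \<in> qq Q'" for Z
    using qq_cj_qq[of Q' "Z + \<theta> Z"] Q' R_nonzero R_minus \<theta>(4)[OF that] by (auto simp: QQ_def)
  have \<theta>h: "\<theta> T \<in> h" if "T \<in> h" for T
  proof -
    have "(T + \<theta> T) - T \<in> h"
      using sum_h[OF h_qq[OF that]] that cartan_h(1) cx.subspace_diff by blast
    then show ?thesis by simp
  qed
  have main: "\<theta> X = - X \<and> (\<forall>T\<in>h. \<rho> x (\<theta> T) = \<rho> x T)" if x: "x \<in> Q'" "X \<in> gsp x" "X \<noteq> 0" for x X
  proof -
    have xs: "x \<in> span R" "x \<in> R" "x \<noteq> 0" using R[OF x(1)] R_nonzero by auto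
    define T1 where "T1 = X + \<theta> X"
    have T1: "T1 \<in> h" using sum_h[OF gsp_qq[OF x(1,2)]] by (simp add: T1_def)
    have \<theta>X: "\<theta> X = T1 - X" by (simp add: T1_def)
    \<comment> \<open>Apply \<theta> to [T, X] and insert \<theta> X = T1 - X. The two sides lie in
      the root space of x and in \<open>h\<close>, which are orthogonal, so both vanish.\<close>
    have eq: "cs (\<rho> x T - \<rho> x (\<theta> T)) X = cs (\<rho> x T) T1" if "T \<in> h" for T
    proof -
      have "br (\<theta> T) (\<theta> X) = cs (\<rho> x T) (\<theta> X)"
        using br[of T X] gsp_eig[OF x(2) that] by (simp add: \<theta>.scale)
      then have "- cs (\<rho> x (\<theta> T)) X = cs (\<rho> x T) T1 - cs (\<rho> x T) X"
        using h_abelian[OF \<theta>h[OF that] T1] gsp_eig[OF x(2) \<theta>h[OF that]]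
        by (simp add: \<theta>X br_diff_right cx.scale_right_diff_distrib)
      then show ?thesis by (simp add: cx.scale_left_diff_distrib algebra_simps)
    qed
    have "ip X T1 = 0" using gsp_orthogonal[OF xs(1) span_zero xs(3) x(2)] T1 gsp_zero by blast
    have diff: "\<rho> x T = \<rho> x (\<theta> T)" if "T \<in> h" for T
    proof -
      let ?c = "\<rho> x T - \<rho> x (\<theta> T)"
      have "cs (\<rho> x T) T1 \<in> gsp 0" using T1 gsp_zero gsp_cs by blast
      then have "ip (cs ?c X) (cs (\<rho> x T) T1) = 0"
        by (rule gsp_orthogonal[OF xs(1) span_zero xs(3) gsp_cs[OF x(2)]])
      then have "cs ?c X = 0" using eq[OF that] by simp
      then show ?thesis using x(3) by simp
    qed
    moreover have "\<exists>T\<in>h. \<rho> x T \<noteq> 0"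
      using coroot_negative[OF xs(2) x(2,3)] by force
    then have "T1 = 0" using eq diff by fastforce
    ultimately show ?thesis using \<theta>X by simp
  qed
  show neg: "\<theta> X = - X" if "x \<in> Q'" "X \<in> gsp x" for x X
    using main[OF that] by (cases "X = 0") auto
  \<comment> \<open>A complex linear map preserving the real form commutes with its conjugation,
    which carries the result from x to -x.\<close>
  have cj: "\<theta> (cj Z) = cj (\<theta> Z)" for Z
  proof -
    have U: "\<theta> X \<in> u0" if "X \<in> u0" for X using \<theta>(2) that by blast
    have "\<theta> Z = \<theta> (re Z) + cs \<i> (\<theta> (im Z))" by (subst re_im[of Z]) (simp add: \<theta>.add \<theta>.scale)
    then have "cj (\<theta> Z) = \<theta> (re Z) - cs \<i> (\<theta> (im Z))" by (simp add: cj_eq U)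
    then show ?thesis by (simp add: lie_conj_def[of _ Z] \<theta>.diff \<theta>.scale)
  qed
  show "\<theta> X = - X" if "x \<in> Q'" "X \<in> gsp (- x)" for x X
    using neg[OF that(1), of "cj X"] cj_gsp[OF span_neg[OF R(2)[OF that(1)]] that(2)] cj[of "cj X"]
    by (simp add: cj_minus)
  \<comment> \<open>T - \<theta> T is annihilated by the roots in \<open>Q'\<close>, hence by
    additivity by all roots. It is therefore central, and the center is trivial.\<close>
  show "\<theta> T = T" if "T \<in> h" for T
  proof -
    define D where "D = T - \<theta> T"
    have D: "D \<in> h" unfolding D_def using that \<theta>h cartan_h(1) cx.subspace_diff by blast
    have RQ: "Q' \<subseteq> R" "R \<subseteq> group_closure Q'" using Q' by (auto simp: QQ_def)
    have zQ: "\<rho> x D = 0" if "x \<in> Q'" for x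
    proof -
      obtain X where "X \<in> gsp x" "X \<noteq> 0" using gsp_nontrivial R(1)[OF \<open>x \<in> Q'\<close>] by blast
      then have "\<rho> x (\<theta> T) = \<rho> x T" using main \<open>x \<in> Q'\<close> \<open>T \<in> h\<close> by blast
      then show ?thesis
        using rho_h(2)[OF R(2)[OF \<open>x \<in> Q'\<close>] \<open>T \<in> h\<close> \<theta>h[OF \<open>T \<in> h\<close>]] by (simp add: D_def)
    qed
    have "\<rho> x D = 0" if "x \<in> R" for x
      by (rule root_induct[OF RQ _ _ _ that])
        (auto simp: zQ rho_minus R(2) rho_add span_base)
    then have "br D X = 0" if "X \<in> (\<Union>x\<in>insert 0 R. gsp x)" for X
      using that gsp_eig[OF _ D] h_abelian[OF D] gsp_zero by auto
    then have "br D X = 0" for X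
      using br_span_span[of "{D}" "\<Union>x\<in>insert 0 R. gsp x" "{0}" D X] span_root_spaces
      by (simp add: cx.span_base cx.subspace_def)
    then show ?thesis using center_trivial[of D] by (simp add: D_def)
  qed
qed

end

section \<open>The involution attached to a gradation\<close>

locale rich_graded_root_data = simply_laced_root_data cs br u0 t0 h R \<rho> + rich_graded_root_system R b
  for cs :: "complex \<Rightarrow> 'g::euclidean_space \<Rightarrow> 'g" and br :: "'g \<Rightarrow> 'g \<Rightarrow> 'g"
    and u0 t0 h :: "'g set" and R :: "'v::real_inner set" and \<rho> :: "'v \<Rightarrow> 'g \<Rightarrow> complex" and b :: 'v
begin

text \<open>The sum of the weight spaces of parity \<open>p\<close>. Index 0 has weight space
  \<open>h\<close> and is even.\<close>

definition G :: "bool \<Rightarrow> 'g set" where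
  "G p = cx.span (\<Union>x\<in>{x \<in> insert 0 R. par x = p}. gsp x)"

lemma G_subspace: "cx.subspace (G p)"
  by (simp add: G_def)

lemmas G_closed = cx.subspace_add[OF G_subspace] cx.subspace_diff[OF G_subspace]
  cx.subspace_scale[OF G_subspace]

lemma gsp_G: "x \<in> insert 0 R \<Longrightarrow> X \<in> gsp x \<Longrightarrow> X \<in> G (par x)"
  unfolding G_def by (rule cx.span_base) blast

lemma h_G: "T \<in> h \<Longrightarrow> T \<in> G False"
  using gsp_G[of 0 T] gsp_zero par_zero by simp

lemma insert_0_span: "x \<in> insert 0 R \<Longrightarrow> x \<in> span R"
  by (auto intro: span_base span_zero)

text \<open>Orthogonality stands in for directness of the sum: a vector in both parts is orthogonal
  to itself.\<close>

lemma G_orth: assumes "X \<in> G p" "Y \<in> G (\<not> p)" shows "ip X Y = 0"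
proof (rule ip_cx_span[OF _ assms(2)[unfolded G_def]])
  fix t d assume "t \<in> (\<Union>x\<in>{x \<in> insert 0 R. par x = (\<not> p)}. gsp x)"
  then obtain y where y: "y \<in> insert 0 R" "par y = (\<not> p)" "t \<in> gsp y" by blast
  have "ip (cs d t) X = 0"
  proof (rule ip_cx_span[OF _ assms(1)[unfolded G_def]])
    fix s c assume "s \<in> (\<Union>x\<in>{x \<in> insert 0 R. par x = p}. gsp x)"
    then obtain x where x: "x \<in> insert 0 R" "par x = p" "s \<in> gsp x" by blast
    then have "y \<noteq> x" using y by auto
    then show "ip (cs d t) (cs c s) = 0"
      using gsp_orthogonal[OF insert_0_span[OF y(1)] insert_0_span[OF x(1)] _ gsp_cs[OF y(3)] gsp_cs[OF x(3)]]
      by blast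
  qed
  then show "ip X (cs d t) = 0" by (simp add: ip_sym)
qed

lemma G_decomp: "\<exists>e\<in>G False. X - e \<in> G True"
proof -
  have "insert 0 R = {x \<in> insert 0 R. par x = False} \<union> {x \<in> insert 0 R. par x = True}" by blast
  then have "X \<in> cx.span ((\<Union>x\<in>{x \<in> insert 0 R. par x = False}. gsp x)
      \<union> (\<Union>x\<in>{x \<in> insert 0 R. par x = True}. gsp x))"
    using span_root_spaces by (metis UN_Un UNIV_I)
  then obtain e o' where "X = e + o'" "e \<in> G False" "o' \<in> G True"
    unfolding cx.span_Un G_def by blast
  then show ?thesis by (intro bexI[of _ e]) simp_all
qed

lemma G_br: assumes "X \<in> G p" "Y \<in> G q" shows "br X Y \<in> G (p \<noteq> q)"
proof (rule br_span_span[OF _ G_subspace assms[unfolded G_def]])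
  fix X Y assume "X \<in> (\<Union>x\<in>{x \<in> insert 0 R. par x = p}. gsp x)" "Y \<in> (\<Union>x\<in>{x \<in> insert 0 R. par x = q}. gsp x)"
  then obtain x y where xy: "x \<in> insert 0 R" "par x = p" "X \<in> gsp x" "y \<in> insert 0 R" "par y = q" "Y \<in> gsp y"
    by blast
  have XY: "br X Y \<in> gsp (x + y)" using gsp_br xy insert_0_span by blast
  show "br X Y \<in> G (p \<noteq> q)"
  proof (cases "x + y \<in> insert 0 R")
    case True
    then show ?thesis using gsp_G[OF True XY] par_add[OF xy(1,4)] xy(2,5) by simp
  next
    case False
    have "br X Y = 0"
      using gsp_trivial[OF span_add[OF insert_0_span[OF xy(1)] insert_0_span[OF xy(4)]] _ _ XY] False by auto
    then show ?thesis using cx.subspace_0[OF G_subspace] by simp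
  qed
qed

lemma G_cj: assumes "X \<in> G p" shows "cj X \<in> G p"
  using assms[unfolded G_def]
proof (induction rule: cx.span_induct_alt)
  case base
  then show ?case using cx.subspace_0[OF G_subspace] by simp
next
  case (step c a X)
  then obtain x where x: "x \<in> insert 0 R" "par x = p" "a \<in> gsp x" by blast
  have "- x \<in> insert 0 R" using x(1) R_minus by auto
  then have "cj a \<in> G p" using gsp_G[OF _ cj_gsp[OF insert_0_span[OF x(1)] x(3)]] par_minus[OF x(1)] x(2) by simp
  then show ?case using step by (simp add: cj_add cj_cs G_closed)
qed

text \<open>The even component. The choice is unique because the two parts meet only in 0, which is
  how \<open>grading_eq\<close> evaluates it.\<close>

definition ev :: "'g \<Rightarrow> 'g" where "ev X = (SOME e. e \<in> G False \<and> X - e \<in> G True)"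

definition grading :: "'g \<Rightarrow> 'g" where "grading X = ev X - (X - ev X)"

lemma ev_in: "ev X \<in> G False" "X - ev X \<in> G True"
proof -
  have "ev X \<in> G False \<and> X - ev X \<in> G True"
    unfolding ev_def by (rule someI_ex) (use G_decomp in blast)
  then show "ev X \<in> G False" "X - ev X \<in> G True" by blast+
qed

lemma grading_eq: assumes "e \<in> G False" "o' \<in> G True" shows "grading (e + o') = e - o'"
proof -
  let ?d = "ev (e + o') - e"
  have "?d \<in> G False" using ev_in assms G_closed by blast
  moreover have "o' - (e + o' - ev (e + o')) \<in> G True" using ev_in assms G_closed by blast
  then have "?d \<in> G True" by simp
  ultimately have "ip ?d ?d = 0" using G_orth[of ?d False ?d] by simp
  then show ?thesis by (simp add: grading_def)
qed

lemma G_cases: obtains e o' where "X = e + o'" "e \<in> G False" "o' \<in> G True"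
  using ev_in[of X] that[of "ev X" "X - ev X"] by simp

lemma grading_even: "e \<in> G False \<Longrightarrow> grading e = e" and grading_odd: "e \<in> G True \<Longrightarrow> grading e = - e"
  using grading_eq[of e 0] grading_eq[of 0 e] cx.subspace_0[OF G_subspace] by simp_all

lemma grading_add: "grading (X + Y) = grading X + grading Y"
proof -
  obtain e o' where X: "X = e + o'" "e \<in> G False" "o' \<in> G True" by (rule G_cases)
  obtain f p where Y: "Y = f + p" "f \<in> G False" "p \<in> G True" by (rule G_cases)
  have "grading ((e + f) + (o' + p)) = (e + f) - (o' + p)"
    using X Y by (intro grading_eq G_closed)
  moreover have "X + Y = (e + f) + (o' + p)" using X Y by simp
  ultimately have "grading (X + Y) = (e + f) - (o' + p)" by (simp only:)
  then show ?thesis using X Y grading_eq by simp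
qed

lemma grading_cs: "grading (cs c X) = cs c (grading X)"
proof -
  obtain e o' where X: "X = e + o'" "e \<in> G False" "o' \<in> G True" by (rule G_cases)
  have "grading (cs c e + cs c o') = cs c e - cs c o'"
    using X by (intro grading_eq G_closed)
  then show ?thesis using X grading_eq by (simp add: cx.scale_right_distrib cx.scale_right_diff_distrib)
qed

lemma grading_br: "grading (br X Y) = br (grading X) (grading Y)"
proof -
  obtain e o' where X: "X = e + o'" "e \<in> G False" "o' \<in> G True" by (rule G_cases)
  obtain f p where Y: "Y = f + p" "f \<in> G False" "p \<in> G True" by (rule G_cases)
  have "br e f \<in> G False" "br o' p \<in> G False" "br e p \<in> G True" "br o' f \<in> G True"
    using G_br[of _ False _ False] G_br[of _ True _ True] G_br[of _ False _ True] G_br[of _ True _ False] X Y by simp_all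
  then have "grading ((br e f + br o' p) + (br e p + br o' f)) = (br e f + br o' p) - (br e p + br o' f)"
    by (intro grading_eq G_closed)
  moreover have "br X Y = (br e f + br o' p) + (br e p + br o' f)"
    using X Y by (simp add: br_add_left br_add_right)
  ultimately have "grading (br X Y) = (br e f + br o' p) - (br e p + br o' f)" by (simp only:)
  moreover have "grading X = e - o'" "grading Y = f - p" using X Y grading_eq by simp_all
  moreover have "br (e - o') (f - p) = (br e f + br o' p) - (br e p + br o' f)"
    by (simp add: br_diff_left br_diff_right)
  ultimately show ?thesis by (simp only:)
qed

lemma grading_grading: "grading (grading X) = X"
proof -
  obtain e o' where X: "X = e + o'" "e \<in> G False" "o' \<in> G True" by (rule G_cases)
  have "- o' \<in> G True" using G_closed(3)[of o' True "-1"] X by simp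
  then show ?thesis using X grading_eq[of e o'] grading_eq[of e "- o'"] by simp
qed

lemma grading_cj: "grading (cj X) = cj (grading X)"
proof -
  obtain e o' where X: "X = e + o'" "e \<in> G False" "o' \<in> G True" by (rule G_cases)
  then show ?thesis using grading_eq[of e o'] grading_eq[of "cj e" "cj o'"] G_cj by (simp add: cj_add cj_diff)
qed

lemma grading_linear: "Vector_Spaces.linear cs cs grading"
  by unfold_locales (simp_all add: grading_add grading_cs)

lemma grading_involution: "lie_involution grading"
  by (simp add: lie_involution_def grading_linear grading_br grading_grading)

lemma grading_gsp: "x \<in> S \<Longrightarrow> X \<in> gsp x \<Longrightarrow> grading X = - X"
  using gsp_G[of x X] grading_odd by (simp add: S_def)

text \<open>Since \<open>Q0\<close> is odd, Z plus its image is twice the component of Z in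
  \<open>h\<close>, and \<open>h\<close> is stable under conjugation. The condition on fixed points
  holds because \<open>qq Q0\<close> and its conjugate generate the whole algebra.\<close>

lemma CR_symmetric_qq:
  assumes Q0: "Q0 \<in> QQ R" "Q0 \<subseteq> S"
  shows "CR_symmetric u0 (qq Q0)"
  unfolding CR_symmetric_def
proof (intro exI[of _ grading] conjI ballI)
  interpret grading: Vector_Spaces.linear cs cs grading by (rule grading_linear)
  show "lie_involution grading" by (rule grading_involution)
  have inv: "grading ` V = V" if "\<And>X. X \<in> V \<Longrightarrow> grading X \<in> V" for V
    using that grading_grading by (auto intro!: image_eqI[of _ grading "grading _"])
  show "grading ` u0 = u0"
    by (rule inv) (metis cj_fixed_iff grading_cj)
  have main: "grading Z \<in> qq Q0 \<and> Z + grading Z \<in> h" if "Z \<in> qq Q0" for Z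
    using that[unfolded qq_def]
  proof (induction rule: cx.span_induct_alt)
    case base
    then show ?case using cx.subspace_0 qq_subspace cartan_h(1) by auto
  next
    case (step c a Z)
    have "grading a \<in> qq Q0 \<and> a + grading a \<in> h"
    proof (cases "a \<in> h")
      case True
      then show ?thesis using grading_even[OF h_G[OF True]] h_qq cartan_h(1) cx.subspace_add by auto
    next
      case False
      then obtain x where x: "x \<in> Q0" "a \<in> gsp x" using step by blast
      then have "grading a = - a" using grading_gsp Q0 by blast
      then show ?thesis
        using gsp_qq[OF x] cx.subspace_neg[OF qq_subspace] cx.subspace_0[OF cartan_h(1)] by simp
    qed
    then have "cs c (grading a) + grading Z \<in> qq Q0" "cs c (a + grading a) + (Z + grading Z) \<in> h"
      using step qq_subspace cartan_h(1) by (blast intro: cx.subspace_add cx.subspace_scale)+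
    then show ?case by (simp add: grading.add grading.scale cx.scale_right_distrib algebra_simps)
  qed
  show "grading ` qq Q0 = qq Q0" by (rule inv) (use main in blast)
  show "Z + grading Z \<in> qq Q0 \<inter> cj ` qq Q0" if "Z \<in> qq Q0" for Z
  proof -
    have Zh: "Z + grading Z \<in> h" using main[OF that] by blast
    then have "cj (cj (Z + grading Z)) \<in> cj ` qq Q0" by (intro imageI h_qq cj_h)
    then show ?thesis using h_qq[OF Zh] by simp
  qed
  let ?q = "{Z + W |Z W. Z \<in> qq Q0 \<and> W \<in> cj ` qq Q0}"
  have "V = UNIV" if V: "complex_subalgebra V" "?q \<subseteq> V" for V
  proof (rule subalgebra_generated[OF V(1)])
    have zero: "0 \<in> qq Q0" by (rule cx.subspace_0[OF qq_subspace])
    have q: "X \<in> V" if "X \<in> qq Q0" for X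
    proof -
      have "X + cj 0 \<in> ?q" using that zero by blast
      then show ?thesis using V by auto
    qed
    have cq: "cj X \<in> V" if "X \<in> qq Q0" for X
    proof -
      have "0 + cj X \<in> ?q" using that zero by blast
      then show ?thesis using V by auto
    qed
    show "h \<subseteq> V" using q h_qq by blast
    show QR: "Q0 \<subseteq> R" "R \<subseteq> group_closure Q0" using Q0 by (auto simp: QQ_def)
    show "gsp x \<subseteq> V" if "x \<in> Q0" for x using q gsp_qq that by blast
    show "gsp (- x) \<subseteq> V" if "x \<in> Q0" for x
    proof
      fix X assume X: "X \<in> gsp (- x)"
      have "- x \<in> span R" using that QR(1) by (blast intro: span_base span_neg)
      then have "cj X \<in> gsp x" using cj_gsp[OF _ X] by simp
      from cq[OF gsp_qq[OF that this]] show "X \<in> V" by simp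
    qed
  qed
  note generated = this
  show "{X. X - grading X = 0} \<subseteq> complex_subalgebra hull ?q"
    unfolding hull_def
  proof (rule Inter_greatest)
    fix V assume "V \<in> {t. complex_subalgebra t \<and> ?q \<subseteq> t}"
    then have "V = UNIV" by (elim CollectE conjE) (rule generated)
    then show "{X. X - grading X = 0} \<subseteq> V" by (simp only: subset_UNIV)
  qed
qed

text \<open>The elements on which \<theta> and \<open>grading\<close> agree form a complex
  subalgebra; it contains \<open>h\<close> and the root spaces of \<plusminus>Q, hence everything.
  For an even x in \<open>Q'\<close> the common map would be both 1 and -1 on the root
  space.\<close>

lemma QQ_s_subset_S:
  assumes \<alpha>\<^sub>0: "\<alpha>\<^sub>0 \<in> S" and Q': "Q' \<in> QQ_s" "Q \<alpha>\<^sub>0 \<subseteq> Q'"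
  shows "Q' \<subseteq> S"
proof
  obtain \<theta> where \<theta>: "lie_involution \<theta>" "\<theta> ` u0 = u0" "\<theta> ` qq Q' = qq Q'"
      "\<And>Z. Z \<in> qq Q' \<Longrightarrow> Z + \<theta> Z \<in> qq Q' \<inter> cj ` qq Q'"
    using Q' by (auto simp: QQ_s_def CR_symmetric_def)
  have QQ: "Q' \<in> QQ R" using Q' by (simp add: QQ_s_def)
  interpret \<theta>: Vector_Spaces.linear cs cs \<theta> using \<theta>(1) by (simp add: lie_involution_def)
  have \<theta>_br: "\<theta> (br X Y) = br (\<theta> X) (\<theta> Y)" for X Y using \<theta>(1) by (simp add: lie_involution_def)
  have sym: "\<And>T. T \<in> h \<Longrightarrow> \<theta> T = T" "\<And>x X. x \<in> Q' \<Longrightarrow> X \<in> gsp x \<Longrightarrow> \<theta> X = - X"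
    "\<And>x X. x \<in> Q' \<Longrightarrow> X \<in> gsp (- x) \<Longrightarrow> \<theta> X = - X"
    using symmetry_on_qq[OF QQ \<theta>] by blast+
  have "{X. \<theta> X = grading X} = UNIV"
  proof (rule subalgebra_generated[of _ "Q \<alpha>\<^sub>0"])
    show "complex_subalgebra {X. \<theta> X = grading X}"
      unfolding complex_subalgebra_def cx.subspace_def
      using grading_even[OF cx.subspace_0[OF G_subspace]]
      by (simp add: \<theta>.zero \<theta>.add \<theta>.scale grading_add grading_cs \<theta>_br grading_br)
    show "h \<subseteq> {X. \<theta> X = grading X}" using sym(1) h_G grading_even by auto
    show "Q \<alpha>\<^sub>0 \<subseteq> R" "R \<subseteq> group_closure (Q \<alpha>\<^sub>0)" using Q_in_QQ[OF \<alpha>\<^sub>0] by (auto simp: QQ_def)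
    fix x assume "x \<in> Q \<alpha>\<^sub>0"
    then have x: "x \<in> Q'" "x \<in> S" using Q'(2) Q_S by blast+
    show "gsp x \<subseteq> {X. \<theta> X = grading X}"
      using sym(2)[OF x(1)] grading_gsp[OF x(2)] by auto
    show "gsp (- x) \<subseteq> {X. \<theta> X = grading X}"
      using sym(3)[OF x(1)] grading_gsp[OF S_minus[OF x(2)]] by auto
  qed
  then have eq: "\<theta> X = grading X" for X by blast
  fix x assume x: "x \<in> Q'"
  show "x \<in> S"
  proof (rule ccontr)
    assume "x \<notin> S"
    moreover have xR: "x \<in> R" using x QQ by (auto simp: QQ_def)
    ultimately have "\<not> par x" by (simp add: S_def)
    obtain X where X: "X \<in> gsp x" "X \<noteq> 0" using gsp_nontrivial[OF xR] by blast
    have "X \<in> G False" using gsp_G[of x X] xR X(1) \<open>\<not> par x\<close> by simp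
    then have "- X = X" using sym(2)[OF x X(1)] eq grading_even by metis
    then have "2 *\<^sub>R X = 0" by (metis add.right_inverse scaleR_2)
    then show False using X(2) by simp
  qed
qed

lemma maximal_Q: assumes "\<alpha>\<^sub>0 \<in> S" shows "maximal_in QQ_s (Q \<alpha>\<^sub>0)"
  unfolding maximal_in_def
proof (intro conjI ballI impI)
  show "Q \<alpha>\<^sub>0 \<in> QQ_s"
    using Q_in_QQ[OF assms] CR_symmetric_qq[OF Q_in_QQ[OF assms]] Q_S by (auto simp: QQ_s_def)
  show "Q' = Q \<alpha>\<^sub>0" if "Q' \<in> QQ_s" "Q \<alpha>\<^sub>0 \<subseteq> Q'" for Q'
    using Q_maximal_in_S[OF assms _ that(2) QQ_s_subset_S[OF assms that]] that(1) by (simp add: QQ_s_def)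
qed

text \<open>The exponential is abstracted to what is used of it: a complex automorphism that
  commutes with conjugation, covers \<open>h\<close> by the image of \<open>h\<close>, and satisfies
  the weak-J condition.\<close>

lemma automorphism_contradiction:
  assumes \<alpha>\<^sub>0: "\<alpha>\<^sub>0 \<in> S" and lin: "Vector_Spaces.linear cs cs \<Upsilon>"
    and \<Upsilon>_br: "\<And>X Y. \<Upsilon> (br X Y) = br (\<Upsilon> X) (\<Upsilon> Y)" and \<Upsilon>_cj: "\<And>X. \<Upsilon> (cj X) = cj (\<Upsilon> X)"
    and \<Upsilon>_h: "h \<subseteq> \<Upsilon> ` h"
    and J: "\<And>X. X \<in> re ` qq (Q \<alpha>\<^sub>0) \<Longrightarrow> X + cs \<i> (\<Upsilon> X) \<in> qq (Q \<alpha>\<^sub>0)"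
  shows False
proof -
  interpret \<Upsilon>: Vector_Spaces.linear cs cs \<Upsilon> by (rule lin)
  have scaleR: "\<Upsilon> (r *\<^sub>R X) = r *\<^sub>R \<Upsilon> X" for r X by (metis \<Upsilon>.scale cs_of_real)
  let ?q = "qq (Q \<alpha>\<^sub>0)"
  have QR: "Q \<alpha>\<^sub>0 \<subseteq> R" using Q_S S_R by blast
  have neg: "\<Upsilon> W = cs \<i> W" if \<alpha>: "\<alpha> \<in> Q \<alpha>\<^sub>0" and W: "W \<in> gsp (- \<alpha>)" for \<alpha> W
  proof (cases "W = 0")
    case True
    then show ?thesis by simp
  next
    case False
    have R: "- \<alpha> \<in> R" "- \<alpha> \<in> span R" "- \<alpha> \<notin> Q \<alpha>\<^sub>0"
      using \<alpha> QR R_minus by (auto intro: span_base span_neg simp: Q_def)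
    have Z: "cj W \<in> gsp \<alpha>" using cj_gsp[OF R(2) W] by simp
    have reZ: "re (cj W) = (1/2) *\<^sub>R (cj W + W)" by (simp add: re_cj)
    have reiZ: "re (cs \<i> (cj W)) = (1/2) *\<^sub>R (cs \<i> (cj W) - cs \<i> W)" by (simp add: re_cj cj_i)
    \<comment> \<open>With Z = \<open>cj W\<close> one has Re Z + i Re(iZ) = W. The same combination
      of the two instances of the weak-J condition therefore gives W + i \<Upsilon> W.\<close>
    let ?A1 = "re (cj W) + cs \<i> (\<Upsilon> (re (cj W)))"
    let ?A2 = "re (cs \<i> (cj W)) + cs \<i> (\<Upsilon> (re (cs \<i> (cj W))))"
    have "?A1 \<in> ?q" "?A2 \<in> ?q"
      using J gsp_qq[OF \<alpha>] Z gsp_cs[OF Z] by blast+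
    then have "?A1 + cs \<i> ?A2 \<in> ?q"
      using qq_subspace by (blast intro: cx.subspace_add cx.subspace_scale)
    moreover have "?A1 + cs \<i> ?A2 = W + cs \<i> (\<Upsilon> W)"
    proof -
      have "?A1 + cs \<i> ?A2 = (1/2) *\<^sub>R (W + W) + (1/2) *\<^sub>R (cs \<i> (\<Upsilon> W) + cs \<i> (\<Upsilon> W))"
        unfolding reZ reiZ
        by (simp add: scaleR \<Upsilon>.add \<Upsilon>.diff \<Upsilon>.scale cs_i_scaleR cx.scale_right_distrib
            cx.scale_right_diff_distrib algebra_simps)
      then show ?thesis by (simp flip: scaleR_2)
    qed
    ultimately have q: "W + cs \<i> (\<Upsilon> W) \<in> ?q" by simp
    \<comment> \<open>-\<alpha> is not in Q, so \<open>qq\<close> is orthogonal to its root space.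
      In particular i \<Upsilon> W has nonzero product with W.\<close>
    have orth: "ip V (W + cs \<i> (\<Upsilon> W)) = 0" if "V \<in> gsp (- \<alpha>)" for V
      by (rule qq_orth[OF QR R(1,3) q that])
    \<comment> \<open>\<Upsilon> W is an eigenvector of T = \<Upsilon> T' with the eigenvalue that W
      has for T'. If W had another eigenvalue for T, then W and i \<Upsilon> W would be
      orthogonal.\<close>
    have t: "br T (\<Upsilon> W) = cs (\<rho> (- \<alpha>) T) (\<Upsilon> W)" if T: "T \<in> t0" for T
    proof -
      obtain T' where T': "T' \<in> h" "T = \<Upsilon> T'" using \<Upsilon>_h t0_h[OF T] by blast
      have e: "br T (\<Upsilon> W) = cs (\<rho> (- \<alpha>) T') (\<Upsilon> W)"
        using \<Upsilon>_br[of T' W] gsp_eig[OF W T'(1)] T'(2) by (simp add: \<Upsilon>.scale)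
      then have "br T (cs \<i> (\<Upsilon> W)) = cs (\<rho> (- \<alpha>) T') (cs \<i> (\<Upsilon> W))"
        by (simp add: br_scale_right cx.scale_left_commute)
      moreover have "ip W (cs \<i> (\<Upsilon> W)) \<noteq> 0"
        using orth[OF W] ip_pos[OF False] by (simp add: ip_add_right)
      ultimately have "\<rho> (- \<alpha>) T = \<rho> (- \<alpha>) T'"
        using ip_eigenvectors[OF T gsp_eig[OF W t0_h[OF T]]] by blast
      then show ?thesis using e by simp
    qed
    have "br T (\<Upsilon> W) = cs (\<rho> (- \<alpha>) T) (\<Upsilon> W)" if "T \<in> h" for T
    proof -
      obtain A B where AB: "A \<in> t0" "B \<in> t0" "T = A + cs \<i> B" using \<open>T \<in> h\<close> h_form by blast
      then have "A \<in> h" "B \<in> h" "cs \<i> B \<in> h" using t0_h cartan_h(1) cx.subspace_scale by blast+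
      then have "\<rho> (- \<alpha>) T = \<rho> (- \<alpha>) A + \<i> * \<rho> (- \<alpha>) B"
        using rho_h[OF R(2)] AB(3) by metis
      then show ?thesis using t[OF AB(1)] t[OF AB(2)]
        by (simp add: AB(3) br_add_left br_scale_left cx.scale_left_distrib)
    qed
    then have "\<Upsilon> W \<in> gsp (- \<alpha>)" by (simp add: root_space_def)
    then have "W + cs \<i> (\<Upsilon> W) \<in> gsp (- \<alpha>)"
      using W root_space_subspace gsp_cs cx.subspace_add by blast
    \<comment> \<open>The vector lies in the root space of -\<alpha> and is orthogonal to that
      space.\<close>
    then have "W + cs \<i> (\<Upsilon> W) = 0" using orth ip_eq_0 by blast
    then have "cs \<i> (W + cs \<i> (\<Upsilon> W)) = 0" by simp
    then show ?thesis by (simp add: cx.scale_right_distrib)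
  qed
  have pos: "\<Upsilon> Z = - cs \<i> Z" if "\<alpha> \<in> Q \<alpha>\<^sub>0" "Z \<in> gsp \<alpha>" for \<alpha> Z
  proof -
    have "cj Z \<in> gsp (- \<alpha>)" using cj_gsp that QR by (auto intro: span_base)
    then have "\<Upsilon> (cj (cj Z)) = cj (cs \<i> (cj Z))" using neg[OF that(1)] \<Upsilon>_cj by metis
    then show ?thesis by (simp add: cj_i)
  qed
  have ort: "\<Upsilon> v = - cs \<i> v" if \<beta>: "\<beta> \<in> S" "\<beta> \<bullet> \<alpha>\<^sub>0 = 0" "v \<in> gsp \<beta>" for \<beta> v
  proof -
    obtain \<alpha>\<^sub>1 \<alpha>\<^sub>2 where a: "\<alpha>\<^sub>1 \<in> Q \<alpha>\<^sub>0" "\<alpha>\<^sub>2 \<in> Q \<alpha>\<^sub>0" "\<beta> = \<alpha>\<^sub>1 + (\<alpha>\<^sub>2 + - \<alpha>\<^sub>0)"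
      "\<alpha>\<^sub>2 \<bullet> - \<alpha>\<^sub>0 = -1" "\<alpha>\<^sub>1 \<bullet> (\<alpha>\<^sub>2 + - \<alpha>\<^sub>0) = -1"
      using orthogonal_split[OF \<alpha>\<^sub>0 \<beta>(1,2)] by blast
    have R: "\<alpha>\<^sub>1 \<in> R" "\<alpha>\<^sub>2 \<in> R" "- \<alpha>\<^sub>0 \<in> R" using a QR \<alpha>\<^sub>0 S_R R_minus by blast+
    have R2: "\<alpha>\<^sub>2 + - \<alpha>\<^sub>0 \<in> R" by (rule R_add[OF R(2,3) a(4)])
    have a0: "\<alpha>\<^sub>0 \<in> Q \<alpha>\<^sub>0" using \<alpha>\<^sub>0 R_norm[OF S_R] by (simp add: Q_def)
    obtain Z1 Z2 where Z: "Z1 \<in> gsp \<alpha>\<^sub>1" "Z1 \<noteq> 0" "Z2 \<in> gsp \<alpha>\<^sub>2" "Z2 \<noteq> 0"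
      using gsp_nontrivial R by blast
    obtain w where w: "w \<in> gsp (\<alpha>\<^sub>2 + - \<alpha>\<^sub>0)" "v = br Z1 w"
      using ad_surj[OF R(1) R2 a(5) Z(1,2)] \<beta>(3) a(3) by blast
    obtain u where u: "u \<in> gsp (- \<alpha>\<^sub>0)" "w = br Z2 u"
      using ad_surj[OF R(2,3) a(4) Z(3,4) w(1)] by blast
    \<comment> \<open>The factor -i from \<open>\<alpha>\<^sub>2\<close> cancels the factor i from
      \<open>- \<alpha>\<^sub>0\<close>; bracketing with a vector of \<open>\<alpha>\<^sub>1\<close>
      then leaves -i.\<close>
    have "\<Upsilon> w = w"
      using neg[OF a0 u(1)] pos[OF a(2) Z(3)] u(2)
      by (simp add: \<Upsilon>_br br_minus_left br_scale_left br_scale_right)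
    then show ?thesis
      using pos[OF a(1) Z(1)] w(2) by (simp add: \<Upsilon>_br br_minus_left br_scale_left)
  qed
  obtain \<beta> where \<beta>: "\<beta> \<in> S" "\<beta> \<bullet> \<alpha>\<^sub>0 = 0" using orthogonal_exists \<alpha>\<^sub>0 by blast
  obtain v where v: "v \<in> gsp \<beta>" "v \<noteq> 0" using gsp_nontrivial S_R \<beta>(1) by blast
  \<comment> \<open>-\<beta> is odd and orthogonal to \<open>\<alpha>\<^sub>0\<close> too, so
    \<Upsilon> is -i on \<open>cj v\<close>; conjugating its value on v gives i instead.\<close>
  have "cj v \<in> gsp (- \<beta>)" using cj_gsp v(1) \<beta>(1) S_R span_base by blast
  then have "\<Upsilon> (cj v) = - cs \<i> (cj v)" using ort[OF S_minus[OF \<beta>(1)]] \<beta>(2) by simp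
  moreover have "\<Upsilon> (cj v) = cs \<i> (cj v)" using \<Upsilon>_cj ort[OF \<beta> v(1)] by (simp add: cj_i cj_minus)
  ultimately have "cs \<i> (cs \<i> (cj v)) = cs \<i> (- cs \<i> (cj v))" by simp
  then have "- cj v = cj v" by simp
  then have "2 *\<^sub>R cj v = 0" by (metis add.right_inverse scaleR_2)
  then show False using v(2) by simp
qed

end

subsection \<open>Exponentials of derivations\<close>

lemma bilinear_expand:
  fixes f :: "'p::euclidean_space \<Rightarrow> 'q::euclidean_space \<Rightarrow> 'r::real_vector"
  assumes "bilinear f"
  shows "f x y = (\<Sum>d\<in>Basis. \<Sum>e\<in>Basis. ((x \<bullet> d) * (y \<bullet> e)) *\<^sub>R f d e)"
proof -
  have lin: "linear (\<lambda>x. f x z)" "linear (f z')" for z z' using assms by (auto simp: bilinear_def)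
  have "f x y = f (\<Sum>d\<in>Basis. (x \<bullet> d) *\<^sub>R d) y" by (simp add: euclidean_representation)
  also have "\<dots> = (\<Sum>d\<in>Basis. (x \<bullet> d) *\<^sub>R f d y)"
    by (simp add: linear_sum[OF lin(1)] linear_cmul[OF lin(1)])
  also have "\<dots> = (\<Sum>d\<in>Basis. (x \<bullet> d) *\<^sub>R (\<Sum>e\<in>Basis. (y \<bullet> e) *\<^sub>R f d e))"
  proof (rule sum.cong[OF refl])
    fix d
    have "f d y = f d (\<Sum>e\<in>Basis. (y \<bullet> e) *\<^sub>R e)" by (simp add: euclidean_representation)
    also have "\<dots> = (\<Sum>e\<in>Basis. (y \<bullet> e) *\<^sub>R f d e)"
      by (simp add: linear_sum[OF lin(2)] linear_cmul[OF lin(2)])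
    finally show "(x \<bullet> d) *\<^sub>R f d y = (x \<bullet> d) *\<^sub>R (\<Sum>e\<in>Basis. (y \<bullet> e) *\<^sub>R f d e)" by simp
  qed
  finally show ?thesis by (simp add: scaleR_sum_right)
qed

text \<open>In coordinates the statement becomes a finite combination of Cauchy products of
  absolutely convergent real series.\<close>

lemma bilinear_Cauchy_product_sums:
  fixes f :: "'p::euclidean_space \<Rightarrow> 'q::euclidean_space \<Rightarrow> 'r::real_normed_vector"
  assumes f: "bilinear f" and a: "summable (\<lambda>n. norm (a n))" and c: "summable (\<lambda>n. norm (c n))"
  shows "(\<lambda>n. \<Sum>k\<le>n. f (a k) (c (n - k))) sums f (\<Sum>n. a n) (\<Sum>n. c n)"
proof -
  have comp: "summable (\<lambda>n. norm (g n \<bullet> d))" if "summable (\<lambda>n. norm (g n))" "d \<in> Basis"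
    for g :: "nat \<Rightarrow> 's::euclidean_space" and d
    using that by (intro summable_comparison_test'[OF that(1)]) (simp add: Basis_le_norm)
  have inner: "(\<Sum>n. g n \<bullet> d) = (\<Sum>n. g n) \<bullet> d" if "summable (\<lambda>n. norm (g n))"
    for g :: "nat \<Rightarrow> 's::euclidean_space" and d
    by (rule bounded_linear.suminf[OF bounded_linear_inner_left summable_norm_cancel[OF that], symmetric])
  have "(\<lambda>n. \<Sum>d\<in>Basis. \<Sum>e\<in>Basis. (\<Sum>k\<le>n. (a k \<bullet> d) * (c (n - k) \<bullet> e)) *\<^sub>R f d e)
     sums (\<Sum>d\<in>Basis. \<Sum>e\<in>Basis. ((\<Sum>n. a n \<bullet> d) * (\<Sum>n. c n \<bullet> e)) *\<^sub>R f d e)"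
    by (intro sums_sum sums_scaleR_left Cauchy_product_sums comp a c)
  moreover have "(\<Sum>d\<in>Basis. \<Sum>e\<in>Basis. (\<Sum>k\<le>n. (a k \<bullet> d) * (c (n - k) \<bullet> e)) *\<^sub>R f d e)
      = (\<Sum>k\<le>n. f (a k) (c (n - k)))" for n
    by (subst bilinear_expand[OF f])
      (simp add: scaleR_sum_left sum.swap[where A = "{..n}"])
  moreover have "(\<Sum>d\<in>Basis. \<Sum>e\<in>Basis. ((\<Sum>n. a n \<bullet> d) * (\<Sum>n. c n \<bullet> e)) *\<^sub>R f d e)
      = f (\<Sum>n. a n) (\<Sum>n. c n)"
    by (subst bilinear_expand[OF f]) (simp add: inner a c)
  ultimately show ?thesis by simp
qed

lemma exp_summable:
  fixes D :: "'g::euclidean_space \<Rightarrow> 'g"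
  assumes "linear D"
  shows "summable (\<lambda>n. norm ((1 / fact n) *\<^sub>R (D ^^ n) X))"
proof -
  obtain B where B: "\<And>X. norm (D X) \<le> B * norm X" "B > 0"
    using linear_bounded_pos[OF assms] by metis
  have "norm ((D ^^ n) X) \<le> B ^ n * norm X" for n
  proof (induction n)
    case (Suc n)
    have "norm ((D ^^ Suc n) X) \<le> B * norm ((D ^^ n) X)" using B by simp
    also have "\<dots> \<le> B * (B ^ n * norm X)" using Suc B by simp
    finally show ?case by simp
  qed simp
  then have "norm ((1 / fact n) *\<^sub>R (D ^^ n) X) \<le> (inverse (fact n) * B ^ n) * norm X" for n
    by (simp add: divide_simps mult.commute)
  then show ?thesis
    by (intro summable_comparison_test'[OF summable_mult2[OF summable_exp[of B]], of 0 _ "norm X"]) auto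
qed

lemma exp_end_linear:
  fixes D :: "'g::euclidean_space \<Rightarrow> 'g"
  assumes D: "linear D" shows "linear (exp_end D)"
proof -
  have lin: "linear (D ^^ n)" for n
  proof (induction n)
    case 0
    show ?case by (simp add: linear_iff)
  next
    case (Suc n)
    show ?case using linear_compose[OF Suc D] by (simp add: o_def)
  qed
  have s: "summable (\<lambda>n. (1 / fact n) *\<^sub>R (D ^^ n) X)" for X
    using exp_summable[OF D] by (rule summable_norm_cancel)
  show ?thesis
    by (rule linearI)
      (simp_all add: exp_end_def linear_add[OF lin] linear_cmul[OF lin] scaleR_add_right
        suminf_add[OF s s] suminf_scaleR_right[OF s] scaleR_left_commute)
qed

lemma exp_end_in:
  fixes D :: "'g::euclidean_space \<Rightarrow> 'g"
  assumes D: "linear D" and V: "subspace V" "D ` V \<subseteq> V" "X \<in> V"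
  shows "exp_end D X \<in> V"
proof -
  have it: "(D ^^ n) X \<in> V" for n by (induction n) (use V in auto)
  have lim: "(\<lambda>n. \<Sum>k<n. (1 / fact k) *\<^sub>R (D ^^ k) X) \<longlonglongrightarrow> exp_end D X"
    unfolding exp_end_def by (rule summable_LIMSEQ[OF summable_norm_cancel[OF exp_summable[OF D]]])
  show ?thesis
    by (rule closed_sequentially[OF closed_subspace[OF V(1)] _ lim])
      (intro subspace_sum subspace_scale V it)
qed

section \<open>Exponentials of derivations as automorphisms\<close>

context real_form_lie_algebra
begin

lemma bilinear_br: "bilinear br"
  unfolding bilinear_def
  by (auto intro!: linearI simp: br_add_left br_add_right br_scaleR_left br_scaleR_right)

text \<open>The Leibniz rule with the factorials absorbed into \<open>a\<close>, which removes the
  binomial coefficients: D sends the k-th term to k + 1 times the next, and the weights k and n + 1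
  - k add up to n + 1.\<close>

lemma derivation_power_br:
  assumes D: "linear D" "D ` U \<subseteq> U" "\<And>X Y. X \<in> U \<Longrightarrow> Y \<in> U \<Longrightarrow> D (br X Y) = br (D X) Y + br X (D Y)"
    and XY: "X \<in> U" "Y \<in> U"
  defines "a \<equiv> \<lambda>n X. (1 / fact n) *\<^sub>R (D ^^ n) X"
  shows "a n (br X Y) = (\<Sum>k\<le>n. br (a k X) (a (n - k) Y))"
proof (induction n)
  case 0
  then show ?case by (simp add: a_def)
next
  case (Suc n)
  have it: "a k X \<in> U" "a k Y \<in> U" for k
  proof -
    have "(D ^^ k) X \<in> U" "(D ^^ k) Y \<in> U" by (induction k) (use D(2) XY in auto)
    then show "a k X \<in> U" "a k Y \<in> U" by (simp_all add: a_def U_closed)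
  qed
  have D_a: "D (a k Z) = real (Suc k) *\<^sub>R a (Suc k) Z" for k Z
    by (simp add: a_def linear_cmul[OF D(1)] divide_simps)
  let ?f = "\<lambda>k. br (a k X) (a (Suc n - k) Y)"
  have "real (Suc n) *\<^sub>R a (Suc n) (br X Y) = D (\<Sum>k\<le>n. br (a k X) (a (n - k) Y))"
    by (simp only: D_a[symmetric] Suc.IH)
  also have "\<dots> = (\<Sum>k\<le>n. br (D (a k X)) (a (n - k) Y)) + (\<Sum>k\<le>n. br (a k X) (D (a (n - k) Y)))"
    by (simp add: linear_sum[OF D(1)] D(3) it sum.distrib)
  also have "(\<Sum>k\<le>n. br (D (a k X)) (a (n - k) Y)) = (\<Sum>k\<le>n. real (Suc k) *\<^sub>R ?f (Suc k))"
    by (simp add: D_a br_scaleR_left)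
  \<comment> \<open>The term k = 0 has weight 0, so the shifted sum may start there. In the other
    sum the added term k = n + 1 has weight 0.\<close>
  also have "\<dots> = (\<Sum>k\<le>Suc n. real k *\<^sub>R ?f k)"
    by (subst sum.atMost_Suc_shift) simp
  also have "(\<Sum>k\<le>n. br (a k X) (D (a (n - k) Y))) = (\<Sum>k\<le>n. real (Suc n - k) *\<^sub>R ?f k)"
    by (rule sum.cong) (simp_all add: D_a br_scaleR_right Suc_diff_le)
  also have "\<dots> = (\<Sum>k\<le>Suc n. real (Suc n - k) *\<^sub>R ?f k)" by simp
  also have "(\<Sum>k\<le>Suc n. real k *\<^sub>R ?f k) + (\<Sum>k\<le>Suc n. real (Suc n - k) *\<^sub>R ?f k)
      = (\<Sum>k\<le>Suc n. real (Suc n) *\<^sub>R ?f k)"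
    unfolding sum.distrib[symmetric]
    by (rule sum.cong) (simp_all add: scaleR_add_left[symmetric] of_nat_diff del: of_nat_Suc)
  also have "\<dots> = real (Suc n) *\<^sub>R (\<Sum>k\<le>Suc n. ?f k)" by (simp only: scaleR_sum_right)
  finally show ?case by (simp del: sum.atMost_Suc of_nat_Suc)
qed

lemma exp_derivation:
  assumes J: "derivation br U J"
  defines "E \<equiv> exp_end (\<lambda>X. (pi / 2) *\<^sub>R J X)"
  shows "X \<in> U \<Longrightarrow> E X \<in> U"
    and "X \<in> U \<Longrightarrow> Y \<in> U \<Longrightarrow> E (X + Y) = E X + E Y"
    and "X \<in> U \<Longrightarrow> E (r *\<^sub>R X) = r *\<^sub>R E X"
    and "X \<in> U \<Longrightarrow> Y \<in> U \<Longrightarrow> E (br X Y) = br (E X) (E Y)"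
proof -
  \<comment> \<open>J is controlled on \<open>U\<close> only. Composing with \<open>re\<close> gives
    a map linear on the whole space whose powers agree with those of the scaled J on
    \<open>U\<close>.\<close>
  define D where "D = (\<lambda>X. (pi / 2) *\<^sub>R J (re X))"
  have DU: "D X \<in> U" for X
    using J by (auto simp: D_def derivation_def intro!: U_closed)
  have lin: "linear D"
    using J by (intro linearI) (simp_all add: D_def re_im_add re_im_scaleR derivation_def scaleR_add_right)
  have der: "D (br X Y) = br (D X) Y + br X (D Y)" if "X \<in> U" "Y \<in> U" for X Y
    using J that by (simp add: D_def derivation_def U_br br_scaleR_left br_scaleR_right scaleR_add_right)
  have EE: "E X = exp_end D X" if "X \<in> U" for X
  proof -
    have DJ: "D Y = (pi / 2) *\<^sub>R J Y" if "Y \<in> U" for Y using that by (simp add: D_def)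
    have "((\<lambda>X. (pi / 2) *\<^sub>R J X) ^^ n) X = (D ^^ n) X \<and> (D ^^ n) X \<in> U" for n
      by (induction n) (use that DU DJ[symmetric] in simp_all)
    then show ?thesis by (simp add: E_def exp_end_def)
  qed
  show "X \<in> U \<Longrightarrow> E X \<in> U"
    using exp_end_in[OF lin U_subspace] DU EE by auto
  show "X \<in> U \<Longrightarrow> Y \<in> U \<Longrightarrow> E (X + Y) = E X + E Y"
    by (simp add: EE U_closed linear_add[OF exp_end_linear[OF lin]])
  show "X \<in> U \<Longrightarrow> E (r *\<^sub>R X) = r *\<^sub>R E X"
    by (simp add: EE U_closed linear_cmul[OF exp_end_linear[OF lin]])
  show "E (br X Y) = br (E X) (E Y)" if "X \<in> U" "Y \<in> U"
  proof -
    have "E (br X Y) = (\<Sum>n. \<Sum>k\<le>n. br ((1 / fact k) *\<^sub>R (D ^^ k) X) ((1 / fact (n - k)) *\<^sub>R (D ^^ (n - k)) Y))"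
      using that DU by (simp add: EE U_br exp_end_def derivation_power_br[OF lin _ der that] image_subset_iff)
    also have "\<dots> = br (exp_end D X) (exp_end D Y)"
      unfolding exp_end_def
      by (rule sums_unique[symmetric]) (intro bilinear_Cauchy_product_sums bilinear_br exp_summable lin)
    finally show ?thesis using that by (simp add: EE)
  qed
qed

end

section \<open>Failure of the weak-J-property\<close>

context rich_graded_root_data
begin

lemma not_weak_J:
  assumes \<alpha>\<^sub>0: "\<alpha>\<^sub>0 \<in> S" shows "\<not> weak_J u0 t0 (qq (Q \<alpha>\<^sub>0))"
proof
  assume "weak_J u0 t0 (qq (Q \<alpha>\<^sub>0))"
  then obtain J where J: "derivation br u0 J" and
    E: "exp_end (\<lambda>X. (pi / 2) *\<^sub>R J X) ` t0 = t0"
      "\<And>X. X \<in> re ` qq (Q \<alpha>\<^sub>0) \<Longrightarrow> X + cs \<i> (exp_end (\<lambda>X. (pi / 2) *\<^sub>R J X) X) \<in> qq (Q \<alpha>\<^sub>0)"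
    by (auto simp: weak_J_def Let_def)
  define E where "E = exp_end (\<lambda>X. (pi / 2) *\<^sub>R J X)"
  note Ep = exp_derivation[OF J, folded E_def]
  \<comment> \<open>The complex linear extension of the exponential, of which only the restriction
    to \<open>u0\<close> is meaningful.\<close>
  define \<Upsilon> where "\<Upsilon> Z = E (re Z) + cs \<i> (E (im Z))" for Z
  have \<Upsilon>_add: "\<Upsilon> (X + Y) = \<Upsilon> X + \<Upsilon> Y" for X Y
    by (simp add: \<Upsilon>_def re_im_add Ep(2) cx.scale_right_distrib)
  have \<Upsilon>_scaleR: "\<Upsilon> (r *\<^sub>R X) = r *\<^sub>R \<Upsilon> X" for r X
    by (simp add: \<Upsilon>_def re_im_scaleR Ep(3) cs_i_scaleR scaleR_add_right)
  have E_minus: "E (- X) = - E X" if "X \<in> u0" for X using Ep(3)[OF that, of "-1"] by simp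
  have \<Upsilon>_i: "\<Upsilon> (cs \<i> X) = cs \<i> (\<Upsilon> X)" for X
    by (simp add: \<Upsilon>_def re_im_i E_minus cx.scale_right_distrib)
  have \<Upsilon>_u0: "\<Upsilon> X = E X" if "X \<in> u0" for X
    using that Ep(3)[of 0 0] U_closed(1) by (simp add: \<Upsilon>_def)
  have lin: "Vector_Spaces.linear cs cs \<Upsilon>"
  proof unfold_locales
    show "\<Upsilon> (cs c X) = cs c (\<Upsilon> X)" for c X
      by (subst (1 2) cs_eq) (simp add: \<Upsilon>_add \<Upsilon>_i \<Upsilon>_scaleR)
  qed (rule \<Upsilon>_add)
  interpret \<Upsilon>: Vector_Spaces.linear cs cs \<Upsilon> by (rule lin)
  show False
  proof (rule automorphism_contradiction[OF \<alpha>\<^sub>0 lin])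
    have half: "\<Upsilon> (br X Y) = br (\<Upsilon> X) (\<Upsilon> Y)" if "X \<in> u0" for X Y
      by (simp add: that \<Upsilon>_u0) (simp add: \<Upsilon>_def that re_im_br Ep(4) br_add_right br_scale_right)
    show "\<Upsilon> (br X Y) = br (\<Upsilon> X) (\<Upsilon> Y)" for X Y
    proof -
      have "br X Y = br (re X) Y + cs \<i> (br (im X) Y)"
        by (subst re_im[of X]) (simp add: br_add_left br_scale_left)
      then have "\<Upsilon> (br X Y) = br (\<Upsilon> (re X)) (\<Upsilon> Y) + cs \<i> (br (\<Upsilon> (im X)) (\<Upsilon> Y))"
        by (simp add: \<Upsilon>_add \<Upsilon>_i half)
      also have "\<dots> = br (\<Upsilon> (re X) + cs \<i> (\<Upsilon> (im X))) (\<Upsilon> Y)"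
        by (simp add: br_add_left br_scale_left)
      also have "\<Upsilon> (re X) + cs \<i> (\<Upsilon> (im X)) = \<Upsilon> X"
        by (metis \<Upsilon>_add \<Upsilon>_i re_im)
      finally show ?thesis .
    qed
    show "\<Upsilon> (cj X) = cj (\<Upsilon> X)" for X
      by (simp add: \<Upsilon>_def[of X] cj_eq Ep(1))
        (simp add: lie_conj_def \<Upsilon>.diff \<Upsilon>_i \<Upsilon>_u0)
    show "h \<subseteq> \<Upsilon> ` h"
    proof
      fix T assume "T \<in> h"
      then obtain A B where AB: "A \<in> t0" "B \<in> t0" "T = A + cs \<i> B" using h_form by blast
      have "A \<in> E ` t0" "B \<in> E ` t0" using AB E(1)[folded E_def] by simp_all
      then obtain A' B' where AB': "A' \<in> t0" "B' \<in> t0" "A = E A'" "B = E B'" by (elim imageE)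
      have "A' + cs \<i> B' \<in> h" using AB' h_form by blast
      moreover have "T = \<Upsilon> (A' + cs \<i> B')" using AB AB' by (simp add: \<Upsilon>_add \<Upsilon>_i \<Upsilon>_u0 t0_sub)
      ultimately show "T \<in> \<Upsilon> ` h" by blast
    qed
    show "X + cs \<i> (\<Upsilon> X) \<in> qq (Q \<alpha>\<^sub>0)" if "X \<in> re ` qq (Q \<alpha>\<^sub>0)" for X
    proof -
      have "X \<in> u0" using that by (elim imageE) simp
      then show ?thesis using E(2)[OF that, folded E_def] by (simp only: \<Upsilon>_u0)
    qed
  qed
qed

lemma Q_theorem:
  assumes "\<alpha>\<^sub>0 \<in> S" shows "maximal_in QQ_s (Q \<alpha>\<^sub>0) \<and> Q \<alpha>\<^sub>0 \<notin> QQ_\<Upsilon>"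
  using maximal_Q[OF assms] not_weak_J[OF assms] by (simp add: QQ_\<Upsilon>_def)

end

subsection \<open>Coordinates on the lattice of type E8\<close>

lemma UNIV_8: "(UNIV :: 8 set) = {1, 2, 3, 4, 5, 6, 7, 8}"
proof (rule sym, rule card_subset_eq)
  show "card {1, 2, 3, 4, 5, 6, 7, 8 :: 8} = card (UNIV :: 8 set)" by simp
qed simp_all

definition ax_sum :: "8 set \<Rightarrow> real^8" where "ax_sum M = (\<Sum>j\<in>M. ax j)"

lemma ax_nth [simp]: "ax i $ j = (if i = j then 1 else 0)"
  by (simp add: axis_def)

lemma ax_sum_nth [simp]: "ax_sum M $ i = (if i \<in> M then 1 else 0)"
  by (simp add: ax_sum_def sum.delta)

lemma beta0_nth [simp]: "beta0 $ i = 1/2"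
  by (simp add: beta0_def)

lemma spin_nth [simp]: "spin \<epsilon> $ i = \<epsilon> i / 2"
proof -
  have "(\<Sum>j\<in>UNIV. \<epsilon> j * ax j $ i) = (\<Sum>j\<in>UNIV. if i = j then \<epsilon> j else 0)"
    by (rule sum.cong) auto
  then show ?thesis by (simp add: spin_def del: ax_nth)
qed

lemma inner_ax [simp]: "x \<bullet> ax i = x $ i" "ax i \<bullet> x = x $ i"
  by (simp_all add: inner_axis inner_axis')

lemma inner_ax_sum: "x \<bullet> ax_sum M = (\<Sum>j\<in>M. x $ j)" "ax_sum M \<bullet> x = (\<Sum>j\<in>M. x $ j)"
  by (simp_all add: ax_sum_def inner_sum_right inner_sum_left)

lemma inner_beta0: "x \<bullet> beta0 = (\<Sum>j\<in>UNIV. x $ j) / 2" "beta0 \<bullet> x = (\<Sum>j\<in>UNIV. x $ j) / 2"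
  by (simp_all add: inner_vec_def sum_divide_distrib)

text \<open>Recording a spin vector by the set of its negative entries turns evenness of signs into
  evenness of a cardinality and inner products into counts of intersections.\<close>

definition half_spin :: "8 set \<Rightarrow> real^8" where "half_spin M = beta0 - ax_sum M"

lemma half_spin_nth [simp]: "half_spin M $ i = (if i \<in> M then - 1/2 else 1/2)"
  by (simp add: half_spin_def)

lemma prod_signs: "(\<Prod>j\<in>UNIV. if j \<in> M then - 1 else 1 :: real) = (- 1) ^ card (M :: 8 set)"
  by (simp add: prod.If_cases)

lemma even_signs_iff:
  "\<epsilon> \<in> even_signs \<longleftrightarrow> (\<exists>M. even (card M) \<and> \<epsilon> = (\<lambda>j. if j \<in> M then - 1 else 1))"
proof
  assume e: "\<epsilon> \<in> even_signs"
  define M where "M = {j. \<epsilon> j = - 1}"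
  have \<epsilon>: "\<epsilon> = (\<lambda>j. if j \<in> M then - 1 else 1)" using e by (intro ext) (auto simp: M_def even_signs_def)
  then have "(- 1) ^ card M = (1::real)" using e prod_signs[of M] by (simp add: even_signs_def)
  then have "even (card M)" by (metis neg_one_odd_power one_neq_neg_one)
  then show "\<exists>M. even (card M) \<and> \<epsilon> = (\<lambda>j. if j \<in> M then - 1 else 1)" using \<epsilon> by blast
next
  assume "\<exists>M. even (card M) \<and> \<epsilon> = (\<lambda>j. if j \<in> M then - 1 else 1)"
  then show "\<epsilon> \<in> even_signs" by (auto simp: even_signs_def prod_signs)
qed

lemma spin_half_spin: "spin (\<lambda>j. if j \<in> M then - 1 else 1) = half_spin M"
  by (simp add: vec_eq_iff)

lemma spins_eq: "{spin \<epsilon> | \<epsilon>. \<epsilon> \<in> even_signs \<and> P \<epsilon>} =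
    {half_spin M | M. even (card M) \<and> P (\<lambda>j. if j \<in> M then - 1 else 1)}"
  unfolding even_signs_iff spin_half_spin[symmetric] by blast

text \<open>\<open>d\<close> separates integral from half-integral vectors. In the latter case the
  halves contribute 4 to the coordinate sum, so evenness of that sum is evenness of the sum of
  \<open>a\<close>.\<close>

definition E8_lattice :: "(real^8) set" where
  "E8_lattice = {x. \<exists>a d. (d = 0 \<or> d = (1::int)) \<and> (\<forall>i. x $ i = of_int (a i) + of_int d / 2)
     \<and> even (\<Sum>i\<in>UNIV. a i)}"

lemma E8_latticeI:
  "(\<And>i. x $ i = of_int (a i) + of_int d / 2) \<Longrightarrow> d = 0 \<or> d = 1 \<Longrightarrow> even (\<Sum>i\<in>UNIV. a i) \<Longrightarrow> x \<in> E8_lattice"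
  unfolding E8_lattice_def by blast

lemma E8_lattice_diff:
  assumes "x \<in> E8_lattice" "y \<in> E8_lattice" shows "x - y \<in> E8_lattice"
proof -
  obtain a d where x: "d = 0 \<or> d = 1" "\<And>i. x $ i = of_int (a i) + of_int d / 2" "even (\<Sum>i\<in>UNIV. a i)"
    using assms(1) unfolding E8_lattice_def by blast
  obtain c e where y: "e = 0 \<or> e = 1" "\<And>i. y $ i = of_int (c i) + of_int e / 2" "even (\<Sum>i\<in>UNIV. c i)"
    using assms(2) unfolding E8_lattice_def by blast
  show ?thesis
  proof (cases "d = 0 \<and> e = 1")
    \<comment> \<open>An integral minus a half-integral vector: -1/2 is written as -1 + 1/2, and
      lowering all eight entries of \<open>a\<close> by 1 keeps the parity.\<close>
    case True
    then show ?thesis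
      using x y by (intro E8_latticeI[of _ "\<lambda>i. a i - c i - 1" 1]) (auto simp: sum_subtractf sum.distrib field_simps)
  next
    case False
    then show ?thesis
      using x y by (intro E8_latticeI[of _ "\<lambda>i. a i - c i" "d - e"]) (auto simp: sum_subtractf field_simps)
  qed
qed

lemma E8_lattice_zero: "0 \<in> E8_lattice"
  by (rule E8_latticeI[of _ "\<lambda>_. 0" 0]) auto

text \<open>The terms linear in \<open>d\<close> or \<open>e\<close> are halves of even sums, and
  the eight products of halves add up to 2de.\<close>

lemma E8_lattice_inner:
  assumes "x \<in> E8_lattice" "y \<in> E8_lattice" shows "x \<bullet> y \<in> \<int>"
proof -
  obtain a d where x: "d = 0 \<or> d = 1" "\<And>i. x $ i = of_int (a i) + of_int d / 2" "even (\<Sum>i\<in>UNIV. a i)"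
    using assms(1) unfolding E8_lattice_def by blast
  obtain c e where y: "e = 0 \<or> e = 1" "\<And>i. y $ i = of_int (c i) + of_int e / 2" "even (\<Sum>i\<in>UNIV. c i)"
    using assms(2) unfolding E8_lattice_def by blast
  obtain k l where kl: "(\<Sum>i\<in>UNIV. a i) = 2 * k" "(\<Sum>i\<in>UNIV. c i) = 2 * l" using x(3) y(3) by (auto elim!: evenE)
  have "x \<bullet> y = (\<Sum>i\<in>UNIV. of_int (a i * c i) + of_int (a i) * (of_int e / 2)
      + of_int (c i) * (of_int d / 2) + of_int (d * e) / 4)"
    unfolding inner_vec_def by (rule sum.cong) (simp_all add: x(2) y(2) field_simps)
  also have "\<dots> = of_int (\<Sum>i\<in>UNIV. a i * c i) + of_int (\<Sum>i\<in>UNIV. a i) * (of_int e / 2)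
      + of_int (\<Sum>i\<in>UNIV. c i) * (of_int d / 2) + 2 * of_int (d * e)"
    by (simp add: sum.distrib sum_distrib_right sum_divide_distrib)
  also have "\<dots> = of_int ((\<Sum>i\<in>UNIV. a i * c i) + k * e + l * d + 2 * (d * e))"
    by (simp add: kl)
  finally show ?thesis by (simp only: Ints_of_int)
qed

lemma ax_E8_lattice:
  assumes "s = 1 \<or> s = - 1" "t = 1 \<or> t = - (1::real)"
  shows "s *\<^sub>R ax i + t *\<^sub>R ax j \<in> E8_lattice"
proof -
  obtain s' t' :: int where st: "s = of_int s'" "t = of_int t'" "s' = 1 \<or> s' = - 1" "t' = 1 \<or> t' = - 1"
    using assms by (metis of_int_1 of_int_minus)
  have "(\<Sum>k\<in>UNIV. (if i = k then s' else 0) + (if j = k then t' else 0)) = s' + t'"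
    by (simp add: sum.distrib)
  moreover have "even (s' + t')" using st by auto
  ultimately show ?thesis using st
    by (intro E8_latticeI[of _ "\<lambda>k. (if i = k then s' else 0) + (if j = k then t' else 0)" 0]) auto
qed

lemma half_spin_E8_lattice: "even (card M) \<Longrightarrow> half_spin M \<in> E8_lattice"
proof (rule E8_latticeI[of _ "\<lambda>k. if k \<in> M then - 1 else 0" 1])
  assume "even (card M)"
  moreover have "(\<Sum>k\<in>UNIV. if k \<in> M then - 1 else 0) = - int (card M)"
    by (simp add: sum.If_cases)
  ultimately show "even (\<Sum>k\<in>UNIV. if k \<in> M then - 1 else (0::int))" by simp
qed auto

lemma half_spin_norm: "half_spin M \<bullet> half_spin M = 2"
proof -
  have "half_spin M \<bullet> half_spin M = (\<Sum>i\<in>(UNIV::8 set). 1/4)"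
    unfolding inner_vec_def by (rule sum.cong) auto
  then show ?thesis by simp
qed

lemma D_rootsI: "s = 1 \<or> s = -1 \<Longrightarrow> t = 1 \<or> t = -1 \<Longrightarrow> i \<in> I \<Longrightarrow> j \<in> I \<Longrightarrow> i \<noteq> j \<Longrightarrow>
    s *\<^sub>R ax i + t *\<^sub>R ax j \<in> D_roots I"
  unfolding D_roots_def by blast

text \<open>Integral case: the squares add up to 2, so exactly two entries are \<plusminus>1.
  Half-integral case: each square is 1/4 + a(a + 1), the quarters already give 2, so every a is 0 or
  -1.\<close>

lemma E8_lattice_norm2:
  assumes "x \<in> E8_lattice" "x \<bullet> x = 2"
  shows "x \<in> D_roots UNIV \<or> (\<exists>M. even (card M) \<and> x = half_spin M)"
proof -
  obtain a d where x: "d = 0 \<or> d = 1" "\<And>i. x $ i = of_int (a i) + of_int d / 2" "even (\<Sum>i\<in>UNIV. a i)"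
    using assms(1) unfolding E8_lattice_def by blast
  have sq: "(\<Sum>i\<in>UNIV. (x $ i) ^ 2) = 2"
    using assms(2) by (simp add: inner_vec_def power2_eq_square)
  from x(1) show ?thesis
  proof
    assume d: "d = 0"
    then have "of_int (\<Sum>i\<in>UNIV. (a i) ^ 2) = (2::real)" using sq x(2) by simp
    then have s: "(\<Sum>i\<in>UNIV. (a i) ^ 2) = 2" by linarith
    define N where "N = {i. a i \<noteq> 0}"
    have one: "(a i) ^ 2 = 1" if "i \<in> N" for i
    proof -
      have "(a i) ^ 2 \<le> 2" using member_le_sum[of i UNIV "\<lambda>i. (a i) ^ 2"] s by simp
      moreover have "\<bar>a i\<bar> \<ge> 1" using that by (simp add: N_def)
      moreover have "\<not> \<bar>a i\<bar> \<ge> 2"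
      proof
        assume "\<bar>a i\<bar> \<ge> 2"
        then have "2 ^ 2 \<le> \<bar>a i\<bar> ^ 2" by (intro power_mono) auto
        then show False using calculation by simp
      qed
      ultimately have "\<bar>a i\<bar> = 1" by linarith
      then show ?thesis by (metis one_power2 power2_abs)
    qed
    have "(\<Sum>i\<in>UNIV. (a i) ^ 2) = (\<Sum>i\<in>N. (a i) ^ 2)"
      by (rule sum.mono_neutral_right) (auto simp: N_def)
    also have "\<dots> = int (card N)" using one by simp
    finally have "card N = 2" using s by simp
    then obtain i j where ij: "N = {i, j}" "i \<noteq> j" by (meson card_2_iff)
    have pm: "a k = 1 \<or> a k = - 1" if "k \<in> N" for k using one[OF that] by (simp add: power2_eq_1_iff)
    have "a k = 0" if "k \<noteq> i" "k \<noteq> j" for k using ij(1) that unfolding N_def by blast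
    then have "x = of_int (a i) *\<^sub>R ax i + of_int (a j) *\<^sub>R ax j"
      using ij(2) x(2) d by (auto simp: vec_eq_iff)
    moreover have "of_int (a i) = (1::real) \<or> of_int (a i) = (-1::real)"
      "of_int (a j) = (1::real) \<or> of_int (a j) = (-1::real)" using pm[of i] pm[of j] ij(1) by auto
    ultimately have "x \<in> D_roots UNIV" using D_rootsI[OF _ _ UNIV_I UNIV_I ij(2)] by blast
    then show ?thesis ..
  next
    assume d: "d = 1"
    have "x $ i = of_int (a i) + 1/2" for i using d x(2) by simp
    then have "(x $ i) ^ 2 - 1/4 = of_int (a i * (a i + 1))" for i
      by (simp add: power2_eq_square algebra_simps)
    then have "of_int (\<Sum>i\<in>UNIV. a i * (a i + 1)) = (\<Sum>i\<in>UNIV. (x $ i) ^ 2 - 1/4)" by simp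
    also have "\<dots> = 0" using sq by (simp add: sum_subtractf)
    finally have s: "(\<Sum>i\<in>UNIV. a i * (a i + 1)) = 0" by (simp only: of_int_eq_0_iff)
    have "a i * (a i + 1) \<ge> 0" for i
      by (cases "a i \<ge> 0") (auto simp: zero_le_mult_iff)
    then have "a i * (a i + 1) = 0" for i
      using s sum_nonneg_eq_0_iff[of UNIV "\<lambda>i. a i * (a i + 1)"] by simp
    then have a: "a i = 0 \<or> a i = - 1" for i by (metis add_eq_0_iff2 mult_eq_0_iff)
    define M where "M = {i. a i = - 1}"
    have "x = half_spin M" using a x(2) d by (auto simp: vec_eq_iff M_def)
    moreover have "(\<Sum>i\<in>UNIV. a i) = (\<Sum>i\<in>UNIV. if i \<in> M then - 1 else 0)"
      using a by (intro sum.cong) (auto simp: M_def)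
    then have "even (card M)" using x(3) by (simp add: sum.If_cases)
    ultimately show ?thesis by blast
  qed
qed

lemma D_rootsE:
  assumes "x \<in> D_roots I"
  obtains s t i j where "s = 1 \<or> s = -1" "t = 1 \<or> t = -1" "i \<in> I" "j \<in> I" "i \<noteq> j" "x = s *\<^sub>R ax i + t *\<^sub>R ax j"
  using assms unfolding D_roots_def by blast

lemma D_roots_lattice: "x \<in> D_roots I \<Longrightarrow> x \<in> E8_lattice \<and> x \<bullet> x = 2"
  by (elim D_rootsE) (auto simp: ax_E8_lattice inner_add_left inner_add_right)

lemma E8_roots_eq: "E8_roots = {x \<in> E8_lattice. x \<bullet> x = 2}"
proof -
  have "E8_roots = D_roots UNIV \<union> {half_spin M | M. even (card M)}"
    using spins_eq[of "\<lambda>_. True"] by (simp add: E8_roots_def UNIV_8)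
  then show ?thesis
    using E8_lattice_norm2 D_roots_lattice half_spin_E8_lattice half_spin_norm by blast
qed

lemma index_6: "i \<in> {1, 2, 3, 4, 5, 6} \<longleftrightarrow> i \<noteq> 7 \<and> i \<noteq> (8::8)"
  and index_5: "i \<in> {1, 2, 3, 4, 5} \<longleftrightarrow> i \<noteq> 6 \<and> i \<noteq> 7 \<and> i \<noteq> (8::8)"
proof -
  have "i \<in> {1, 2, 3, 4, 5, 6, 7, 8}" using UNIV_8 by blast
  then show "i \<in> {1, 2, 3, 4, 5, 6} \<longleftrightarrow> i \<noteq> 7 \<and> i \<noteq> (8::8)"
    "i \<in> {1, 2, 3, 4, 5} \<longleftrightarrow> i \<noteq> 6 \<and> i \<noteq> 7 \<and> i \<noteq> (8::8)" by auto
qed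

lemma E7_roots_iff: "\<alpha> \<in> E7_roots \<longleftrightarrow> \<alpha> \<in> D_roots {1,2,3,4,5,6} \<or> \<alpha> = ax 7 - ax 8 \<or> \<alpha> = ax 8 - ax 7
    \<or> (\<exists>M. even (card M) \<and> \<alpha> = half_spin M \<and> (7 \<in> M \<longleftrightarrow> 8 \<notin> M))"
  unfolding E7_roots_def spins_eq by (auto split: if_splits)

lemma E6_roots_iff: "\<alpha> \<in> E6_roots \<longleftrightarrow> \<alpha> \<in> D_roots {1,2,3,4,5}
    \<or> (\<exists>M. even (card M) \<and> \<alpha> = half_spin M \<and> (6 \<in> M \<longleftrightarrow> 7 \<in> M) \<and> (7 \<in> M \<longleftrightarrow> 8 \<notin> M))"
  unfolding E6_roots_def spins_eq by (auto split: if_splits)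

lemma E7_cases:
  assumes "\<alpha> \<in> E7_roots"
  obtains "\<alpha> \<in> D_roots {1,2,3,4,5,6}" | "\<alpha> = ax 7 - ax 8" | "\<alpha> = ax 8 - ax 7"
    | M where "even (card M)" "\<alpha> = half_spin M" "7 \<in> M \<longleftrightarrow> 8 \<notin> M"
  using assms unfolding E7_roots_iff by blast

lemma E6_cases:
  assumes "\<alpha> \<in> E6_roots"
  obtains "\<alpha> \<in> D_roots {1,2,3,4,5}"
    | M where "even (card M)" "\<alpha> = half_spin M" "6 \<in> M \<longleftrightarrow> 7 \<in> M" "7 \<in> M \<longleftrightarrow> 8 \<notin> M"
  using assms unfolding E6_roots_iff by blast

lemma E7_roots_eq: "E7_roots = {x \<in> E8_lattice. x \<bullet> x = 2 \<and> x $ 7 + x $ 8 = 0}"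
proof (intro equalityI subsetI)
  fix x assume "x \<in> E7_roots"
  then show "x \<in> {x \<in> E8_lattice. x \<bullet> x = 2 \<and> x $ 7 + x $ 8 = 0}"
  proof (cases rule: E7_cases)
    case 1
    then have "x $ 7 + x $ 8 = 0" by (elim D_rootsE, unfold index_6) simp
    then show ?thesis using D_roots_lattice[OF 1] by blast
  next
    case (4 M)
    then show ?thesis using half_spin_E8_lattice[of M] half_spin_norm[of M] by auto
  qed (use ax_E8_lattice[of 1 "-1" 7 8] ax_E8_lattice[of 1 "-1" 8 7] in \<open>simp_all add: inner_diff\<close>)
next
  fix x assume "x \<in> {x \<in> E8_lattice. x \<bullet> x = 2 \<and> x $ 7 + x $ 8 = 0}"
  then have x: "x \<in> E8_lattice" "x \<bullet> x = 2" "x $ 7 + x $ 8 = 0" by blast+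
  from E8_lattice_norm2[OF x(1,2)] show "x \<in> E7_roots"
  proof
    assume "x \<in> D_roots UNIV"
    then obtain s t i j where st: "s = 1 \<or> s = -1" "t = 1 \<or> t = -1" "i \<noteq> j" "x = s *\<^sub>R ax i + t *\<^sub>R ax j"
      by (elim D_rootsE)
    show ?thesis
    proof (cases "i \<in> {1,2,3,4,5,6} \<and> j \<in> {1,2,3,4,5,6}")
      case True
      then have "x \<in> D_roots {1,2,3,4,5,6}" using st(1-3) unfolding st(4) by (intro D_rootsI) simp_all
      then show ?thesis unfolding E7_roots_iff by blast
    next
      case False
      \<comment> \<open>A nonzero entry at 7 or 8 must be cancelled by the entry at the other of
        these two places.\<close>
      then have "{i, j} = {7, 8} \<and> s = - t" using x(3) st unfolding index_6 by (auto split: if_splits)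
      then show ?thesis using st unfolding E7_roots_iff by (auto simp: doubleton_eq_iff)
    qed
  next
    assume "\<exists>M. even (card M) \<and> x = half_spin M"
    then obtain M where "even (card M)" "x = half_spin M" by blast
    moreover from this have "7 \<in> M \<longleftrightarrow> 8 \<notin> M" using x(3) by (auto split: if_splits)
    ultimately show ?thesis unfolding E7_roots_iff by blast
  qed
qed

lemma E6_roots_eq: "E6_roots = {x \<in> E8_lattice. x \<bullet> x = 2 \<and> x $ 6 = x $ 7 \<and> x $ 7 = - x $ 8}"
proof (intro equalityI subsetI)
  fix x assume "x \<in> E6_roots"
  then show "x \<in> {x \<in> E8_lattice. x \<bullet> x = 2 \<and> x $ 6 = x $ 7 \<and> x $ 7 = - x $ 8}"
  proof (cases rule: E6_cases)
    case 1
    then have "x $ 6 = x $ 7 \<and> x $ 7 = - x $ 8" by (elim D_rootsE, unfold index_5) simp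
    then show ?thesis using D_roots_lattice[OF 1] by blast
  next
    case (2 M)
    then show ?thesis using half_spin_E8_lattice[of M] half_spin_norm[of M] by auto
  qed
next
  fix x assume "x \<in> {x \<in> E8_lattice. x \<bullet> x = 2 \<and> x $ 6 = x $ 7 \<and> x $ 7 = - x $ 8}"
  then have x: "x \<in> E8_lattice" "x \<bullet> x = 2" "x $ 6 = x $ 7" "x $ 7 = - x $ 8" by blast+
  from E8_lattice_norm2[OF x(1,2)] show "x \<in> E6_roots"
  proof
    assume "x \<in> D_roots UNIV"
    then obtain s t i j where st: "s = 1 \<or> s = -1" "t = 1 \<or> t = -1" "i \<noteq> j" "x = s *\<^sub>R ax i + t *\<^sub>R ax j"
      by (elim D_rootsE)
    \<comment> \<open>The entries at 6, 7, 8 have equal absolute value, and only two entries of x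
      are nonzero; so those three vanish.\<close>
    then have "i \<in> {1,2,3,4,5} \<and> j \<in> {1,2,3,4,5}"
      using x(3,4) unfolding index_5 by (auto split: if_splits)
    then have "x \<in> D_roots {1,2,3,4,5}" using st(1-3) unfolding st(4) by (intro D_rootsI) simp_all
    then show ?thesis unfolding E6_roots_iff by blast
  next
    assume "\<exists>M. even (card M) \<and> x = half_spin M"
    then obtain M where "even (card M)" "x = half_spin M" by blast
    moreover from this have "6 \<in> M \<longleftrightarrow> 7 \<in> M" "7 \<in> M \<longleftrightarrow> 8 \<notin> M" using x(3,4) by (auto split: if_splits)
    ultimately show ?thesis unfolding E6_roots_iff by blast
  qed
qed

text \<open>Describing E6 and E7 as the vectors of norm 2 in a sublattice gives closure at once: a
  difference of two such vectors with product 1 again has norm 2.\<close>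

lemma simply_laced_sublattice:
  assumes "P 0" "\<And>x y. P x \<Longrightarrow> P y \<Longrightarrow> P (x - y)"
  shows "simply_laced {x \<in> E8_lattice. x \<bullet> x = 2 \<and> P x}"
proof
  fix x y assume xy: "x \<in> {x \<in> E8_lattice. x \<bullet> x = 2 \<and> P x}" "y \<in> {x \<in> E8_lattice. x \<bullet> x = 2 \<and> P x}"
  then show "x \<bullet> y \<in> \<int>" using E8_lattice_inner by blast
  assume "x \<bullet> y = 1"
  then have "(x - y) \<bullet> (x - y) = 2" using xy by (simp add: inner_diff inner_commute)
  then show "x - y \<in> {x \<in> E8_lattice. x \<bullet> x = 2 \<and> P x}" using xy E8_lattice_diff assms by blast
next
  fix x assume x: "x \<in> {x \<in> E8_lattice. x \<bullet> x = 2 \<and> P x}"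
  then show "x \<bullet> x = 2" by blast
  show "- x \<in> {x \<in> E8_lattice. x \<bullet> x = 2 \<and> P x}"
    using x E8_lattice_diff[OF E8_lattice_zero, of x] assms(2)[OF assms(1), of x] by simp
qed

lemma simply_laced_E6: "simply_laced E6_roots" and simply_laced_E7: "simply_laced E7_roots"
  and simply_laced_E8: "simply_laced E8_roots"
  unfolding E6_roots_eq E7_roots_eq
  using simply_laced_sublattice[of "\<lambda>_. True"]
  by (auto simp: E8_roots_eq intro!: simply_laced_sublattice)

subsection \<open>The five gradations\<close>

lemma rich_graded_root_systemI:
  fixes R :: "'v::real_inner set"
  assumes "simply_laced R" "\<forall>\<alpha>\<in>R. \<alpha> \<bullet> b \<in> \<int>"
    and S: "S' = {\<alpha> \<in> R. odd \<lfloor>\<alpha> \<bullet> b\<rfloor>}"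
    and "\<forall>x\<in>S'. \<forall>y\<in>S'. y \<bullet> x = 0 \<longrightarrow> (\<exists>z\<in>S'. z \<bullet> x = 1 \<and> z \<bullet> y = -1)"
    and "\<forall>x\<in>S'. \<exists>y\<in>S'. y \<bullet> x = 0"
    and "\<forall>\<gamma>\<in>R. \<exists>x\<in>S'. x \<bullet> \<gamma> \<noteq> 0"
  shows "rich_graded_root_system R b \<and> graded_root_system.S R b = S'"
proof -
  interpret graded_root_system R b
    using assms(1,2) by (simp add: graded_root_system_def graded_root_system_axioms_def)
  have eq: "S = S'" by (simp add: S S_def par_def)
  have "rich_graded_root_system R b"
    by (unfold_locales, unfold eq) (use assms(4) in blast, use assms(5) in blast, use assms(6) in blast)
  then show ?thesis using eq by blast
qed

lemma floor_minus_1 [simp]: "\<lfloor>- 1 :: real\<rfloor> = - 1"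
  by (rule floor_unique) auto

lemma exists_outside:
  assumes "card A < card I" "finite A" shows "\<exists>m\<in>I. m \<notin> A"
  using assms by (meson card_mono not_less subsetI)

lemma card_doubleton_le: "card {i, j} \<le> 2" "card {i, j, k} \<le> 3" "card {i, j, k, l} \<le> 4"
  by (simp_all add: card_insert_if)

subsubsection \<open>Spin representations\<close>

definition flip :: "(8 \<Rightarrow> real) \<Rightarrow> 8 set \<Rightarrow> 8 \<Rightarrow> real" where
  "flip \<epsilon> A = (\<lambda>k. if k \<in> A then - \<epsilon> k else \<epsilon> k)"

lemma flip_even_signs:
  assumes "\<epsilon> \<in> even_signs" "even (card A)" shows "flip \<epsilon> A \<in> even_signs"
proof -
  have "(\<Prod>k\<in>UNIV. flip \<epsilon> A k) = (\<Prod>k\<in>UNIV. (if k \<in> A then - 1 else 1) * \<epsilon> k)"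
    by (rule prod.cong) (auto simp: flip_def)
  also have "\<dots> = 1" using assms by (simp add: prod.distrib prod_signs even_signs_def)
  finally show ?thesis using assms(1) by (auto simp: even_signs_def flip_def)
qed

lemma inner_spin_flip: "v \<bullet> spin (flip \<epsilon> A) = v \<bullet> spin \<epsilon> - (\<Sum>k\<in>A. \<epsilon> k * v $ k)"
proof -
  have "v \<bullet> spin (flip \<epsilon> A) = (\<Sum>k\<in>UNIV. v $ k * (\<epsilon> k / 2) - (if k \<in> A then \<epsilon> k * v $ k else 0))"
    unfolding inner_vec_def by (rule sum.cong) (auto simp: flip_def)
  then show ?thesis by (simp add: sum_subtractf inner_vec_def sum.If_cases)
qed

lemma signs_square: "\<epsilon> \<in> even_signs \<Longrightarrow> \<epsilon> k * \<epsilon> k = 1"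
  by (auto simp: even_signs_def) (metis mult_minus_left mult_minus_right mult_1 minus_minus)

lemma spin_inner_spin: "spin \<epsilon> \<bullet> spin \<delta> = (\<Sum>k\<in>UNIV. \<epsilon> k * \<delta> k) / 4"
  by (simp add: inner_vec_def sum_divide_distrib)

text \<open>The eight signs add up to 0 and those at 7 and 8 contribute at most 2, so the other six
  add up to at least -2 and two of them are +1. Indices 7 and 8 are avoided because in type E7 their
  signs are tied to each other.\<close>

lemma two_agreements:
  assumes e: "\<epsilon> \<in> even_signs" "\<delta> \<in> even_signs" and 0: "spin \<epsilon> \<bullet> spin \<delta> = 0"
  shows "\<exists>i\<in>{1,2,3,4,5,6}. \<exists>j\<in>{1,2,3,4,5,6}. i \<noteq> j \<and> \<epsilon> i * \<delta> i = 1 \<and> \<epsilon> j * \<delta> j = 1"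
proof -
  let ?I = "{1,2,3,4,5,6 :: 8}"
  define A where "A = {i \<in> ?I. \<epsilon> i * \<delta> i = 1}"
  have pm: "\<epsilon> i * \<delta> i = 1 \<or> \<epsilon> i * \<delta> i = - 1" for i
    using e by (auto simp: even_signs_def) (metis mult_1 mult_minus1 minus_minus)+
  have UN: "UNIV = insert 7 (insert 8 ?I)" unfolding UNIV_8 by auto
  have "(\<Sum>k\<in>UNIV. \<epsilon> k * \<delta> k) = \<epsilon> 7 * \<delta> 7 + (\<epsilon> 8 * \<delta> 8 + (\<Sum>k\<in>?I. \<epsilon> k * \<delta> k))"
    unfolding UN by (subst sum.insert; simp)+
  then have "(\<Sum>k\<in>?I. \<epsilon> k * \<delta> k) \<ge> - 2" using 0 pm[of 7] pm[of 8] by (auto simp: spin_inner_spin)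
  moreover have "(\<Sum>k\<in>?I. \<epsilon> k * \<delta> k) = (\<Sum>k\<in>?I. if k \<in> A then 1 else - 1)"
    by (rule sum.cong) (use pm in \<open>auto simp: A_def\<close>)
  moreover have "\<dots> = real (card A) - real (card (?I - A))"
  proof -
    have "?I \<inter> A = A" "?I \<inter> - A = ?I - A" by (auto simp: A_def)
    then show ?thesis by (simp add: sum.If_cases)
  qed
  moreover have AI: "A \<subseteq> ?I" by (auto simp: A_def)
  have "card (?I - A) = 6 - card A" "card A \<le> 6"
    using card_Diff_subset[OF _ AI] card_mono[OF _ AI] finite_subset[OF AI] by simp_all
  ultimately have "\<not> card A \<le> Suc 0" by (auto simp: of_nat_diff)
  then have "\<not> (\<forall>i\<in>A. \<forall>j\<in>A. i = j)"
    using card_le_Suc0_iff_eq[OF finite_subset[OF AI]] by simp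
  then obtain i j where ij: "i \<in> A" "j \<in> A" "i \<noteq> j" by blast
  have k: "k \<in> ?I" "\<epsilon> k * \<delta> k = 1" if "k \<in> A" for k using that by (simp_all add: A_def)
  show ?thesis
    by (rule bexI[OF bexI[OF _ k(1)[OF ij(2)]] k(1)[OF ij(1)]]) (intro conjI ij k)
qed

text \<open>\<open>J\<close> collects the places where signs may be changed freely: the first six
  for E7, all for E8. Flipping two signs lowers the product with x from 2 to 1, flipping four lowers
  it to 0; two flips at agreements with y lower the product with y from 0 to -1.\<close>

lemma spin_system:
  assumes S: "S' = {spin \<epsilon> | \<epsilon>. \<epsilon> \<in> even_signs \<and> W \<epsilon>}"
    and W: "\<forall>\<epsilon> A. A \<subseteq> J \<longrightarrow> W \<epsilon> \<longrightarrow> W (flip \<epsilon> A)" and J: "{1,2,3,4,5,6} \<subseteq> J"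
  shows "\<forall>x\<in>S'. \<forall>y\<in>S'. y \<bullet> x = 0 \<longrightarrow> (\<exists>z\<in>S'. z \<bullet> x = 1 \<and> z \<bullet> y = -1)"
    and "\<forall>x\<in>S'. \<exists>y\<in>S'. y \<bullet> x = 0"
    and "s \<in> S' \<Longrightarrow> \<forall>x\<in>S'. x \<bullet> \<gamma> = 0 \<Longrightarrow> i \<in> J \<Longrightarrow> \<gamma> $ i = 0"
proof -
  have flip: "spin (flip \<epsilon> A) \<in> S'" if "\<epsilon> \<in> even_signs" "W \<epsilon>" "A \<subseteq> J" "even (card A)" for \<epsilon> A
    unfolding S using W that flip_even_signs by blast
  have norm: "spin \<epsilon> \<bullet> spin \<epsilon> = 2" if "\<epsilon> \<in> even_signs" for \<epsilon>
    using signs_square[OF that] by (simp add: spin_inner_spin)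
  show "\<forall>x\<in>S'. \<forall>y\<in>S'. y \<bullet> x = 0 \<longrightarrow> (\<exists>z\<in>S'. z \<bullet> x = 1 \<and> z \<bullet> y = -1)"
  proof (intro ballI impI)
    fix x y assume xy: "x \<in> S'" "y \<in> S'" "y \<bullet> x = 0"
    obtain \<epsilon> \<delta> where e: "\<epsilon> \<in> even_signs" "W \<epsilon>" "x = spin \<epsilon>" "\<delta> \<in> even_signs" "y = spin \<delta>"
      using xy(1,2) unfolding S by blast
    obtain i j where ij: "i \<in> J" "j \<in> J" "i \<noteq> j" "\<epsilon> i * \<delta> i = 1" "\<epsilon> j * \<delta> j = 1"
      using two_agreements[of \<epsilon> \<delta>] e xy(3) J by (auto simp: inner_commute)
    have "spin (flip \<epsilon> {i, j}) \<in> S'" by (rule flip) (use e ij in auto)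
    moreover have "x \<bullet> spin (flip \<epsilon> {i, j}) = 1"
      using ij(3) e signs_square[OF e(1)] norm by (simp add: inner_spin_flip)
    moreover have "y \<bullet> spin (flip \<epsilon> {i, j}) = - 1"
      using ij e xy(3) by (simp add: inner_spin_flip)
    ultimately have "spin (flip \<epsilon> {i, j}) \<in> S' \<and> spin (flip \<epsilon> {i, j}) \<bullet> x = 1 \<and> spin (flip \<epsilon> {i, j}) \<bullet> y = - 1"
      by (simp add: inner_commute)
    then show "\<exists>z\<in>S'. z \<bullet> x = 1 \<and> z \<bullet> y = -1" by blast
  qed
  show "\<forall>x\<in>S'. \<exists>y\<in>S'. y \<bullet> x = 0"
  proof
    fix x assume x: "x \<in> S'"
    obtain \<epsilon> where e: "\<epsilon> \<in> even_signs" "W \<epsilon>" "x = spin \<epsilon>" using x unfolding S by blast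
    have "spin (flip \<epsilon> {1, 2, 3, 4}) \<in> S'" by (rule flip) (use e J in auto)
    moreover have "x \<bullet> spin (flip \<epsilon> {1, 2, 3, 4}) = 0"
      using e signs_square[OF e(1)] norm by (simp add: inner_spin_flip)
    ultimately show "\<exists>y\<in>S'. y \<bullet> x = 0" by (metis inner_commute)
  qed
  show "\<gamma> $ i = 0" if s: "s \<in> S'" and 0: "\<forall>x\<in>S'. x \<bullet> \<gamma> = 0" and i: "i \<in> J"
  proof -
    obtain \<epsilon> where e: "\<epsilon> \<in> even_signs" "W \<epsilon>" "s = spin \<epsilon>" using s unfolding S by blast
    have pair: "\<epsilon> k * \<gamma> $ k + \<epsilon> l * \<gamma> $ l = 0" if "k \<in> J" "l \<in> J" "k \<noteq> l" for k l
    proof -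
      have "spin (flip \<epsilon> {k, l}) \<in> S'" by (rule flip) (use e that in auto)
      then have "\<gamma> \<bullet> spin (flip \<epsilon> {k, l}) = 0" "\<gamma> \<bullet> spin \<epsilon> = 0"
        using bspec[OF 0] s e(3) by (metis inner_commute)+
      then show ?thesis using that(3) by (simp add: inner_spin_flip)
    qed
    define I where "I = {1,2,3,4,5,6 :: 8}"
    have I: "card I = 6" "I \<subseteq> J" using J by (simp_all add: I_def)
    have "\<exists>k\<in>I. k \<notin> {i}" by (rule exists_outside) (simp_all add: I)
    then obtain k where k: "k \<in> J" "k \<noteq> i" using I(2) by blast
    have "\<exists>l\<in>I. l \<notin> {i, k}"
      by (rule exists_outside) (use card_doubleton_le(1)[of i k] in \<open>simp_all add: I\<close>)
    then obtain l where l: "l \<in> J" "l \<noteq> i" "l \<noteq> k" using I(2) by blast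
    \<comment> \<open>Three numbers whose pairwise sums vanish are all 0.\<close>
    have "\<epsilon> i * \<gamma> $ i = 0"
      using pair[OF i k(1) k(2)[symmetric]] pair[OF i l(1) l(2)[symmetric]]
        pair[OF k(1) l(1) l(3)[symmetric]] by linarith
    then show ?thesis using signs_square[OF e(1), of i] by auto
  qed
qed

lemma signs_pm: "\<epsilon> \<in> even_signs \<Longrightarrow> \<epsilon> j = 1 \<or> \<epsilon> j = -1"
  by (auto simp: even_signs_def)

text \<open>A sample member: opposite signs at 7 and 8, with the minus sign at 1 making their number
  even.\<close>

lemma ones_S71: "spin (\<lambda>j. if j \<in> {1, 8} then - 1 else 1) \<in> S71"
proof -
  have "(\<lambda>j. if j \<in> {1, 8} then - 1 else 1) \<in> even_signs" unfolding even_signs_iff by (intro exI[of _ "{1, 8}"]) simp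
  then show ?thesis unfolding S71_def by (intro CollectI exI[of _ "\<lambda>j. if j \<in> {1, 8} then - 1 else 1"]) simp
qed

text \<open>The vector is a root of E7; its products are \<plusminus>1 on the spin roots and 0 or
  \<plusminus>2 on the others.\<close>

lemma S71_system: "rich_graded_root_system E7_roots (ax 7 - ax 8) \<and> graded_root_system.S E7_roots (ax 7 - ax 8) = S71"
proof -
  have eq: "S71 = {\<alpha> \<in> E7_roots. odd \<lfloor>\<alpha> \<bullet> (ax 7 - ax 8)\<rfloor>}"
  proof -
    have "\<not> odd \<lfloor>\<alpha> \<bullet> (ax 7 - ax 8)\<rfloor>" if "\<alpha> \<in> D_roots {1, 2, 3, 4, 5, 6}" for \<alpha>
      using that by (elim D_rootsE, unfold index_6) (simp add: inner_diff_right)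
    moreover have "\<not> odd \<lfloor>\<alpha> \<bullet> (ax 7 - ax 8)\<rfloor>" if "\<alpha> \<in> {ax 7 - ax 8, ax 8 - ax 7}" for \<alpha>
      using that by (auto simp: inner_diff_right)
    moreover have "odd \<lfloor>\<alpha> \<bullet> (ax 7 - ax 8)\<rfloor>" if "\<alpha> \<in> S71" for \<alpha>
    proof -
      obtain \<epsilon> where e: "\<epsilon> \<in> even_signs" "\<epsilon> 7 + \<epsilon> 8 = 0" "\<alpha> = spin \<epsilon>" using \<open>\<alpha> \<in> S71\<close> by (auto simp: S71_def)
      then have "\<alpha> \<bullet> (ax 7 - ax 8) = \<epsilon> 7" by (simp add: inner_diff_right)
      then show ?thesis using signs_pm[OF e(1), of 7] by auto
    qed
    moreover have "E7_roots = D_roots {1, 2, 3, 4, 5, 6} \<union> {ax 7 - ax 8, ax 8 - ax 7} \<union> S71"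
      by (simp add: E7_roots_def S71_def)
    ultimately show ?thesis by blast
  qed
  have int: "\<alpha> \<bullet> (ax 7 - ax 8) \<in> \<int>" if "\<alpha> \<in> E7_roots" for \<alpha>
    using that simply_laced.R_int[OF simply_laced_E7 that, of "ax 7 - ax 8"] by (simp add: E7_roots_def)
  have W: "\<forall>\<epsilon> A. A \<subseteq> {1,2,3,4,5,6} \<longrightarrow> \<epsilon> 7 + \<epsilon> 8 = 0 \<longrightarrow> flip \<epsilon> A 7 + flip \<epsilon> A 8 = 0"
  proof (intro allI impI)
    fix \<epsilon> :: "8 \<Rightarrow> real" and A :: "8 set"
    assume A: "A \<subseteq> {1,2,3,4,5,6}" and e: "\<epsilon> 7 + \<epsilon> 8 = 0"
    have "7 \<notin> A" "8 \<notin> A" by (rule contra_subsetD[OF A], simp)+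
    then show "flip \<epsilon> A 7 + flip \<epsilon> A 8 = 0" using e by (simp add: flip_def)
  qed
  note sys = spin_system[OF S71_def W subset_refl]
  have span: False if \<gamma>: "\<gamma> \<in> E7_roots" "\<forall>x\<in>S71. x \<bullet> \<gamma> = 0" for \<gamma>
  proof -
    have i6: "\<gamma> $ i = 0" if "i \<noteq> 7" "i \<noteq> 8" for i
      by (rule sys(3)[OF ones_S71 \<gamma>(2)]) (unfold index_6, use that in blast)
    have 78: "\<gamma> $ 7 + \<gamma> $ 8 = 0" "\<gamma> \<bullet> \<gamma> = 2" using \<gamma>(1) by (simp_all add: E7_roots_eq)
    \<comment> \<open>Sign flips reach only the first six entries. The sample root gives equality of
      entries 7 and 8, which in E7 are also opposite.\<close>
    have "\<gamma> \<bullet> spin (\<lambda>j. if j \<in> {1, 8} then - 1 else 1) = 0"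
      using bspec[OF \<gamma>(2) ones_S71] by (simp add: inner_commute)
    moreover have "\<gamma> \<bullet> spin (\<lambda>j. if j \<in> {1, 8} then - 1 else 1)
        = (\<Sum>k\<in>{7, 8}. \<gamma> $ k * spin (\<lambda>j. if j \<in> {1, 8} then - 1 else 1) $ k)"
      unfolding inner_vec_def by (rule sum.mono_neutral_cong_right) (simp_all add: i6)
    ultimately have "\<gamma> $ 7 - \<gamma> $ 8 = 0" by simp
    then have "\<gamma> $ 7 = 0" "\<gamma> $ 8 = 0" using 78(1) by linarith+
    then have "\<gamma> $ i = 0" for i using i6[of i] by metis
    then have "\<gamma> = 0" by (simp add: vec_eq_iff)
    then show False using 78 by simp
  qed
  show ?thesis
    by (rule rich_graded_root_systemI[OF simply_laced_E7 _ eq sys(1,2)]) (use int span in blast)+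
qed

text \<open>Twice a basis vector lies in the E8 lattice; its products are \<plusminus>1 on spin
  vectors and even on the integral roots.\<close>

lemma S81_system: "rich_graded_root_system E8_roots (2 *\<^sub>R ax 1) \<and> graded_root_system.S E8_roots (2 *\<^sub>R ax 1) = S81"
proof -
  have eq: "S81 = {\<alpha> \<in> E8_roots. odd \<lfloor>\<alpha> \<bullet> (2 *\<^sub>R ax 1)\<rfloor>}"
  proof -
    have "\<not> odd \<lfloor>\<alpha> \<bullet> (2 *\<^sub>R ax 1)\<rfloor>" if "\<alpha> \<in> D_roots I" for \<alpha> I
      using that by (elim D_rootsE) auto
    moreover have "odd \<lfloor>\<alpha> \<bullet> (2 *\<^sub>R ax 1)\<rfloor>" if "\<alpha> \<in> S81" for \<alpha>
    proof -
      obtain \<epsilon> where e: "\<epsilon> \<in> even_signs" "\<alpha> = spin \<epsilon>" using \<open>\<alpha> \<in> S81\<close> by (auto simp: S81_def)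
      then have "\<alpha> \<bullet> (2 *\<^sub>R ax 1) = \<epsilon> 1" by simp
      then show ?thesis using signs_pm[OF e(1), of 1] by auto
    qed
    moreover have "E8_roots = D_roots {1, 2, 3, 4, 5, 6, 7, 8} \<union> S81"
      by (simp add: E8_roots_def S81_def)
    ultimately show ?thesis by blast
  qed
  have "1 *\<^sub>R ax 1 + 1 *\<^sub>R ax 1 \<in> E8_lattice" by (rule ax_E8_lattice) simp_all
  then have "2 *\<^sub>R ax 1 \<in> E8_lattice" by (simp add: scaleR_2)
  then have int: "\<alpha> \<bullet> (2 *\<^sub>R ax 1) \<in> \<int>" if "\<alpha> \<in> E8_roots" for \<alpha>
    using that E8_lattice_inner unfolding E8_roots_eq by blast
  have S81: "S81 = {spin \<epsilon> | \<epsilon>. \<epsilon> \<in> even_signs \<and> True}" by (simp add: S81_def)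
  have W: "\<forall>\<epsilon> A. A \<subseteq> UNIV \<longrightarrow> True \<longrightarrow> True" by blast
  note sys = spin_system[OF S81 W subset_UNIV]
  have span: False if \<gamma>: "\<gamma> \<in> E8_roots" "\<forall>x\<in>S81. x \<bullet> \<gamma> = 0" for \<gamma>
  proof -
    have "spin (\<lambda>j. if j \<in> {1, 8} then - 1 else 1) \<in> S81" using ones_S71 by (auto simp: S71_def S81_def)
    then have "\<gamma> $ i = 0" for i using sys(3)[OF _ \<gamma>(2)] by blast
    then have "\<gamma> = 0" by (simp add: vec_eq_iff)
    then show False using \<gamma>(1) by (simp add: E8_roots_eq)
  qed
  show ?thesis
    by (rule rich_graded_root_systemI[OF simply_laced_E8 _ eq sys(1,2)]) (use int span in blast)+
qed

subsubsection \<open>Gradations defined by a root\<close>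

lemma pairs_vanish:
  fixes \<gamma> :: "8 \<Rightarrow> real"
  assumes I: "card I \<ge> 3" and 0: "\<And>i j. i \<in> I \<Longrightarrow> j \<in> I \<Longrightarrow> i \<noteq> j \<Longrightarrow> \<gamma> i + \<gamma> j = 0"
    and i: "i \<in> I"
  shows "\<gamma> i = 0"
proof -
  have "\<exists>k\<in>I. k \<notin> {i}" by (rule exists_outside) (use I in simp_all)
  then obtain k where k: "k \<in> I" "i \<noteq> k" by blast
  have "\<exists>l\<in>I. l \<notin> {i, k}"
    by (rule exists_outside) (use card_doubleton_le(1)[of i k] I in simp_all)
  then obtain l where l: "l \<in> I" "i \<noteq> l" "k \<noteq> l" by blast
  show ?thesis using 0[OF i k] 0[OF i l(1,2)] 0[OF k(1) l(1,3)] by linarith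
qed

text \<open>In the two gradations given by a root \<open>b\<close>, these are the odd roots whose
  product with \<open>b\<close> is 1; their negatives are the remaining odd roots.\<close>

definition pair_vectors :: "real^8 \<Rightarrow> 8 set \<Rightarrow> (real^8) set" where
  "pair_vectors b I = {ax i + ax j | i j. i \<in> I \<and> j \<in> I \<and> i \<noteq> j} \<union>
     {b - (ax i + ax j) | i j. i \<in> I \<and> j \<in> I \<and> i \<noteq> j}"

lemma pair_vectors_cases [consumes 1, case_names pair dual]:
  assumes "x \<in> pair_vectors b I"
  obtains i j where "x = ax i + ax j" "i \<in> I" "j \<in> I" "i \<noteq> j"
    | i j where "x = b - (ax i + ax j)" "i \<in> I" "j \<in> I" "i \<noteq> j"
  using assms unfolding pair_vectors_def by blast

lemma pair_vectorsI: "i \<in> I \<Longrightarrow> j \<in> I \<Longrightarrow> i \<noteq> j \<Longrightarrow> ax i + ax j \<in> pair_vectors b I"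
  and pair_vectorsI_dual: "i \<in> I \<Longrightarrow> j \<in> I \<Longrightarrow> i \<noteq> j \<Longrightarrow> b - (ax i + ax j) \<in> pair_vectors b I"
  unfolding pair_vectors_def by blast+

text \<open>Covers (6,2), with the five indices 1 to 5, and (8,2), with all eight. The bound on
  \<open>I\<close> leaves spare indices for the constructions below.\<close>

locale root_gradation =
  fixes b :: "real^8" and I :: "8 set"
  assumes b_norm: "b \<bullet> b = 2" and b_half: "i \<in> I \<Longrightarrow> b $ i = 1/2" and I_card: "card I \<ge> 5"
begin

abbreviation P where "P \<equiv> pair_vectors b I"

lemma P_b: "x \<in> P \<Longrightarrow> x \<bullet> b = 1"
  by (cases x rule: pair_vectors_cases)
    (auto simp: inner_add_left inner_diff_left b_half b_norm)

lemma P_norm: "x \<in> P \<Longrightarrow> x \<bullet> x = 2"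
  by (cases x rule: pair_vectors_cases)
    (auto simp: inner_add_left inner_add_right inner_diff_left inner_diff_right b_half b_norm)

text \<open>Up to sign the reflection in \<open>b\<close>, since (x|b) = 1.\<close>

lemma P_dual: "x \<in> P \<Longrightarrow> b - x \<in> P"
  by (cases x rule: pair_vectors_cases) (auto intro: pair_vectorsI pair_vectorsI_dual)

text \<open>The product is 1 minus the number of common indices, so exactly one is shared. The
  neighbour adds the unshared index of the first pair to an index outside both pairs.\<close>

lemma common_neighbour_mixed:
  assumes "i \<in> I" "j \<in> I" "i \<noteq> j" "k \<in> I" "l \<in> I" "k \<noteq> l"
    and 0: "(ax i + ax j) \<bullet> (b - (ax k + ax l)) = 0"
  shows "\<exists>z\<in>P. z \<bullet> (ax i + ax j) = 1 \<and> z \<bullet> (b - (ax k + ax l)) = 1"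
proof -
  have main: "\<exists>z\<in>P. z \<bullet> (ax i + ax j) = 1 \<and> z \<bullet> (b - (ax i + ax l)) = 1"
    if h: "i \<in> I" "j \<in> I" "i \<noteq> j" "l \<in> I" "i \<noteq> l" "j \<noteq> l" for i j l
  proof -
    have "\<exists>m\<in>I. m \<notin> {i, j, l}"
      by (rule exists_outside) (use card_doubleton_le(2)[of i j l] I_card in simp_all)
    then obtain m where m: "m \<in> I" "m \<noteq> i" "m \<noteq> j" "m \<noteq> l" by blast
    have "(ax j + ax m) \<bullet> (ax i + ax j) = 1" "(ax j + ax m) \<bullet> (b - (ax i + ax l)) = 1"
      using h m by (simp_all add: inner_add_left inner_add_right inner_diff_right b_half)
    then show ?thesis using pair_vectorsI[OF h(2) m(1)] m by blast
  qed
  have "(if i = k then 1 else 0) + (if i = l then 1 else 0) + (if j = k then 1 else 0)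
      + (if j = l then 1 else 0) = (1::real)"
    using 0 assms(1-6) by (simp add: inner_add_left inner_diff_right inner_add_right b_half algebra_simps)
  then consider "i = k" "j \<noteq> l" | "i = l" "j \<noteq> k" | "j = k" "i \<noteq> l" | "j = l" "i \<noteq> k"
    using assms(3,6) by (auto split: if_splits)
  then show ?thesis
  proof cases
    case 1
    then show ?thesis using main[of i j l] assms by auto
  next
    case 2
    then show ?thesis using main[of i j k] assms by (auto simp: add.commute)
  next
    case 3
    then show ?thesis using main[of j i l] assms by (auto simp: add.commute)
  next
    case 4
    then show ?thesis using main[of j i k] assms by (auto simp: add.commute)
  qed
qed

lemma common_neighbour_pairs:
  assumes "i \<in> I" "j \<in> I" "i \<noteq> j" "k \<in> I" "l \<in> I" "k \<noteq> l"
    and 0: "(ax i + ax j) \<bullet> (ax k + ax l) = 0"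
  shows "(ax i + ax k) \<bullet> (ax i + ax j) = 1" "(ax i + ax k) \<bullet> (ax k + ax l) = 1" "ax i + ax k \<in> P"
proof -
  have "i \<noteq> k" "i \<noteq> l" "j \<noteq> k" "j \<noteq> l"
    using 0 by (auto simp: inner_add_left inner_add_right split: if_splits)
  then show "(ax i + ax k) \<bullet> (ax i + ax j) = 1" "(ax i + ax k) \<bullet> (ax k + ax l) = 1" "ax i + ax k \<in> P"
    using assms(1-6) by (auto simp: inner_add_left inner_add_right intro: pair_vectorsI)
qed

lemma common_neighbour:
  assumes x: "x \<in> P" and y: "y \<in> P" and 0: "x \<bullet> y = 0"
  shows "\<exists>z\<in>P. z \<bullet> x = 1 \<and> z \<bullet> y = 1"
  using x
proof (cases rule: pair_vectors_cases)
  case (pair i j)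
  note x' = pair
  from y show ?thesis
  proof (cases rule: pair_vectors_cases)
    case (pair k l)
    then show ?thesis using common_neighbour_pairs[of i j k l] x' 0 by blast
  next
    case (dual k l)
    then show ?thesis using common_neighbour_mixed[of i j k l] x' 0 by blast
  qed
next
  case (dual i j)
  note x' = dual
  from y show ?thesis
  proof (cases rule: pair_vectors_cases)
    case (pair k l)
    then show ?thesis using common_neighbour_mixed[of k l i j] x' 0 inner_commute by metis
  next
    case (dual k l)
    have "(ax i + ax j) \<bullet> (ax k + ax l) = 0"
      using 0 x' dual by (simp add: inner_diff_left inner_diff_right b_norm inner_add_left inner_add_right b_half)
    then have n: "(ax i + ax k) \<bullet> (ax i + ax j) = 1" "(ax i + ax k) \<bullet> (ax k + ax l) = 1" "ax i + ax k \<in> P"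
      using common_neighbour_pairs[of i j k l] x' dual by blast+
    \<comment> \<open>Passing to b - x preserves products among vectors having product 1 with
      \<open>b\<close>, which reduces the case of two duals to that of two pairs.\<close>
    have dd: "(b - v) \<bullet> (b - w) = v \<bullet> w" if "v \<bullet> b = 1" "w \<bullet> b = 1" for v w
      using that by (simp add: inner_diff_left inner_diff_right b_norm inner_commute)
    have "(b - (ax i + ax k)) \<bullet> x = 1" "(b - (ax i + ax k)) \<bullet> y = 1"
      using n x' dual by (simp_all add: dd inner_add_left b_half P_b)
    then show ?thesis using P_dual[OF n(3)] by blast
  qed
qed

definition PM :: "(real^8) set" where "PM = {s *\<^sub>R x | s x. (s = 1 \<or> s = -1) \<and> x \<in> P}"

lemma PM_eq: "PM = pm_sums I \<union> {s *\<^sub>R (b - (ax i + ax j)) | s i j. (s = 1 \<or> s = -1) \<and> i \<in> I \<and> j \<in> I \<and> i \<noteq> j}"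
  unfolding PM_def pm_sums_def pair_vectors_def by blast

lemma P_lattice:
  assumes "b \<in> E8_lattice" "x \<in> P" shows "x \<in> E8_lattice"
  using assms(2)
proof (cases rule: pair_vectors_cases)
  case (pair i j)
  then show ?thesis using ax_E8_lattice[of 1 1 i j] by simp
next
  case (dual i j)
  then show ?thesis using ax_E8_lattice[of 1 1 i j] E8_lattice_diff[OF assms(1)] by simp
qed

lemma PM_odd_roots:
  assumes R: "simply_laced R" "R = {x \<in> E8_lattice. x \<bullet> x = 2 \<and> p x}"
    and "b \<in> E8_lattice" "\<And>x. x \<in> P \<Longrightarrow> p x"
  shows "PM \<subseteq> {\<alpha> \<in> R. odd \<lfloor>\<alpha> \<bullet> b\<rfloor>}"
proof
  fix \<alpha> assume "\<alpha> \<in> PM"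
  then obtain s x where x: "\<alpha> = s *\<^sub>R x" "s = 1 \<or> s = -1" "x \<in> P" unfolding PM_def by blast
  have "x \<in> R" using P_lattice[OF assms(3) x(3)] P_norm[OF x(3)] assms(4)[OF x(3)] by (simp add: R(2))
  then have "\<alpha> \<in> R" using x(1,2) simply_laced.R_minus[OF R(1)] by auto
  then show "\<alpha> \<in> {\<alpha> \<in> R. odd \<lfloor>\<alpha> \<bullet> b\<rfloor>}" using x P_b[OF x(3)] by auto
qed

lemma odd_D_root_PM:
  assumes "\<alpha> \<in> D_roots I" "odd \<lfloor>\<alpha> \<bullet> b\<rfloor>" shows "\<alpha> \<in> PM"
proof -
  obtain s t i j where st: "s = 1 \<or> s = -1" "t = 1 \<or> t = -1" "i \<in> I" "j \<in> I" "i \<noteq> j" "\<alpha> = s *\<^sub>R ax i + t *\<^sub>R ax j"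
    using assms(1) by (elim D_rootsE)
  have "\<alpha> \<bullet> b = s * b $ i + t * b $ j" using st(6) by (simp add: inner_add_left)
  then have "\<alpha> \<bullet> b = (s + t) / 2" unfolding b_half[OF st(3)] b_half[OF st(4)] by simp
  then have "s = t" using st(1,2) assms(2) by auto
  then have "\<alpha> = s *\<^sub>R (ax i + ax j)" using st(6) by (simp add: scaleR_add_right)
  then show ?thesis unfolding PM_def using st(1) pair_vectorsI[OF st(3-5)] by blast
qed

text \<open>For equal signs, b - y' has product 1 with x' and 1 - 2 = -1 with y'. For opposite
  signs, a common neighbour of x' and y' does it.\<close>

lemma PM_connecting: "\<forall>x\<in>PM. \<forall>y\<in>PM. y \<bullet> x = 0 \<longrightarrow> (\<exists>z\<in>PM. z \<bullet> x = 1 \<and> z \<bullet> y = -1)"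
proof (intro ballI impI)
  fix x y assume "x \<in> PM" "y \<in> PM" and 0: "y \<bullet> x = 0"
  then obtain s t x' y' where x: "x = s *\<^sub>R x'" "s = 1 \<or> s = -1" "x' \<in> P" and y: "y = t *\<^sub>R y'" "t = 1 \<or> t = -1" "y' \<in> P"
    unfolding PM_def by blast
  have ort: "x' \<bullet> y' = 0" "y' \<bullet> x' = 0" using 0 x y by (auto simp: inner_commute)
  show "\<exists>z\<in>PM. z \<bullet> x = 1 \<and> z \<bullet> y = -1"
  proof (cases "s = t")
    case True
    have "s *\<^sub>R (b - y') \<in> PM" unfolding PM_def using P_dual y(3) x(2) by blast
    moreover have "(s *\<^sub>R (b - y')) \<bullet> x = 1" "(s *\<^sub>R (b - y')) \<bullet> y = -1"
      using x y True ort P_b[OF x(3)] P_b[OF y(3)] P_norm[OF y(3)]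
      by (auto simp: inner_diff_left inner_commute[of b])
    ultimately show ?thesis by blast
  next
    case False
    obtain z where z: "z \<in> P" "z \<bullet> x' = 1" "z \<bullet> y' = 1" using common_neighbour[OF x(3) y(3) ort(1)] by blast
    have "s *\<^sub>R z \<in> PM" unfolding PM_def using z(1) x(2) by blast
    moreover have "(s *\<^sub>R z) \<bullet> x = 1" "(s *\<^sub>R z) \<bullet> y = -1" using x y z False by auto
    ultimately show ?thesis by blast
  qed
qed

lemma PM_orthogonal: "\<forall>x\<in>PM. \<exists>y\<in>PM. y \<bullet> x = 0"
proof
  fix x assume "x \<in> PM"
  then obtain s x' where x: "x = s *\<^sub>R x'" "x' \<in> P" unfolding PM_def by blast
  have outside: "\<exists>k\<in>I. \<exists>l\<in>I. k \<noteq> l \<and> k \<noteq> i \<and> k \<noteq> j \<and> l \<noteq> i \<and> l \<noteq> j" for i j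
  proof -
    have "\<exists>k\<in>I. k \<notin> {i, j}"
      by (rule exists_outside) (use card_doubleton_le(1)[of i j] I_card in simp_all)
    then obtain k where k: "k \<in> I" "k \<noteq> i" "k \<noteq> j" by blast
    have "\<exists>l\<in>I. l \<notin> {i, j, k}"
      by (rule exists_outside) (use card_doubleton_le(2)[of i j k] I_card in simp_all)
    then show ?thesis using k by blast
  qed
  have "\<exists>y\<in>P. y \<bullet> x' = 0" using x(2)
  proof (cases rule: pair_vectors_cases)
    case (pair i j)
    obtain k l where kl: "k \<in> I" "l \<in> I" "k \<noteq> l" "k \<noteq> i" "k \<noteq> j" "l \<noteq> i" "l \<noteq> j"
      using outside[of i j] by blast
    have "(ax k + ax l) \<bullet> x' = 0" using kl pair by (simp add: inner_add_left inner_add_right)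
    then show ?thesis using pair_vectorsI[OF kl(1-3)] by blast
  next
    case (dual i j)
    obtain k l where kl: "k \<in> I" "l \<in> I" "k \<noteq> l" "k \<noteq> i" "k \<noteq> j" "l \<noteq> i" "l \<noteq> j"
      using outside[of i j] by blast
    have "(b - (ax k + ax l)) \<bullet> x' = 0"
      using kl dual by (simp add: inner_add_left inner_add_right inner_diff_left inner_diff_right b_norm b_half)
    then show ?thesis using pair_vectorsI_dual[OF kl(1-3)] by blast
  qed
  then obtain y where "y \<in> P" "y \<bullet> x' = 0" by blast
  then have "1 *\<^sub>R y \<in> PM" "(1 *\<^sub>R y) \<bullet> x = 0" using x(1) unfolding PM_def by (blast, simp)
  then show "\<exists>y\<in>PM. y \<bullet> x = 0" by blast
qed

lemma PM_spanning:
  assumes "\<forall>x\<in>PM. x \<bullet> \<gamma> = 0"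
  shows "\<And>i. i \<in> I \<Longrightarrow> \<gamma> $ i = 0" "\<gamma> \<bullet> b = 0"
proof -
  have P0: "x \<bullet> \<gamma> = 0" if "x \<in> P" for x
  proof -
    have "1 *\<^sub>R x \<in> PM" unfolding PM_def using that by blast
    then show ?thesis using assms by auto
  qed
  show z: "\<gamma> $ i = 0" if "i \<in> I" for i
  proof (rule pairs_vanish[OF _ _ that])
    show "3 \<le> card I" using I_card by simp
    show "\<gamma> $ i + \<gamma> $ j = 0" if "i \<in> I" "j \<in> I" "i \<noteq> j" for i j
      using P0[OF pair_vectorsI[OF that]] by (simp add: inner_add_left)
  qed
  have "I \<noteq> {}" "finite I" using I_card by auto
  then obtain i where i: "i \<in> I" by blast
  have "\<exists>k\<in>I. k \<notin> {i}" by (rule exists_outside) (use I_card in simp_all)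
  then obtain j where j: "j \<in> I" "i \<noteq> j" by blast
  show "\<gamma> \<bullet> b = 0"
    using P0[OF pair_vectorsI_dual[OF i j]] z[OF i] z[OF j(1)]
    by (simp add: inner_diff_left inner_add_left inner_commute[of b])
qed

end

lemma half_spin_inner: "half_spin M \<bullet> half_spin N = 2 - card M / 2 - card N / 2 + card (M \<inter> N)"
proof -
  have "half_spin M \<bullet> half_spin N = beta0 \<bullet> beta0 - beta0 \<bullet> ax_sum M - beta0 \<bullet> ax_sum N + ax_sum M \<bullet> ax_sum N"
    by (simp add: half_spin_def inner_diff_left inner_diff_right inner_commute)
  then show ?thesis by (simp add: inner_beta0 inner_ax_sum(1) sum.If_cases Int_commute)
qed

lemma ax_sum_insert: "i \<notin> M \<Longrightarrow> ax_sum (insert i M) = ax i + ax_sum M"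
  by (simp add: ax_sum_def)

lemma ax_sum_empty [simp]: "ax_sum {} = 0"
  by (simp add: ax_sum_def)

lemma half_spin_Compl: "half_spin (- M) = - half_spin M"
  by (simp add: vec_eq_iff)

lemma card_Compl_8: "card (- M) = 8 - card (M :: 8 set)"
  by (simp add: Compl_eq_Diff_UNIV card_Diff_subset)

lemma card_le_8: "card (M :: 8 set) \<le> 8"
  using card_mono[of UNIV M] by simp

lemma half_spin_pair: "i \<noteq> j \<Longrightarrow> half_spin {i, j} = beta0 - (ax i + ax j)"
  by (simp add: half_spin_def ax_sum_insert)

text \<open>A spin root with 2m minus signs has product 2 - m with \<open>beta0\<close>, which is
  odd only for m = 1 and m = 3; the latter is the negative of the former, by complementing the set
  of signs.\<close>

lemma S82_system: "rich_graded_root_system E8_roots beta0 \<and> graded_root_system.S E8_roots beta0 = S82"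
proof -
  interpret root_gradation beta0 UNIV
    by unfold_locales (simp_all add: inner_beta0)
  have S82: "S82 = PM"
    unfolding S82_def PM_eq UNIV_8[symmetric] beta2_def diff_diff_add by (rule refl)
  have "half_spin {} \<in> E8_lattice" by (rule half_spin_E8_lattice) simp
  then have b_lattice: "beta0 \<in> E8_lattice" by (simp add: half_spin_def)
  have eq: "S82 = {\<alpha> \<in> E8_roots. odd \<lfloor>\<alpha> \<bullet> beta0\<rfloor>}"
  proof (rule equalityI)
    show "S82 \<subseteq> {\<alpha> \<in> E8_roots. odd \<lfloor>\<alpha> \<bullet> beta0\<rfloor>}"
      unfolding S82 by (rule PM_odd_roots[OF simply_laced_E8 _ b_lattice, of "\<lambda>_. True"]) (simp_all add: E8_roots_eq)
    show "{\<alpha> \<in> E8_roots. odd \<lfloor>\<alpha> \<bullet> beta0\<rfloor>} \<subseteq> S82"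
    proof
    fix \<alpha> assume a: "\<alpha> \<in> {\<alpha> \<in> E8_roots. odd \<lfloor>\<alpha> \<bullet> beta0\<rfloor>}"
    then consider "\<alpha> \<in> D_roots UNIV" | M where "even (card M)" "\<alpha> = half_spin M"
      using E8_lattice_norm2 by (auto simp: E8_roots_eq)
    then show "\<alpha> \<in> S82"
    proof cases
      case 1
      then show ?thesis using odd_D_root_PM a unfolding S82 by blast
    next
      case 2
      have "\<alpha> \<bullet> beta0 = 2 - card M / 2"
        using half_spin_inner[of M "{}"] 2(2) by (simp add: half_spin_def[of "{}"])
      moreover obtain m where m: "card M = 2 * m" using 2(1) by (elim evenE)
      ultimately have "odd \<lfloor>2 - real m\<rfloor>" using a by simp
      moreover have "\<lfloor>2 - real m\<rfloor> = 2 - int m" by (rule floor_unique) auto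
      ultimately have "odd m" by simp
      moreover have "m \<le> 4" using card_le_8[of M] m by simp
      ultimately have "m = 1 \<or> m = 3" by presburger
      then show ?thesis
      proof
        assume "m = 1"
        then obtain i j where ij: "M = {i, j}" "i \<noteq> j" using m card_2_iff[of M] by auto
        then have "\<alpha> = 1 *\<^sub>R (beta0 - (ax i + ax j))" using 2 half_spin_pair by simp
        then show ?thesis unfolding S82 PM_def using pair_vectorsI_dual[OF UNIV_I UNIV_I ij(2)] by blast
      next
        assume "m = 3"
        then obtain i j where ij: "- M = {i, j}" "i \<noteq> j" using m card_Compl_8[of M] card_2_iff[of "- M"] by auto
        then have "\<alpha> = (- 1) *\<^sub>R (beta0 - (ax i + ax j))" using 2 half_spin_pair half_spin_Compl[of M] by simp
        then show ?thesis unfolding S82 PM_def using pair_vectorsI_dual[OF UNIV_I UNIV_I ij(2)] by blast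
      qed
    qed
  qed
  qed
  have int: "\<forall>\<alpha>\<in>E8_roots. \<alpha> \<bullet> beta0 \<in> \<int>"
    using E8_lattice_inner b_lattice unfolding E8_roots_eq by blast
  have span: "\<exists>x\<in>S82. x \<bullet> \<gamma> \<noteq> 0" if "\<gamma> \<in> E8_roots" for \<gamma>
  proof (rule ccontr)
    assume "\<not> (\<exists>x\<in>S82. x \<bullet> \<gamma> \<noteq> 0)"
    then have "\<gamma> $ i = 0" for i using PM_spanning(1) unfolding S82 by blast
    then have "\<gamma> = 0" by (simp add: vec_eq_iff)
    then show False using that by (simp add: E8_roots_eq)
  qed
  show ?thesis
    by (rule rich_graded_root_systemI[OF simply_laced_E8 int eq PM_connecting[folded S82] PM_orthogonal[folded S82]])
      (use span in blast)
qed

lemma half_spin_four: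
  assumes "card N = 4" "6 \<in> N" "7 \<in> N" "8 \<notin> N"
  shows "\<exists>i\<in>{1,2,3,4,5}. \<exists>j\<in>{1,2,3,4,5}. i \<noteq> j \<and> half_spin N = half_spin {6, 7} - (ax i + ax j)"
proof -
  have "card (N - {6, 7}) = 2" using assms by (simp add: card_Diff_subset)
  then obtain i j where ij: "N - {6, 7} = {i, j}" "i \<noteq> j" using card_2_iff[of "N - {6, 7}"] by auto
  then have N: "N = insert i (insert j {6, 7})" "i \<notin> {6, 7}" "j \<notin> {6, 7}" using assms by blast+
  have I: "i \<in> {1,2,3,4,5}" "j \<in> {1,2,3,4,5}"
    using N assms(4) unfolding index_5 by blast+
  have "half_spin N = half_spin {6, 7} - (ax i + ax j)"
    using N(2,3) ij(2) unfolding N(1) half_spin_def by (simp add: ax_sum_insert algebra_simps)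
  then show ?thesis using ij(2) by (intro bexI[OF bexI[OF _ I(2)] I(1)]) blast
qed

lemma floor_nat_diff: "\<lfloor>real k - real m\<rfloor> = int k - int m"
  by (rule floor_unique) auto

text \<open>The defining vector is itself a root of E6, with entries 1/2 at 1 to 5, so subtracting a
  pair from it gives exactly the vectors \<open>beta4 i j 6 7\<close>.\<close>

lemma S62_system: "rich_graded_root_system E6_roots (half_spin {6, 7}) \<and> graded_root_system.S E6_roots (half_spin {6, 7}) = S62"
proof -
  let ?b = "half_spin {6, 7}" and ?I = "{1,2,3,4,5 :: 8}"
  interpret root_gradation ?b ?I
  proof
    show "?b $ i = 1 / 2" if "i \<in> ?I" for i using that unfolding index_5 by simp
  qed (simp_all add: half_spin_norm)
  have S62: "S62 = PM"
  proof -
    have "beta4 i j 6 7 = ?b - (ax i + ax j)" for i j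
      by (simp add: beta4_def half_spin_pair algebra_simps)
    then show ?thesis unfolding S62_def PM_eq by simp
  qed
  have b_lattice: "?b \<in> E8_lattice" by (rule half_spin_E8_lattice) simp
  have I_nth: "ax i $ 6 = 0" "ax i $ 7 = 0" "ax i $ 8 = 0" if "i \<in> ?I" for i
    using that unfolding index_5 by simp_all
  have eq: "S62 = {\<alpha> \<in> E6_roots. odd \<lfloor>\<alpha> \<bullet> ?b\<rfloor>}"
  proof (rule equalityI)
    have "x $ 6 = x $ 7 \<and> x $ 7 = - x $ 8" if "x \<in> P" for x
      using that
    proof (cases rule: pair_vectors_cases)
      case (pair i j)
      then show ?thesis using I_nth[of i] I_nth[of j] by (simp del: ax_nth)
    next
      case (dual i j)
      then show ?thesis using I_nth[of i] I_nth[of j] by (simp del: ax_nth)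
    qed
    then show "S62 \<subseteq> {\<alpha> \<in> E6_roots. odd \<lfloor>\<alpha> \<bullet> ?b\<rfloor>}"
      unfolding S62 by (rule PM_odd_roots[OF simply_laced_E6 E6_roots_eq b_lattice])
    show "{\<alpha> \<in> E6_roots. odd \<lfloor>\<alpha> \<bullet> ?b\<rfloor>} \<subseteq> S62"
    proof
    fix \<alpha> assume a: "\<alpha> \<in> {\<alpha> \<in> E6_roots. odd \<lfloor>\<alpha> \<bullet> ?b\<rfloor>}"
    then have "\<alpha> \<in> E6_roots" by blast
    then show "\<alpha> \<in> S62"
    proof (cases rule: E6_cases)
      case 1
      then show ?thesis using odd_D_root_PM a unfolding S62 by blast
    next
      case (2 M)
      obtain m where m: "card M = 2 * m" using 2(1) by (elim evenE)
      \<comment> \<open>The count at 6 and 7 is 2 or 0, so the product is 3 - m or 1 - m; with m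
        between 1 and 3 oddness means m = 2 either way. In the second case the complement is of the
        first kind.\<close>
      have ip: "\<alpha> \<bullet> ?b = 1 - real m + card (M \<inter> {6, 7})"
        using half_spin_inner[of M "{6, 7}"] 2(2) m by simp
      have M: "M \<noteq> {}" "- M \<noteq> {}" using 2(4) by auto
      then have "card M \<noteq> 0" "card (- M) \<noteq> 0" by simp_all
      then have m3: "1 \<le> m" "m \<le> 3" using m card_Compl_8[of M] by auto
      show ?thesis
      proof (cases "7 \<in> M")
        case True
        then have "M \<inter> {6, 7} = {6, 7}" using 2(3) by blast
        then have "odd \<lfloor>real 3 - real m\<rfloor>" using a ip by simp
        then have "m = 2" using m3 unfolding floor_nat_diff by presburger
        then have "\<exists>i\<in>?I. \<exists>j\<in>?I. i \<noteq> j \<and> half_spin M = ?b - (ax i + ax j)"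
          using 2(3,4) True m by (intro half_spin_four) simp_all
        then obtain i j where ij: "i \<in> ?I" "j \<in> ?I" "i \<noteq> j" "half_spin M = ?b - (ax i + ax j)" by (elim bexE conjE)
        then have "\<alpha> = 1 *\<^sub>R (?b - (ax i + ax j))" using 2(2) by simp
        then show ?thesis unfolding S62 PM_def using pair_vectorsI_dual[OF ij(1-3)] by blast
      next
        case False
        then have "M \<inter> {6, 7} = {}" using 2(3) by blast
        then have "odd \<lfloor>real 1 - real m\<rfloor>" using a ip by simp
        then have "m = 2" using m3 unfolding floor_nat_diff by presburger
        then have "\<exists>i\<in>?I. \<exists>j\<in>?I. i \<noteq> j \<and> half_spin (- M) = ?b - (ax i + ax j)"
          using 2(3,4) False m card_Compl_8[of M] by (intro half_spin_four) simp_all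
        then obtain i j where ij: "i \<in> ?I" "j \<in> ?I" "i \<noteq> j" "half_spin (- M) = ?b - (ax i + ax j)" by (elim bexE conjE)
        have "\<alpha> = - half_spin (- M)" using 2(2) half_spin_Compl[of M] by simp
        then have "\<alpha> = (- 1) *\<^sub>R (?b - (ax i + ax j))" unfolding ij(4) by simp
        then show ?thesis unfolding S62 PM_def using pair_vectorsI_dual[OF ij(1-3)] by blast
      qed
    qed
  qed
  qed
  have int: "\<forall>\<alpha>\<in>E6_roots. \<alpha> \<bullet> ?b \<in> \<int>"
    using E8_lattice_inner b_lattice unfolding E6_roots_eq by blast
  have span: "\<exists>x\<in>S62. x \<bullet> \<gamma> \<noteq> 0" if g: "\<gamma> \<in> E6_roots" for \<gamma>
  proof (rule ccontr)
    assume "\<not> (\<exists>x\<in>S62. x \<bullet> \<gamma> \<noteq> 0)"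
    then have z: "\<forall>x\<in>PM. x \<bullet> \<gamma> = 0" unfolding S62 by blast
    have i5: "\<gamma> $ i = 0" if "i \<noteq> 6" "i \<noteq> 7" "i \<noteq> 8" for i
      by (rule PM_spanning(1)[OF z]) (unfold index_5, use that in blast)
    have "\<gamma> \<bullet> ?b = (\<Sum>k\<in>{6, 7, 8}. \<gamma> $ k * ?b $ k)"
      unfolding inner_vec_def by (rule sum.mono_neutral_cong_right) (simp_all add: i5)
    \<comment> \<open>Together with the equations of E6 this says that three times the last entry is
      0.\<close>
    then have "- \<gamma> $ 6 - \<gamma> $ 7 + \<gamma> $ 8 = 0" using PM_spanning(2)[OF z] by simp
    moreover have g': "\<gamma> $ 6 = \<gamma> $ 7" "\<gamma> $ 7 = - \<gamma> $ 8" "\<gamma> \<bullet> \<gamma> = 2" using g by (simp_all add: E6_roots_eq)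
    ultimately have "\<gamma> $ 6 = 0" "\<gamma> $ 7 = 0" "\<gamma> $ 8 = 0" by linarith+
    then have "\<gamma> $ i = 0" for i using i5[of i] by metis
    then have "\<gamma> = 0" by (simp add: vec_eq_iff)
    then show False using g'(3) by simp
  qed
  show ?thesis
    by (rule rich_graded_root_systemI[OF simply_laced_E6 int eq PM_connecting[folded S62] PM_orthogonal[folded S62]])
      (use span in blast)
qed

subsubsection \<open>The gradation of type E7 with even part A7\<close>

text \<open>Unlike in the other cases, the vector defining this gradation is not in the E8 lattice; it is
  only integral on the roots of type E7.\<close>

definition b72 :: "real^8" where "b72 = beta0 + (1/2) *\<^sub>R ax 7 - (3/2) *\<^sub>R ax 8"

definition triples :: "8 set set" where "triples = {B. B \<subseteq> {1,2,3,4,5,6} \<and> card B = 3}"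

lemma triple_index: "B \<in> triples \<Longrightarrow> i \<in> B \<Longrightarrow> i \<noteq> 7 \<and> i \<noteq> 8"
  unfolding triples_def using index_6 by blast

lemma b72_nth: "b72 $ i = (if i = 7 then 1 else if i = 8 then - 1 else 1/2)"
  by (simp add: b72_def)

lemma beta4_half_spin:
  assumes "distinct [i, j, h, k]" shows "beta4 i j h k = half_spin {i, j, h, k}"
  using assms by (simp add: beta4_def half_spin_def ax_sum_insert algebra_simps)

lemma S72_eq: "S72 = pm_sums {1,2,3,4,5,6} \<union> {half_spin (insert k B) | k B. B \<in> triples \<and> (k = 7 \<or> k = 8)}"
proof -
  let ?I = "{1,2,3,4,5,6 :: 8}"
  let ?X = "{beta4 i j h k | i j h k. i \<in> ?I \<and> j \<in> ?I \<and> h \<in> ?I \<and>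
      i \<noteq> j \<and> i \<noteq> h \<and> j \<noteq> h \<and> (k = 7 \<or> k = 8)}"
  let ?Y = "{half_spin (insert k B) | k B. B \<in> triples \<and> (k = 7 \<or> k = 8)}"
  have XY: "beta4 i j h k \<in> {half_spin (insert k B) | k B. B \<in> triples \<and> (k = 7 \<or> k = 8)}"
    if "i \<in> ?I" "j \<in> ?I" "h \<in> ?I" "i \<noteq> j" "i \<noteq> h" "j \<noteq> h" "k = 7 \<or> k = 8" for i j h k
  proof -
    have "distinct [i, j, h, k]" using that unfolding index_6 by auto
    then have "beta4 i j h k = half_spin (insert k {i, j, h})"
      using beta4_half_spin[of i j h k] by (simp add: insert_commute)
    moreover have "card {i, j, h} = 3" using that(4-6) by simp
    moreover have "{i, j, h} \<subseteq> ?I" using that(1-3) by (simp only: insert_subset empty_subsetI)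
    ultimately have "beta4 i j h k = half_spin (insert k {i, j, h})" "{i, j, h} \<in> triples"
      unfolding triples_def by blast+
    then show ?thesis using that(7) by blast
  qed
  have YX: "\<exists>i j h. half_spin (insert k B) = beta4 i j h k \<and>
      i \<in> ?I \<and> j \<in> ?I \<and> h \<in> ?I \<and> i \<noteq> j \<and> i \<noteq> h \<and> j \<noteq> h"
    if B: "B \<in> triples" and k: "k = 7 \<or> k = 8" for k B
  proof -
    obtain i j h where ijh: "B = {i, j, h}" "i \<noteq> j" "i \<noteq> h" "j \<noteq> h"
      using B card_3_iff[of B] unfolding triples_def by auto
    have "B \<subseteq> ?I" using B unfolding triples_def by blast
    then have I: "i \<in> ?I" "j \<in> ?I" "h \<in> ?I" using ijh(1) by (simp_all only: insert_subset)
    have "distinct [i, j, h, k]" using I k ijh unfolding index_6 by auto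
    then have "half_spin (insert k B) = beta4 i j h k"
      using beta4_half_spin[of i j h k] ijh(1) by (simp add: insert_commute)
    then show ?thesis using I ijh(2-4) by (intro exI conjI)
  qed
  have "?X = ?Y"
  proof (intro equalityI subsetI)
    fix x assume "x \<in> ?X"
    then show "x \<in> ?Y" by (elim CollectE exE conjE) (simp only:, rule XY)
  next
    fix x assume "x \<in> ?Y"
    then obtain k B where kB: "x = half_spin (insert k B)" "B \<in> triples" "k = 7 \<or> k = 8" by blast
    obtain i j h where "half_spin (insert k B) = beta4 i j h k" "i \<in> ?I" "j \<in> ?I" "h \<in> ?I"
      "i \<noteq> j" "i \<noteq> h" "j \<noteq> h"
      using YX[OF kB(2,3)] by (elim exE conjE)
    then show "x \<in> ?X" using kB(1,3)
      by (intro CollectI exI[of _ i] exI[of _ j] exI[of _ h] exI[of _ k] conjI) (simp only:)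
  qed
  then show ?thesis unfolding S72_def by (simp only:)
qed

text \<open>The contribution of \<open>beta0\<close> is 2 - m; the extra terms at 7 and 8, whose
  signs are opposite, shift it by -1 or +1.\<close>

lemma half_spin_b72:
  assumes "7 \<in> M \<longleftrightarrow> 8 \<notin> M" "card M = 2 * m"
  shows "half_spin M \<bullet> b72 = (if 7 \<in> M then 1 else 3) - real m"
proof -
  have "half_spin M \<bullet> beta0 = 2 - real m"
    using half_spin_inner[of M "{}"] assms(2) by (simp add: half_spin_def[of "{}"])
  then show ?thesis using assms(1) by (simp add: b72_def inner_add_right inner_diff_right)
qed

lemma triple_card: "B \<in> triples \<Longrightarrow> k = 7 \<or> k = 8 \<Longrightarrow> card (insert k B) = 4"
  using triple_index[of B k] finite_subset[of B UNIV] by (auto simp: triples_def card_insert_if)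

text \<open>The product is (s + t)/2 on the roots in the first six coordinates, \<plusminus>2 on the
  roots supported at 7 and 8, and 1 - m or 3 - m on spin roots. It is odd exactly for s = t,
  respectively for four minus signs.\<close>

lemma S72_roots: "S72 = {\<alpha> \<in> E7_roots. odd \<lfloor>\<alpha> \<bullet> b72\<rfloor>}" and b72_int: "\<forall>\<alpha>\<in>E7_roots. \<alpha> \<bullet> b72 \<in> \<int>"
proof -
  let ?I = "{1,2,3,4,5,6 :: 8}"
  have D: "\<alpha> \<bullet> b72 = (s + t) / 2" if "\<alpha> = s *\<^sub>R ax i + t *\<^sub>R ax j" "i \<in> ?I" "j \<in> ?I" for \<alpha> s t i j
    using that unfolding index_6 by (simp add: inner_add_left b72_nth)
  show "\<forall>\<alpha>\<in>E7_roots. \<alpha> \<bullet> b72 \<in> \<int>"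
  proof
    fix \<alpha> assume "\<alpha> \<in> E7_roots"
    then show "\<alpha> \<bullet> b72 \<in> \<int>"
    proof (cases rule: E7_cases)
      case 1
      then show ?thesis by (elim D_rootsE) (auto simp: D)
    next
      case (4 M)
      then obtain m where "card M = 2 * m" by (elim evenE)
      then show ?thesis using half_spin_b72[OF 4(3)] 4(2) by simp
    qed (simp_all add: inner_diff_left b72_nth)
  qed
  have "\<alpha> \<in> E7_roots \<and> odd \<lfloor>\<alpha> \<bullet> b72\<rfloor>" if "\<alpha> \<in> pm_sums ?I" for \<alpha>
  proof -
    obtain s i j where st: "s = 1 \<or> s = -1" "i \<in> ?I" "j \<in> ?I" "i \<noteq> j" "\<alpha> = s *\<^sub>R (ax i + ax j)"
      using \<open>\<alpha> \<in> pm_sums ?I\<close> unfolding pm_sums_def by blast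
    then have a: "\<alpha> = s *\<^sub>R ax i + s *\<^sub>R ax j" by (simp add: scaleR_add_right)
    then have "\<alpha> \<in> D_roots ?I" using D_rootsI[OF st(1) st(1) st(2-4)] by simp
    then have "\<alpha> \<in> E7_roots" unfolding E7_roots_def by blast
    then show ?thesis using D[OF a st(2,3)] st(1) by auto
  qed
  moreover have "half_spin (insert k B) \<in> E7_roots \<and> odd \<lfloor>half_spin (insert k B) \<bullet> b72\<rfloor>"
    if B: "B \<in> triples" and k: "k = 7 \<or> k = 8" for k B
  proof -
    have c: "card (insert k B) = 2 * 2" using triple_card[OF B k] by simp
    have 78: "7 \<in> insert k B \<longleftrightarrow> 8 \<notin> insert k B" using triple_index[OF B] k by auto
    have "half_spin (insert k B) \<in> E8_lattice" by (rule half_spin_E8_lattice) (simp add: c)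
    moreover have "half_spin (insert k B) $ 7 + half_spin (insert k B) $ 8 = 0" using 78 by simp
    ultimately have "half_spin (insert k B) \<in> E7_roots" by (simp add: E7_roots_eq half_spin_norm del: half_spin_nth)
    moreover have "half_spin (insert k B) \<bullet> b72 = 1 \<or> half_spin (insert k B) \<bullet> b72 = -1"
      using half_spin_b72[OF 78 c] by simp
    then have "odd \<lfloor>half_spin (insert k B) \<bullet> b72\<rfloor>" by (elim disjE) simp_all
    ultimately show ?thesis by blast
  qed
  moreover have "\<alpha> \<in> S72" if a: "\<alpha> \<in> E7_roots" "odd \<lfloor>\<alpha> \<bullet> b72\<rfloor>" for \<alpha>
    using a(1)
  proof (cases rule: E7_cases)
    case 1
    then obtain s t i j where st: "s = 1 \<or> s = -1" "t = 1 \<or> t = -1" "i \<in> ?I" "j \<in> ?I" "i \<noteq> j" "\<alpha> = s *\<^sub>R ax i + t *\<^sub>R ax j"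
      by (elim D_rootsE)
    then have "s = t" using D[OF st(6,3,4)] a(2) by auto
    then have "\<alpha> = s *\<^sub>R (ax i + ax j)" using st(6) by (simp add: scaleR_add_right)
    then show ?thesis unfolding S72_eq pm_sums_def using st(1,3-5) by blast
  next
    case 2
    then show ?thesis using a(2) by (simp add: inner_diff_left b72_nth)
  next
    case 3
    then show ?thesis using a(2) by (simp add: inner_diff_left b72_nth)
  next
    case (4 M)
    obtain m where m: "card M = 2 * m" using 4(1) by (elim evenE)
    have "M \<noteq> {}" "- M \<noteq> {}" using 4(3) by auto
    then have "card M \<noteq> 0" "card (- M) \<noteq> 0" by simp_all
    then have m3: "1 \<le> m" "m \<le> 3" using m card_Compl_8[of M] by auto
    have "odd \<lfloor>real (if 7 \<in> M then 1 else 3) - real m\<rfloor>"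
      using a(2) half_spin_b72[OF 4(3) m] 4(2) by (simp split: if_splits)
    then have "m = 2" using m3 unfolding floor_nat_diff by (cases "7 \<in> M") (simp_all, presburger+)
    \<comment> \<open>The one of 7 and 8 that carries a minus sign; the other three minus signs form
      the triple.\<close>
    define k :: 8 where "k = (if 7 \<in> M then 7 else 8)"
    have k: "k \<in> M" "k = 7 \<or> k = 8" "M - {k} = M - {7, 8}" using 4(3) by (auto simp: k_def)
    have "M - {k} \<subseteq> ?I" unfolding k(3) using index_6 by blast
    moreover have "card (M - {k}) = 3" using k(1) m \<open>m = 2\<close> by simp
    ultimately have "M - {k} \<in> triples" unfolding triples_def by blast
    moreover have "\<alpha> = half_spin (insert k (M - {k}))" using 4(2) k(1) by (simp add: insert_absorb)
    ultimately show ?thesis unfolding S72_eq using k(2) by blast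
  qed
  ultimately show "S72 = {\<alpha> \<in> E7_roots. odd \<lfloor>\<alpha> \<bullet> b72\<rfloor>}" unfolding S72_eq by blast
qed


lemma half_spin_exchange:
  assumes "i \<in> M" "j \<notin> M"
  shows "half_spin (insert j (M - {i})) = half_spin M + ax i - ax j"
  using assms by (auto simp: vec_eq_iff)

lemma triples_inner:
  assumes "B \<in> triples" "B' \<in> triples" "k = 7 \<or> k = 8" "k' = 7 \<or> k' = 8"
  shows "half_spin (insert k B) \<bullet> half_spin (insert k' B') = real (card (B \<inter> B')) + (if k = k' then 1 else 0) - 2"
proof -
  have "insert k B \<inter> insert k' B' = (if k = k' then insert k (B \<inter> B') else B \<inter> B')"
    using triple_index[OF assms(1)] triple_index[OF assms(2)] assms(3,4) by auto
  moreover have "k \<notin> B \<inter> B'" using triple_index[OF assms(1)] assms(3) by auto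
  then have "card (insert k (B \<inter> B')) = card (B \<inter> B') + 1" by simp
  ultimately have "card (insert k B \<inter> insert k' B') = card (B \<inter> B') + (if k = k' then 1 else 0)" by (simp only: if_True if_False split: if_split) simp
  then show ?thesis
    using half_spin_inner[of "insert k B" "insert k' B'"] triple_card[OF assms(1,3)] triple_card[OF assms(2,4)]
    by simp
qed

lemma pm_sumsI: "s = 1 \<or> s = -1 \<Longrightarrow> i \<in> I \<Longrightarrow> j \<in> I \<Longrightarrow> i \<noteq> j \<Longrightarrow> s *\<^sub>R (ax i + ax j) \<in> pm_sums I"
  unfolding pm_sums_def by blast

text \<open>A folded name, so that membership is handled by the two inequalities of
  \<open>I6_iff\<close> and not as six equations.\<close>

definition I6 :: "8 set" where "I6 = {1,2,3,4,5,6}"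

lemma card_I6: "card I6 = 6" and I6_iff: "i \<in> I6 \<longleftrightarrow> i \<noteq> 7 \<and> i \<noteq> 8"
  by (simp add: I6_def) (unfold I6_def, rule index_6)

lemma triples_I6: "B \<in> triples \<longleftrightarrow> B \<subseteq> I6 \<and> card B = 3"
  by (simp add: triples_def I6_def)

lemma S72_I6: "S72 = pm_sums I6 \<union> {half_spin (insert k B) | k B. B \<in> triples \<and> (k = 7 \<or> k = 8)}"
  unfolding I6_def by (rule S72_eq)

lemma S72I: "x \<in> pm_sums I6 \<Longrightarrow> x \<in> S72"
  and S72I_spin: "B \<in> triples \<Longrightarrow> k = 7 \<or> k = 8 \<Longrightarrow> half_spin (insert k B) \<in> S72"
  unfolding S72_I6 by blast+

lemma S72_cases [consumes 1, case_names pair spin]: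
  assumes "x \<in> S72"
  obtains s i j where "s = 1 \<or> s = -1" "i \<in> I6" "j \<in> I6" "i \<noteq> j" "x = s *\<^sub>R (ax i + ax j)"
    | k B where "B \<in> triples" "k = 7 \<or> k = 8" "x = half_spin (insert k B)"
proof -
  from assms have "x \<in> pm_sums I6 \<or> (\<exists>k B. B \<in> triples \<and> (k = 7 \<or> k = 8) \<and> x = half_spin (insert k B))"
    unfolding S72_I6 by blast
  then show ?thesis
  proof
    assume "x \<in> pm_sums I6"
    then show ?thesis unfolding pm_sums_def by (elim CollectE exE conjE) (rule that(1))
  next
    assume "\<exists>k B. B \<in> triples \<and> (k = 7 \<or> k = 8) \<and> x = half_spin (insert k B)"
    then show ?thesis by (elim exE conjE) (rule that(2))
  qed
qed

text \<open>A spin root orthogonal to \<open>\<plusminus>(e\<^sub>i + e\<^sub>j)\<close> has opposite signs at \<open>i\<close> and \<open>j\<close>, so one of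
  them and some third index carry the sign needed.\<close>

lemma pair_spin_neighbour:
  assumes s: "s = 1 \<or> s = (-1::real)" and i: "i \<in> I6" "j \<in> I6" "i \<noteq> j"
    and B: "B \<in> triples" "k = 7 \<or> k = 8"
    and 0: "(s *\<^sub>R (ax i + ax j)) \<bullet> half_spin (insert k B) = 0"
  shows "\<exists>z\<in>pm_sums I6. z \<bullet> (s *\<^sub>R (ax i + ax j)) = 1 \<and> z \<bullet> half_spin (insert k B) = -1"
proof -
  have nth: "half_spin (insert k B) $ p = (if p \<in> B then - 1/2 else 1/2)" if "p \<in> I6" for p
    using that B(2) by (auto simp: I6_iff)
  have main: ?thesis if pq: "p \<in> I6" "{p, q} = {i, j}" "m \<in> I6" "m \<noteq> p" "m \<noteq> q"
    "half_spin (insert k B) $ p = - s / 2" "half_spin (insert k B) $ m = - s / 2" for p q m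
  proof -
    have ij: "ax i + ax j = ax p + ax q" "p \<noteq> q" using pq(2) i(3) by (auto simp: doubleton_eq_iff add.commute)
    have "s *\<^sub>R (ax p + ax m) \<in> pm_sums I6" using pm_sumsI[OF s pq(1,3)] pq(4) by blast
    moreover have "(s *\<^sub>R (ax p + ax m)) \<bullet> (s *\<^sub>R (ax i + ax j)) = 1"
      unfolding ij(1) using s pq(4,5) ij(2) by (auto simp: inner_add_left inner_add_right)
    moreover have "(s *\<^sub>R (ax p + ax m)) \<bullet> half_spin (insert k B) = -1"
      using s pq(6,7) by (auto simp: inner_add_left simp del: half_spin_nth)
    ultimately show ?thesis by blast
  qed
  have "half_spin (insert k B) $ i + half_spin (insert k B) $ j = 0"
    using 0 s by (auto simp: inner_add_left simp del: half_spin_nth)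
  then have ij: "i \<in> B \<longleftrightarrow> j \<notin> B" unfolding nth[OF i(1)] nth[OF i(2)] by (auto split: if_splits)
  have cB: "card B = 3" "B \<subseteq> I6" using B(1) by (auto simp: triples_I6)
  from s show ?thesis
  proof
    assume s1: "s = 1"
    \<comment> \<open>The entries needed are -s/2: for s = 1 both indices are taken in the triple,
      for s = -1 in its complement. Each has three elements, so one lies outside {i, j}.\<close>
    have "\<exists>m\<in>B. m \<notin> {i, j}" by (rule exists_outside) (use cB card_doubleton_le(1)[of i j] in simp_all)
    then obtain m where m: "m \<in> B" "m \<noteq> i" "m \<noteq> j" by blast
    then have mI: "m \<in> I6" using cB by blast
    have "?thesis" if "p \<in> B" "{p, q} = {i, j}" "p \<in> I6" "m \<noteq> p" "m \<noteq> q" for p q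
      by (rule main[OF that(3,2) mI that(4,5)]) (use that(1) m(1) s1 in simp_all)
    note this[of i j] this[of j i]
    then show ?thesis using ij i m by (cases "i \<in> B") (simp_all add: insert_commute)
  next
    assume s1: "s = -1"
    have "card (I6 - B) = 3" using cB card_I6 by (simp add: card_Diff_subset finite_subset)
    then have "\<exists>m\<in>I6 - B. m \<notin> {i, j}" by (intro exists_outside) (use card_doubleton_le(1)[of i j] in simp_all)
    then obtain m where m: "m \<in> I6" "m \<notin> B" "m \<noteq> i" "m \<noteq> j" by blast
    have "?thesis" if "p \<notin> B" "{p, q} = {i, j}" "p \<in> I6" "m \<noteq> p" "m \<noteq> q" for p q
      by (rule main[OF that(3,2) m(1) that(4,5)]) (use that(1) nth[OF that(3)] nth[OF m(1)] m(2) s1 in simp_all)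
    note this[of i j] this[of j i]
    then show ?thesis using ij i m by (cases "i \<in> B") (simp_all add: insert_commute)
  qed
qed

text \<open>Pairs of opposite sign are joined by a pair, of equal sign by a spin root; two spin
  roots are joined by exchanging one index. A spin root and a pair are settled by
  \<open>pair_spin_neighbour\<close>.\<close>

lemma S72_connecting: "\<forall>x\<in>S72. \<forall>y\<in>S72. y \<bullet> x = 0 \<longrightarrow> (\<exists>z\<in>S72. z \<bullet> x = 1 \<and> z \<bullet> y = -1)"
proof (intro ballI impI)
  fix x y assume "x \<in> S72" "y \<in> S72" and ort: "y \<bullet> x = 0"
  from \<open>x \<in> S72\<close> show "\<exists>z\<in>S72. z \<bullet> x = 1 \<and> z \<bullet> y = -1"
  proof (cases rule: S72_cases)
    case (pair s i j)
    note x = pair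
    from \<open>y \<in> S72\<close> show ?thesis
    proof (cases rule: S72_cases)
      case (pair t k l)
      have d: "i \<noteq> k" "i \<noteq> l" "j \<noteq> k" "j \<noteq> l"
        using ort x pair by (auto simp: inner_add_left inner_add_right split: if_splits)
      show ?thesis
      proof (cases "s = t")
        case False
        have "s *\<^sub>R (ax i + ax k) \<in> S72" using pm_sumsI x pair d S72I by blast
        moreover have "(s *\<^sub>R (ax i + ax k)) \<bullet> x = 1" "(s *\<^sub>R (ax i + ax k)) \<bullet> y = -1"
          using x pair d False by (auto simp: inner_add_left inner_add_right)
        ultimately show ?thesis by blast
      next
        case True
        have "\<exists>m\<in>I6. m \<notin> {i, j, k, l}"
          by (rule exists_outside) (use card_doubleton_le(3)[of i j k l] card_I6 in simp_all)
        then obtain m where m: "m \<in> I6" "m \<noteq> i" "m \<noteq> j" "m \<noteq> k" "m \<noteq> l" by blast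
        \<comment> \<open>The minus signs go to the indices of y if s = 1 and to those of x if s =
          -1; \<open>m\<close> only fills up the triple.\<close>
        define B where "B = (if s = 1 then {k, l, m} else {i, j, m})"
        have "B \<in> triples" using x pair d m by (simp add: B_def triples_I6)
        then have "half_spin (insert 7 B) \<in> S72" using S72I_spin by blast
        moreover have nth: "half_spin (insert 7 B) $ p = (if p \<in> B then - 1/2 else 1/2)" if "p \<in> I6" for p
          using that by (auto simp: I6_iff)
        have "half_spin (insert 7 B) \<bullet> x = 1" "half_spin (insert 7 B) \<bullet> y = -1"
          using x(1,4) pair(1,4) d m True
          unfolding x(5) pair(5) inner_scaleR_right inner_add_right inner_ax nth[OF x(2)] nth[OF x(3)]
            nth[OF pair(2)] nth[OF pair(3)] by (auto simp: B_def)
        ultimately show ?thesis by blast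
      qed
    next
      case (spin k B)
      show ?thesis using pair_spin_neighbour[OF x(1-4) spin(1,2)] ort x(5) spin(3) S72I inner_commute by metis
    qed
  next
    case (spin k B)
    note x = spin
    from \<open>y \<in> S72\<close> show ?thesis
    proof (cases rule: S72_cases)
      case (pair s i j)
      have "(s *\<^sub>R (ax i + ax j)) \<bullet> half_spin (insert k B) = 0" using ort pair(5) x(3) by simp
      then obtain z where z: "z \<in> pm_sums I6" "z \<bullet> y = 1" "z \<bullet> x = -1"
        using pair_spin_neighbour[OF pair(1-4) x(1,2)] pair(5) x(3) by blast
      then obtain r p q where r: "r = 1 \<or> r = -1" "p \<in> I6" "q \<in> I6" "p \<noteq> q" "z = r *\<^sub>R (ax p + ax q)"
        unfolding pm_sums_def by blast
      \<comment> \<open>\<open>pair_spin_neighbour\<close> was applied with x and y exchanged, so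
        its vector has the opposite signs and must be negated.\<close>
      have "- r = 1 \<or> - r = -1" using r(1) by auto
      then have "(- r) *\<^sub>R (ax p + ax q) \<in> pm_sums I6" by (rule pm_sumsI[OF _ r(2-4)])
      then have "- z \<in> S72" using r(5) S72I by simp
      then show ?thesis using z by (intro bexI[of _ "- z"]) simp_all
    next
      case (spin k' B')
      have c: "card B = 3" "card B' = 3" "B \<subseteq> I6" "B' \<subseteq> I6" using x(1) spin(1) by (auto simp: triples_I6)
      have "real (card (B \<inter> B')) > 0"
        using ort triples_inner[OF spin(1) x(1) spin(2) x(2)] x(3) spin(3) by (auto simp: Int_commute split: if_splits)
      then have pos: "card (B \<inter> B') > 0" by simp
      then obtain i where i: "i \<in> B" "i \<in> B'" by (metis Int_iff card_gt_0_iff equals0I)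
      have fin: "finite B" "finite B'" by simp_all
      have "card (B \<union> B') < 6" using card_Un_Int[OF fin] c pos by simp
      then have "\<exists>j\<in>I6. j \<notin> B \<union> B'" by (intro exists_outside) (simp_all add: card_I6)
      then obtain j where j: "j \<in> I6" "j \<notin> B" "j \<notin> B'" by blast
      have ik: "i \<noteq> k" "i \<noteq> k'" "j \<noteq> k" "j \<noteq> k'" using triple_index[OF x(1) i(1)] j(1) x(2) spin(2) by (auto simp: I6_iff)
      \<comment> \<open>Orthogonality makes the triples overlap, so some \<open>i\<close> lies in
        both and some \<open>j\<close> in neither. Exchanging them adds \<open>ax i - ax j\<close>,
        which lowers the products with x and with y by 1 each.\<close>
      let ?z = "half_spin (insert k (insert j (B - {i})))"
      have "insert j (B - {i}) \<in> triples" using c i j by (simp add: triples_I6) blast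
      then have zS: "?z \<in> S72" using S72I_spin x(2) by blast
      have "insert k (insert j (B - {i})) = insert j (insert k B - {i})" using ik by auto
      then have z: "?z = x + ax i - ax j"
        using half_spin_exchange[of i "insert k B" j] i j ik x(3) by simp
      have "x \<bullet> x = 2" using x(3) half_spin_norm by simp
      moreover have "x \<bullet> y = 0" using ort by (simp add: inner_commute)
      moreover have "x $ i = -1/2" "x $ j = 1/2" "y $ i = -1/2" "y $ j = 1/2"
        using i j ik x(3) spin(3) by simp_all
      ultimately have "?z \<bullet> x = 1" "?z \<bullet> y = -1"
        unfolding z by (simp_all add: inner_add_left inner_diff_left)
      then show ?thesis using zS by blast
    qed
  qed
qed

text \<open>For a pair take a disjoint pair; for a spin root take one index inside its triple and
  one outside, where the entries cancel.\<close>

lemma S72_orthogonal: "\<forall>x\<in>S72. \<exists>y\<in>S72. y \<bullet> x = 0"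
proof
  fix x assume "x \<in> S72"
  then show "\<exists>y\<in>S72. y \<bullet> x = 0"
  proof (cases rule: S72_cases)
    case (pair s i j)
    have "\<exists>k\<in>I6. k \<notin> {i, j}" by (rule exists_outside) (use card_doubleton_le(1)[of i j] card_I6 in simp_all)
    then obtain k where k: "k \<in> I6" "k \<noteq> i" "k \<noteq> j" by blast
    have "\<exists>l\<in>I6. l \<notin> {i, j, k}" by (rule exists_outside) (use card_doubleton_le(2)[of i j k] card_I6 in simp_all)
    then obtain l where l: "l \<in> I6" "l \<noteq> i" "l \<noteq> j" "k \<noteq> l" by blast
    have "1 *\<^sub>R (ax k + ax l) \<in> S72" using pm_sumsI[of 1 k I6 l] k l S72I by simp
    moreover have "(1 *\<^sub>R (ax k + ax l)) \<bullet> x = 0" using k l pair by (simp add: inner_add_left inner_add_right)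
    ultimately show ?thesis by blast
  next
    case (spin k B)
    have c: "card B = 3" "B \<subseteq> I6" using spin(1) by (auto simp: triples_I6)
    then have "B \<noteq> {}" "\<exists>j\<in>I6. j \<notin> B" using exists_outside[of B I6] card_I6 by auto
    then obtain i j where ij: "i \<in> B" "i \<in> I6" "j \<in> I6" "j \<notin> B" using c(2) by blast
    then have "i \<noteq> j" "i \<noteq> k" "j \<noteq> k" using spin(2) by (auto simp: I6_iff)
    then have "1 *\<^sub>R (ax i + ax j) \<in> S72" "(1 *\<^sub>R (ax i + ax j)) \<bullet> x = 0"
      using pm_sumsI[of 1 i I6 j] ij S72I spin(3) by (simp_all add: inner_add_left)
    then show ?thesis by blast
  qed
qed

lemma S72_system: "rich_graded_root_system E7_roots b72 \<and> graded_root_system.S E7_roots b72 = S72"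
proof -
  have span: "\<exists>x\<in>S72. x \<bullet> \<gamma> \<noteq> 0" if g: "\<gamma> \<in> E7_roots" for \<gamma>
  proof (rule ccontr)
    assume "\<not> (\<exists>x\<in>S72. x \<bullet> \<gamma> \<noteq> 0)"
    then have z: "x \<bullet> \<gamma> = 0" if "x \<in> S72" for x using that by blast
    have i6: "\<gamma> $ i = 0" if "i \<in> I6" for i
    proof (rule pairs_vanish[OF _ _ that])
      show "3 \<le> card I6" by (simp add: card_I6)
      show "\<gamma> $ i + \<gamma> $ j = 0" if "i \<in> I6" "j \<in> I6" "i \<noteq> j" for i j
        using z[OF S72I[OF pm_sumsI[of 1 i I6 j]]] that by (simp add: inner_add_left)
    qed
    \<comment> \<open>The pairs only control the first six entries; one spin root compares the
      entries at 7 and 8.\<close>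
    have "{1, 2, 3} \<in> triples" by (simp add: triples_def)
    then have "half_spin {7, 1, 2, 3} \<bullet> \<gamma> = 0" using z S72I_spin[of _ 7] by blast
    moreover have "half_spin {7, 1, 2, 3} \<bullet> \<gamma> = (\<Sum>k\<in>{7, 8}. half_spin {7, 1, 2, 3} $ k * \<gamma> $ k)"
      unfolding inner_vec_def by (rule sum.mono_neutral_cong_right) (simp_all add: i6 I6_iff)
    ultimately have "\<gamma> $ 8 - \<gamma> $ 7 = 0" by simp
    moreover have g': "\<gamma> $ 7 + \<gamma> $ 8 = 0" "\<gamma> \<bullet> \<gamma> = 2" using g by (simp_all add: E7_roots_eq)
    ultimately have "\<gamma> $ 7 = 0" "\<gamma> $ 8 = 0" by linarith+
    then have "\<gamma> $ i = 0" for i using i6[of i] I6_iff by metis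
    then have "\<gamma> = 0" by (simp add: vec_eq_iff)
    then show False using g'(2) by simp
  qed
  show ?thesis
    by (rule rich_graded_root_systemI[OF simply_laced_E7 b72_int S72_roots S72_connecting S72_orthogonal])
      (use span in blast)
qed

section \<open>The five cases together\<close>

lemma odd_roots_system:
  assumes "(l, i) \<in> {(6, 2), (7, 1), (7, 2), (8, 1), (8, 2)}"
  shows "\<exists>b. rich_graded_root_system (E_roots l) b \<and> graded_root_system.S (E_roots l) b = odd_roots l i"
proof -
  from assms consider "l = 6" "i = 2" | "l = 7" "i = 1" | "l = 7" "i = 2" | "l = 8" "i = 1" | "l = 8" "i = 2"
    by auto
  then show ?thesis
    by cases (use S62_system S71_system S72_system S81_system S82_system in \<open>auto simp: E_roots_def odd_roots_def\<close>)
qed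

theorem proposition6p18:
  fixes cs :: "complex \<Rightarrow> 'g::euclidean_space \<Rightarrow> 'g" and br :: "'g \<Rightarrow> 'g \<Rightarrow> 'g"
    and u0 t0 h :: "'g set" and \<rho> :: "real^8 \<Rightarrow> 'g \<Rightarrow> complex"
    and l i :: nat and \<alpha>\<^sub>0 :: "real^8"
  assumes "(l, i) \<in> {(6, 2), (7, 1), (7, 2), (8, 1), (8, 2)}"
    and "compact_root_data cs br u0 t0 h (E_roots l) \<rho>"
    and "\<alpha>\<^sub>0 \<in> odd_roots l i"
  shows "maximal_in (compact_root_data.QQ_s cs br u0 h (E_roots l) \<rho>) (Q_set l i \<alpha>\<^sub>0) \<and>
    Q_set l i \<alpha>\<^sub>0 \<notin> compact_root_data.QQ_\<Upsilon> cs br u0 t0 h (E_roots l) \<rho>"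
proof -
  obtain b where b: "rich_graded_root_system (E_roots l) b" "graded_root_system.S (E_roots l) b = odd_roots l i"
    using odd_roots_system[OF assms(1)] by blast
  interpret L: compact_root_data cs br u0 t0 h "E_roots l" \<rho> by (rule assms(2))
  interpret R: rich_graded_root_system "E_roots l" b by (rule b(1))
  interpret LR: rich_graded_root_data cs br u0 t0 h "E_roots l" \<rho> b by unfold_locales
  have "Q_set l i \<alpha>\<^sub>0 = R.Q \<alpha>\<^sub>0" by (simp add: Q_set_def R.Q_def b(2))
  then show ?thesis using LR.Q_theorem[of \<alpha>\<^sub>0] assms(3) b(2) by simp
qed

end
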